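(* Let $N\ge1$, $\tau>0$, let $\sigma=\sum_{j=1}^N\mathtt{p}_j^*(a_j\mu)\in\Omega^2(\mathbb{T}^{2N})$ be non-resonant in period $\tau$, let $V\in C^\infty(\mathbb{S}_\tau\times\mathbb{T}^{2N},\mathbb{R})$ be such that $(\sigma,V,\tau)$ is non-degenerate, and let $A>0$ with $A\ge\max_j\|a_j\|_\infty$. There exists $\varepsilon_0>0$ such that if $\{J_t\}_{t\in\mathbb{S}_\tau}\subset\mathcal{U}(\sigma,A,\varepsilon_0)$, then for any pair $(C,E)\in\mathbb{R}\times[0,\infty)$ there exists a compact set $K(A,C,E)\subseteq T^*\mathbb{T}^{2N}$ with the following property. Suppose $h\in\mathbb{Z}^{2N}$ and $[w^\pm,z^\pm]\in\mathrm{Crit}^h_\tau(\mathcal{A}_{\sigma,V})$ satisfy $$\mathcal{A}_{\sigma,V}([w^-,z^-])\le C,\qquad \mathcal{A}_{\sigma,V}([w^-,z^-])-\mathcal{A}_{\sigma,V}([w^+,z^+])\le E.$$ Then every $u\in\mathcal{M}^h_\tau([w^-,z^-],[w^+,z^+],\sigma,V,\{J_t\})$ satisfies $u(\mathbb{R}\times\mathbb{S}_\tau)\subseteq K(A,C,E)$.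
   Context: Setting. $\mathbb{T}^{2N}=\mathbb{R}^{2N}/\mathbb{Z}^{2N}=\prod_{j=1}^N\mathbb{T}^2_j$ with flat metric, projections $\mathtt{p}_j:\mathbb{T}^{2N}\to\mathbb{T}^2_j=\mathbb{T}^2$, universal cover $\mathtt{q}:\mathbb{R}^{2N}\to\mathbb{T}^{2N}$; $\mu=dx_1\wedge dx_2$ on $\mathbb{T}^2$; $\mathbb{S}_\tau=\mathbb{R}/\tau\mathbb{Z}$. $\sigma=\sum_j\mathtt{p}_j^*(a_j\mu)$, $a_j\in C^\infty(\mathbb{T}^2,\mathbb{R})$, is non-resonant in period $\tau$ if for each $j$ there is $k_j\in\mathbb{Z}$ with $\frac{2\pi k_j}{\tau}<a_j(x)<\frac{2\pi(k_j+1)}{\tau}$ for all $x\in\mathbb{T}^2$. On $T^*\mathbb{T}^{2N}=\mathbb{T}^{2N}\times\mathbb{R}^{2N}$ (projection $\pi$, coordinates $(x,p)$): $\lambda=\sum p_idx_i$, $\omega_\sigma=d\lambda+\pi^*\sigma$, $H_V=\frac12|p|^2+V(t,x)$, $\omega_\sigma(X_{\sigma,V},\cdot)=-dH_V$ with flow $\phi^t_{\sigma,V}$; $\mathcal{P}^h_\tau(\sigma,V)$ is the set of solutions $w:\mathbb{S}_\tau\to T^*\mathbb{T}^{2N}$ of $\partial_tw=X_{\sigma,V}(t,w)$ in class $h\in\mathbb{Z}^{2N}=\pi_1(T^*\mathbb{T}^{2N})$. $(\sigma,V,\tau)$ is non-degenerate if $\det(D\phi^\tau_{\sigma,V}(w(0))-\mathrm{Id})\ne0$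 for all $h$ and all $w\in\mathcal{P}_\tau^h(\sigma,V)$. Action functional. Let $\gamma_h(t)=\mathtt{q}(th)$. $\mathbb{L}^h_\tau(T^*\mathbb{T}^{2N},\sigma)$ is the set of classes $[w,z]$ where $w:\mathbb{S}_\tau\to T^*\mathbb{T}^{2N}$ is a smooth loop in class $h$, $z:[0,1]\times\mathbb{S}_\tau\to\mathbb{T}^{2N}$ satisfies $z(0,t)=\gamma_h(t/\tau)$, $z(1,t)=\pi(w(t))$, and $(w,z_0)\sim(w,z_1)$ iff $\int z_0^*\sigma=\int z_1^*\sigma$. Define $\mathcal{A}_{\sigma,V}([w,z])=\int w^*\lambda-\int_0^\tau H_V(t,w)\,dt+\int_{[0,1]\times\mathbb{S}_\tau}z^*\sigma$. Its critical set is $\mathrm{Crit}^h_\tau(\mathcal{A}_{\sigma,V})=\{[w,z]:w\in\mathcal{P}^h_\tau(\sigma,V)\}$. Almost complex structures. In the splitting $T_{(x,p)}T^*\mathbb{T}^{2N}=\mathbb{R}^{2N}\oplus\mathbb{R}^{2N}$ (horizontal, vertical) let $\mathtt{J}_A(\xi^h,\xi^v)=(-\frac1A\xi^v,A\xi^h)$. $\mathcal{U}(\sigma,A,\varepsilon)$ is the set of almost complex structures $J$ on $T^*\mathbb{T}^{2N}$ with $d\lambda(J\cdot,\cdot)$ symmetric positive definite, $\omega_\sigma(J\xi,\xi)>\frac14d\lambda(J\xi,\xi)$ for all $\xi\neq0$, and $\|J-\mathtt{J}_A\|_\infty<\varepsilon$ (norm from the product flat metric). Families $\{J_t\}_{t\in\mathbb{S}_\tau}$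 are smooth. Moduli spaces. $\mathcal{M}^h_\tau([w^-,z^-],[w^+,z^+],\sigma,V,\{J_t\})$ is the set of smooth $u:\mathbb{R}\times\mathbb{S}_\tau\to T^*\mathbb{T}^{2N}$ with $\partial_su+J_t(u)(\partial_tu-X_{\sigma,V}(t,u))=0$, with $\lim_{s\to\pm\infty}u(s,t)=w^\pm(t)$ and $\lim_{s\to\pm\infty}\partial_su(s,t)=0$ uniformly in $t$, and with $[w^+,z^-\sharp(\pi\circ\bar u)]=[w^+,z^+]$, where $\bar u:[0,1]\times\mathbb{S}_\tau\to T^*\mathbb{T}^{2N}$ is the compactification of $u$ and $\sharp$ is concatenation of cylinders in the first variable. *)

theory Defs
  imports "HOL-Analysis.Analysis"
begin

section \<open>Smooth maps on open subsets of normed spaces\<close>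

primrec Ck_on :: "'a::real_normed_vector set \<Rightarrow> nat \<Rightarrow> ('a \<Rightarrow> 'b::real_normed_vector) \<Rightarrow> bool" where
  "Ck_on S 0 f \<longleftrightarrow> continuous_on S f"
| "Ck_on S (Suc k) f \<longleftrightarrow> (\<forall>x\<in>S. f differentiable (at x)) \<and>
     (\<forall>v. Ck_on S k (\<lambda>x. frechet_derivative f (at x) v))"

text \<open>Meant for open \<open>S\<close> only.\<close>

definition smooth_on :: "'a::real_normed_vector set \<Rightarrow> ('a \<Rightarrow> 'b::real_normed_vector) \<Rightarrow> bool" where
  "smooth_on S f \<longleftrightarrow> (\<forall>k. Ck_on S k f)"

section \<open>The torus \<open>\<T>\<^sup>2 = \<real>\<^sup>2 / \<int>\<^sup>2\<close> with its flat metric\<close>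

definition lattice2 :: "(real^2) set" where
  "lattice2 = {v. \<forall>i. v $ i \<in> \<int>}"

lemma lattice2_zero: "0 \<in> lattice2"
  and lattice2_add: "u \<in> lattice2 \<Longrightarrow> v \<in> lattice2 \<Longrightarrow> u + v \<in> lattice2"
  and lattice2_minus: "v \<in> lattice2 \<Longrightarrow> - v \<in> lattice2"
  by (auto simp: lattice2_def)

lemma lattice2_diff: "u \<in> lattice2 \<Longrightarrow> v \<in> lattice2 \<Longrightarrow> u - v \<in> lattice2"
  by (auto simp: lattice2_def)

lemma closed_lattice2: "closed lattice2"
proof -
  have c: "closed ((\<lambda>v::real^2. v $ i) -` \<int>)" for i
    by (rule closed_vimage) (auto intro: continuous_intros)
  have eq: "lattice2 = (\<Inter>i. (\<lambda>v. v $ i) -` \<int>)"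
    by (auto simp: lattice2_def)
  show ?thesis unfolding eq by (intro closed_INT ballI c)
qed

quotient_type torus2 = "real^2" / "\<lambda>x y. x - y \<in> lattice2"
  morphisms rep_torus2 q2
proof (rule equivpI)
  show "reflp (\<lambda>x y. x - y \<in> lattice2)"
    by (simp add: reflp_def lattice2_zero)
  show "symp (\<lambda>x y. x - y \<in> lattice2)"
    using lattice2_minus by (force simp: symp_def)
  show "transp (\<lambda>x y. x - y \<in> lattice2)"
    using lattice2_add by (force simp: transp_def)
qed

lemma infdist_lattice2_translate:
  assumes "x - y \<in> lattice2"
  shows "infdist x lattice2 = infdist y lattice2"
proof -
  have le: "infdist u lattice2 \<le> infdist v lattice2" if "u - v \<in> lattice2" for u v
  proof -
    have ne: "lattice2 \<noteq> {}" using lattice2_zero by auto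
    have "infdist u lattice2 \<le> dist v b" if "b \<in> lattice2" for b
      using infdist_le[of "b + (u - v)" lattice2 u] lattice2_add[OF that \<open>u - v \<in> lattice2\<close>]
      by (simp add: dist_norm algebra_simps)
    then show ?thesis
      unfolding infdist_notempty[OF ne, of v] by (intro cINF_greatest ne) auto
  qed
  show ?thesis
    using le[OF assms] le[of y x] lattice2_minus[OF assms] by simp
qed

lemma infdist_lattice2_add:
  "infdist (x + y) lattice2 \<le> infdist x lattice2 + infdist y lattice2"
proof -
  have ne: "lattice2 \<noteq> {}" using lattice2_zero by auto
  obtain b where b: "b \<in> lattice2" "infdist y lattice2 = dist y b"
    using infdist_attains_inf[OF closed_lattice2 ne] by blast
  have "infdist (x + y) lattice2 \<le> infdist (x + b) lattice2 + dist (x + y) (x + b)"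
    by (rule infdist_triangle)
  also have "infdist (x + b) lattice2 = infdist x lattice2"
    using b by (intro infdist_lattice2_translate) simp
  finally show ?thesis using b by simp
qed

lemma infdist_lattice2_minus: "infdist (- x) lattice2 = infdist x lattice2"
proof -
  have ne: "lattice2 \<noteq> {}" using lattice2_zero by auto
  have le: "infdist (- x) lattice2 \<le> infdist x lattice2" for x
  proof -
    obtain b where b: "b \<in> lattice2" "infdist x lattice2 = dist x b"
      using infdist_attains_inf[OF closed_lattice2 ne] by blast
    show ?thesis
      using infdist_le[OF lattice2_minus[OF b(1)], of "- x"] b(2) by (simp add: dist_norm norm_minus_commute)
  qed
  show ?thesis using le[of x] le[of "- x"] by simp
qed

text \<open>The distance is the minimal Euclidean distance between lifts. The induced topology
  is the quotient topology, see \<open>open_torus2_iff\<close> below.\<close>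

instantiation torus2 :: metric_space
begin

lift_definition dist_torus2 :: "torus2 \<Rightarrow> torus2 \<Rightarrow> real"
  is "\<lambda>x y. infdist (x - y) lattice2"
proof (rule infdist_lattice2_translate)
  fix x x' y y' :: "real^2"
  assume "x - x' \<in> lattice2" "y - y' \<in> lattice2"
  then have "(x - x') - (y - y') \<in> lattice2" by (rule lattice2_diff)
  then show "(x - y) - (x' - y') \<in> lattice2" by (simp add: algebra_simps)
qed

definition uniformity_torus2 :: "(torus2 \<times> torus2) filter" where
  "uniformity_torus2 = (INF e\<in>{0<..}. principal {(x, y). dist x y < e})"

definition open_torus2 :: "torus2 set \<Rightarrow> bool" where
  "open_torus2 U \<longleftrightarrow> (\<forall>x\<in>U. eventually (\<lambda>(x', y). x' = x \<longrightarrow> y \<in> U) uniformity)"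

instance
proof
  fix x y z :: torus2
  have ne: "lattice2 \<noteq> {}" using lattice2_zero by auto
  show "dist x y = 0 \<longleftrightarrow> x = y"
    by transfer (use in_closed_iff_infdist_zero[OF closed_lattice2 ne] in auto)
  show "dist x y \<le> dist x z + dist y z"
  proof transfer
    fix x y z :: "real^2"
    show "infdist (x - y) lattice2 \<le> infdist (x - z) lattice2 + infdist (y - z) lattice2"
      using infdist_lattice2_add[of "x - z" "z - y"] infdist_lattice2_minus[of "y - z"] by simp
  qed
qed (simp_all only: uniformity_torus2_def open_torus2_def)

end

lemma dist_q2: "dist (q2 x) (q2 y) = infdist (x - y) lattice2"
  by transfer simp

lemma q2_eq_iff: "q2 x = q2 y \<longleftrightarrow> x - y \<in> lattice2"
  by (simp add: torus2.abs_eq_iff)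

lemma surj_q2: "surj q2"
proof (rule surjI)
  fix p show "q2 (rep_torus2 p) = p"
    by (rule Quotient3_abs_rep[OF Quotient3_torus2])
qed

lemma open_torus2_iff:
  fixes U :: "torus2 set"
  shows "open U \<longleftrightarrow> open (q2 -` U)"
proof
  have ne: "lattice2 \<noteq> {}" using lattice2_zero by auto
  have le: "dist (q2 x) (q2 y) \<le> dist x y" for x y
    unfolding dist_q2 using infdist_le[OF lattice2_zero, of "x - y"] by (simp add: dist_norm)
  have "1-lipschitz_on UNIV q2"
    by (rule lipschitz_onI) (simp_all add: le)
  then have "continuous_on UNIV q2"
    by (rule lipschitz_on_continuous_on)
  then show "open U \<Longrightarrow> open (q2 -` U)"
    by (simp add: open_vimage)
  assume op: "open (q2 -` U)"
  show "open U"
    unfolding open_dist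
  proof
    fix p assume "p \<in> U"
    obtain x where x: "p = q2 x" using surjD[OF surj_q2] by blast
    have "\<exists>e>0. \<forall>y. dist y x < e \<longrightarrow> y \<in> q2 -` U"
      using op[unfolded open_dist] \<open>p \<in> U\<close> x by (drule_tac bspec[where x = x]) simp_all
    then obtain e where e: "e > 0" "\<And>y. dist y x < e \<Longrightarrow> q2 y \<in> U"
      unfolding vimage_eq by blast
    have "r \<in> U" if "dist r p < e" for r
    proof -
      obtain y where y: "r = q2 y" using surjD[OF surj_q2] by blast
      obtain b where b: "b \<in> lattice2" "infdist (y - x) lattice2 = dist (y - x) b"
        using infdist_attains_inf[OF closed_lattice2 ne] by blast
      have "dist (y - b) x < e" using that b by (simp add: x y dist_q2 dist_norm algebra_simps)
      moreover have "q2 (y - b) = q2 y" using b by (simp add: q2_eq_iff lattice2_minus)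
      ultimately show ?thesis using e(2)[of "y - b"] y by simp
    qed
    then show "\<exists>e>0. \<forall>y. dist y p < e \<longrightarrow> y \<in> U" using e(1) by auto
  qed
qed

section \<open>The torus \<open>\<T>\<^sup>2\<^sup>N\<close> and its cotangent bundle\<close>

text \<open>\<open>N\<close> is the cardinality of the index type \<open>'n\<close>; the projections onto the factors \<open>\<T>\<^sup>2\<close> are the
  components \<open>x $ j\<close>. The cotangent bundle is trivialised, and \<open>'n tangent\<close> is its tangent space
  at any point, split into the horizontal and the vertical part. Loops \<open>\<S>\<^sub>\<tau> \<rightarrow> X\<close> are
  \<open>\<tau>\<close>-periodic maps \<open>\<real> \<rightarrow> X\<close>, and similarly for further factors \<open>\<S>\<^sub>\<tau>\<close> in a domain.\<close>

type_synonym 'n vect = "real^2^'n"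
type_synonym 'n torus = "torus2^'n"
type_synonym 'n phase = "'n torus \<times> 'n vect"
type_synonym 'n tangent = "'n vect \<times> 'n vect"

definition torus_cover :: "'n::finite vect \<Rightarrow> 'n torus" where
  "torus_cover x = (\<chi> j. q2 (x $ j))"

lemma torus_cover_eq_iff:
  "torus_cover x = torus_cover y \<longleftrightarrow> (\<forall>j. x $ j - y $ j \<in> lattice2)"
  unfolding torus_cover_def by (subst vec_eq_iff) (simp add: q2_eq_iff)

definition phase_cover :: "'n::finite tangent \<Rightarrow> 'n phase" where
  "phase_cover v = (torus_cover (fst v), snd v)"

definition of_int_vect :: "int^2^'n \<Rightarrow> 'n::finite vect" where
  "of_int_vect h = (\<chi> j i. of_int (h $ j $ i))"

text \<open>Smoothness and velocities of maps into the torus are those of local lifts. A lift which is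
  differentiable, hence continuous, at the point is unique up to a constant.\<close>

definition smooth_torus_on :: "'a::real_normed_vector set \<Rightarrow> ('a \<Rightarrow> 'n::finite torus) \<Rightarrow> bool" where
  "smooth_torus_on S f \<longleftrightarrow>
     (\<forall>x\<in>S. \<exists>U F. open U \<and> x \<in> U \<and> smooth_on U F \<and> (\<forall>y\<in>U. f y = torus_cover (F y)))"

definition smooth_phase_on :: "'a::real_normed_vector set \<Rightarrow> ('a \<Rightarrow> 'n::finite phase) \<Rightarrow> bool" where
  "smooth_phase_on S f \<longleftrightarrow> smooth_torus_on S (fst \<circ> f) \<and> smooth_on S (snd \<circ> f)"

definition has_torus_vel :: "(real \<Rightarrow> 'n::finite torus) \<Rightarrow> 'n vect \<Rightarrow> real \<Rightarrow> bool" where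
  "has_torus_vel c v t \<longleftrightarrow>
     (\<exists>C. (C has_vector_derivative v) (at t) \<and> (\<forall>\<^sub>F r in nhds t. c r = torus_cover (C r)))"

lemma has_torus_vel_unique:
  assumes "has_torus_vel c v t" "has_torus_vel c v' t"
  shows "v = v'"
proof -
  obtain C where C: "(C has_vector_derivative v) (at t)" "\<forall>\<^sub>F r in nhds t. c r = torus_cover (C r)"
    using assms(1) unfolding has_torus_vel_def by blast
  obtain D where D: "(D has_vector_derivative v') (at t)" "\<forall>\<^sub>F r in nhds t. c r = torus_cover (D r)"
    using assms(2) unfolding has_torus_vel_def by blast
  let ?F = "\<lambda>r. C r - D r"
  have F: "(?F has_vector_derivative (v - v')) (at t)"
    using C(1) D(1) by (rule has_vector_derivative_diff)
  have int: "\<forall>\<^sub>F r in nhds t. \<forall>j i. ?F r $ j $ i \<in> \<int>"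
    using C(2) D(2)
  proof eventually_elim
    case (elim r)
    then have "torus_cover (C r) = torus_cover (D r)" by simp
    then have "C r $ j - D r $ j \<in> lattice2" for j
      unfolding torus_cover_eq_iff by blast
    then show ?case by (simp add: lattice2_def)
  qed
  have "isCont ?F t"
    using F has_vector_derivative_continuous by blast
  then have "(?F \<longlongrightarrow> ?F t) (nhds t)"
    unfolding isCont_def by (subst (asm) tendsto_at_iff_tendsto_nhds)
  then have "\<forall>\<^sub>F r in nhds t. dist (?F r) (?F t) < 1"
    by (rule tendstoD) simp
  with int have "\<forall>\<^sub>F r in nhds t. ?F r = ?F t"
  proof eventually_elim
    case (elim r)
    have "?F r $ j $ i = ?F t $ j $ i" for j i
    proof -
      have "?F t $ j $ i \<in> \<int>" using eventually_nhds_x_imp_x[OF int] by blast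
      then have "?F r $ j $ i - ?F t $ j $ i \<in> \<int>" using elim(1) by (intro Ints_diff) auto
      moreover have "\<bar>?F r $ j $ i - ?F t $ j $ i\<bar> \<le> norm (?F r - ?F t)"
        using component_le_norm_cart[of "(?F r - ?F t) $ j" i] Finite_Cartesian_Product.norm_nth_le[of "?F r - ?F t" j] by simp
      ultimately show ?thesis
        using elim(2) Ints_nonzero_abs_less1[of "?F r $ j $ i - ?F t $ j $ i"] by (simp add: dist_norm)
    qed
    then show ?case by (simp add: vec_eq_iff)
  qed
  then have "\<forall>\<^sub>F r in nhds t. r \<in> UNIV \<longrightarrow> ?F r = (\<lambda>_. ?F t) r"
    by simp
  then have "(?F has_vector_derivative 0) (at t)"
    using has_vector_derivative_cong_ev[of UNIV ?F "\<lambda>_. ?F t" t 0] by simp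
  with F have "v - v' = 0" by (rule vector_derivative_unique_at)
  then show ?thesis by simp
qed

definition torus_vel :: "(real \<Rightarrow> 'n::finite torus) \<Rightarrow> real \<Rightarrow> 'n vect" where
  "torus_vel c t = (THE v. has_torus_vel c v t)"

definition has_phase_vel :: "(real \<Rightarrow> 'n::finite phase) \<Rightarrow> 'n tangent \<Rightarrow> real \<Rightarrow> bool" where
  "has_phase_vel w v t \<longleftrightarrow> has_torus_vel (fst \<circ> w) (fst v) t \<and>
     ((snd \<circ> w) has_vector_derivative snd v) (at t)"

definition phase_vel :: "(real \<Rightarrow> 'n::finite phase) \<Rightarrow> real \<Rightarrow> 'n tangent" where
  "phase_vel w t = (THE v. has_phase_vel w v t)"

text \<open>Differential of a function on \<open>T\<^sup>*\<T>\<^sup>2\<^sup>N\<close>, computed at an arbitrary lift of the point.\<close>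

definition phase_diff :: "('n::finite phase \<Rightarrow> real) \<Rightarrow> 'n phase \<Rightarrow> 'n tangent \<Rightarrow> real" where
  "phase_diff F y = frechet_derivative (F \<circ> phase_cover) (at (inv phase_cover y))"

definition phase_map_diff :: "('n::finite phase \<Rightarrow> 'n phase) \<Rightarrow> 'n phase \<Rightarrow> 'n tangent \<Rightarrow> 'n tangent" where
  "phase_map_diff \<phi> y = (THE D. \<exists>b \<Phi>. phase_cover b = y \<and> (\<Phi> has_derivative D) (at b) \<and>
     (\<forall>\<^sub>F c in nhds b. \<phi> (phase_cover c) = phase_cover (\<Phi> c)))"

text \<open>Determinant of a linear endomorphism: the Leibniz formula for its matrix in the standard
  basis.\<close>

definition endo_det :: "('a::euclidean_space \<Rightarrow> 'a) \<Rightarrow> real" where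
  "endo_det f = (\<Sum>\<pi> | \<pi> permutes Basis. of_int (sign \<pi>) * (\<Prod>b\<in>Basis. f b \<bullet> \<pi> b))"

section \<open>The magnetic Hamiltonian system\<close>

definition area_form :: "real^2 \<Rightarrow> real^2 \<Rightarrow> real" where
  "area_form v w = v $ 1 * w $ 2 - v $ 2 * w $ 1"

definition magnetic_form ::
    "('n::finite \<Rightarrow> torus2 \<Rightarrow> real) \<Rightarrow> 'n torus \<Rightarrow> 'n vect \<Rightarrow> 'n vect \<Rightarrow> real" where
  "magnetic_form a x v w = (\<Sum>j\<in>UNIV. a j (x $ j) * area_form (v $ j) (w $ j))"

definition smooth_coeffs :: "('n::finite \<Rightarrow> torus2 \<Rightarrow> real) \<Rightarrow> bool" where
  "smooth_coeffs a \<longleftrightarrow> (\<forall>j. smooth_on UNIV (a j \<circ> q2))"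

definition non_resonant :: "('n::finite \<Rightarrow> torus2 \<Rightarrow> real) \<Rightarrow> real \<Rightarrow> bool" where
  "non_resonant a \<tau> \<longleftrightarrow> (\<forall>j. \<exists>k::int. \<forall>x.
     2 * pi * of_int k / \<tau> < a j x \<and> a j x < 2 * pi * (of_int k + 1) / \<tau>)"

definition smooth_potential :: "real \<Rightarrow> (real \<Rightarrow> 'n::finite torus \<Rightarrow> real) \<Rightarrow> bool" where
  "smooth_potential \<tau> V \<longleftrightarrow> (\<forall>t. V (t + \<tau>) = V t) \<and> smooth_on UNIV (\<lambda>(t, x). V t (torus_cover x))"

text \<open>\<open>d\<lambda> = \<Sum>\<^sub>i dp\<^sub>i \<and> dx\<^sub>i\<close> for \<open>\<lambda> = \<Sum>\<^sub>i p\<^sub>i dx\<^sub>i\<close>\<close>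

definition dlambda :: "'n::finite tangent \<Rightarrow> 'n tangent \<Rightarrow> real" where
  "dlambda \<xi> \<eta> = snd \<xi> \<bullet> fst \<eta> - fst \<xi> \<bullet> snd \<eta>"

definition omega ::
    "('n::finite \<Rightarrow> torus2 \<Rightarrow> real) \<Rightarrow> 'n phase \<Rightarrow> 'n tangent \<Rightarrow> 'n tangent \<Rightarrow> real" where
  "omega a y \<xi> \<eta> = dlambda \<xi> \<eta> + magnetic_form a (fst y) (fst \<xi>) (fst \<eta>)"

lemma omega_nondegenerate:
  fixes l :: "'n::finite tangent \<Rightarrow> real"
  assumes "linear l"
  shows "\<exists>!X. \<forall>\<eta>. omega a y X \<eta> = - l \<eta>"
proof (rule ex_ex1I)
  define T where "T X = (\<chi> j. a j (fst y $ j) *\<^sub>R (vector [- (X $ j $ 2), X $ j $ 1] :: real^2))" for X :: "'n vect"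
  have T: "magnetic_form a (fst y) X Y = T X \<bullet> Y" for X Y
    by (auto simp: magnetic_form_def area_form_def T_def inner_vec_def sum_2 algebra_simps intro!: sum.cong)
  have om: "omega a y X \<eta> = (snd X + T (fst X), - fst X) \<bullet> \<eta>" for X \<eta>
    by (simp add: omega_def dlambda_def T inner_prod_def inner_add_left)
  define Y where "Y = adjoint l 1"
  have l: "l \<eta> = Y \<bullet> \<eta>" for \<eta>
    using adjoint_works[OF assms, of \<eta> 1] by (simp add: Y_def inner_commute)
  have "\<forall>\<eta>. omega a y (snd Y, - fst Y - T (snd Y)) \<eta> = - l \<eta>"
    by (simp add: om l inner_prod_def)
  then show "\<exists>X. \<forall>\<eta>. omega a y X \<eta> = - l \<eta>" by blast
  fix X X' assume *: "\<forall>\<eta>. omega a y X \<eta> = - l \<eta>" "\<forall>\<eta>. omega a y X' \<eta> = - l \<eta>"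
  then have "\<forall>\<eta>. (snd X + T (fst X), - fst X) \<bullet> \<eta> = (snd X' + T (fst X'), - fst X') \<bullet> \<eta>"
    unfolding om by simp
  then have "(snd X + T (fst X), - fst X) = (snd X' + T (fst X'), - fst X')"
    by (simp only: vector_eq_rdot)
  then show "X = X'" by (auto simp: prod_eq_iff)
qed

definition hamiltonian :: "(real \<Rightarrow> 'n::finite torus \<Rightarrow> real) \<Rightarrow> real \<Rightarrow> 'n phase \<Rightarrow> real" where
  "hamiltonian V t y = (norm (snd y))\<^sup>2 / 2 + V t (fst y)"

definition ham_field :: "('n::finite \<Rightarrow> torus2 \<Rightarrow> real) \<Rightarrow> (real \<Rightarrow> 'n torus \<Rightarrow> real) \<Rightarrow>
    real \<Rightarrow> 'n phase \<Rightarrow> 'n tangent" where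
  "ham_field a V t y = (THE X. \<forall>\<eta>. omega a y X \<eta> = - phase_diff (hamiltonian V t) y \<eta>)"

definition ham_solution :: "('n::finite \<Rightarrow> torus2 \<Rightarrow> real) \<Rightarrow> (real \<Rightarrow> 'n torus \<Rightarrow> real) \<Rightarrow>
    (real \<Rightarrow> 'n phase) \<Rightarrow> bool" where
  "ham_solution a V w \<longleftrightarrow> (\<forall>t. has_phase_vel w (ham_field a V t (w t)) t)"

text \<open>\<open>ham_field\<close> grows at most linearly in \<open>p\<close>, so the flow is complete.\<close>

definition ham_flow :: "('n::finite \<Rightarrow> torus2 \<Rightarrow> real) \<Rightarrow> (real \<Rightarrow> 'n torus \<Rightarrow> real) \<Rightarrow>
    real \<Rightarrow> 'n phase \<Rightarrow> 'n phase" where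
  "ham_flow a V t y = (THE w. ham_solution a V w \<and> w 0 = y) t"

text \<open>A loop of period \<open>\<tau>\<close> is in the class \<open>h \<in> \<int>\<^sup>2\<^sup>N = \<pi>\<^sub>1(T\<^sup>*\<T>\<^sup>2\<^sup>N)\<close> iff the lifts of its base
  component are translated by \<open>h\<close> over one period.\<close>

definition in_class :: "real \<Rightarrow> int^2^'n \<Rightarrow> (real \<Rightarrow> 'n::finite phase) \<Rightarrow> bool" where
  "in_class \<tau> h w \<longleftrightarrow> (\<exists>W. continuous_on UNIV W \<and> (\<forall>t. torus_cover (W t) = fst (w t)) \<and>
     W \<tau> - W 0 = of_int_vect h)"

definition periodic_orbits :: "('n::finite \<Rightarrow> torus2 \<Rightarrow> real) \<Rightarrow> (real \<Rightarrow> 'n torus \<Rightarrow> real) \<Rightarrow>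
    real \<Rightarrow> int^2^'n \<Rightarrow> (real \<Rightarrow> 'n phase) set" where
  "periodic_orbits a V \<tau> h =
     {w. (\<forall>t. w (t + \<tau>) = w t) \<and> in_class \<tau> h w \<and> ham_solution a V w}"

definition non_degenerate :: "('n::finite \<Rightarrow> torus2 \<Rightarrow> real) \<Rightarrow> (real \<Rightarrow> 'n torus \<Rightarrow> real) \<Rightarrow>
    real \<Rightarrow> bool" where
  "non_degenerate a V \<tau> \<longleftrightarrow> (\<forall>h. \<forall>w\<in>periodic_orbits a V \<tau> h.
     endo_det (\<lambda>\<xi>. phase_map_diff (ham_flow a V \<tau>) (w 0) \<xi> - \<xi>) \<noteq> 0)"

section \<open>The action functional\<close>

definition ref_loop :: "int^2^'n \<Rightarrow> real \<Rightarrow> 'n::finite torus" where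
  "ref_loop h t = torus_cover (t *\<^sub>R of_int_vect h)"

text \<open>\<open>\<integral> z\<^sup>*\<sigma>\<close> over \<open>[0,1] \<times> \<S>\<^sub>\<tau>\<close>. The outer integral is a Henstock--Kurzweil integral, so that
  it also makes sense, as an improper integral, for cylinders that are smooth only away from
  finitely many circles.\<close>

definition magnetic_area :: "('n::finite \<Rightarrow> torus2 \<Rightarrow> real) \<Rightarrow> real \<Rightarrow>
    (real \<times> real \<Rightarrow> 'n torus) \<Rightarrow> real" where
  "magnetic_area a \<tau> z = integral {0..1} (\<lambda>s. integral {0..\<tau>} (\<lambda>t.
     magnetic_form a (z (s, t)) (torus_vel (\<lambda>s'. z (s', t)) s) (torus_vel (\<lambda>t'. z (s, t')) t)))"

text \<open>Capping cylinders: continuous together with their \<open>t\<close>-derivative, and smooth away from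
  finitely many circles \<open>{s} \<times> \<S>\<^sub>\<tau>\<close>. This class contains the smooth cylinders and is closed under
  concatenation, also with compactified Floer cylinders, whose \<open>s\<close>-derivative need not be bounded
  at the ends. By Stokes' theorem it yields the same values of \<open>magnetic_area\<close> as smooth cylinders,
  as \<open>\<integral> z\<^sup>*\<sigma>\<close> over \<open>[r,s] \<times> \<S>\<^sub>\<tau>\<close> tends to 0 for \<open>s - r \<rightarrow> 0\<close>.\<close>

definition capping :: "real \<Rightarrow> int^2^'n \<Rightarrow> (real \<Rightarrow> 'n::finite phase) \<Rightarrow>
    (real \<times> real \<Rightarrow> 'n torus) \<Rightarrow> bool" where
  "capping \<tau> h w z \<longleftrightarrow>
     continuous_on ({0..1} \<times> UNIV) z \<and>
     (\<exists>G. continuous_on ({0..1} \<times> UNIV) G \<and>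
        (\<forall>s\<in>{0..1}. \<forall>t. has_torus_vel (\<lambda>t'. z (s, t')) (G (s, t)) t)) \<and>
     (\<exists>S. finite S \<and> smooth_torus_on (({0<..<1} - S) \<times> UNIV) z) \<and>
     (\<forall>s\<in>{0..1}. \<forall>t. z (s, t + \<tau>) = z (s, t)) \<and>
     (\<forall>t. z (0, t) = ref_loop h (t / \<tau>)) \<and>
     (\<forall>t. z (1, t) = fst (w t))"

definition capped_loops :: "real \<Rightarrow> int^2^'n \<Rightarrow>
    ((real \<Rightarrow> 'n::finite phase) \<times> (real \<times> real \<Rightarrow> 'n torus)) set" where
  "capped_loops \<tau> h = {(w, z). smooth_phase_on UNIV w \<and> (\<forall>t. w (t + \<tau>) = w t) \<and>
     in_class \<tau> h w \<and> capping \<tau> h w z}"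

type_synonym 'n capped_class = "((real \<Rightarrow> 'n phase) \<times> (real \<times> real \<Rightarrow> 'n torus)) set"

definition capped_rel :: "('n::finite \<Rightarrow> torus2 \<Rightarrow> real) \<Rightarrow> real \<Rightarrow> int^2^'n \<Rightarrow>
    (((real \<Rightarrow> 'n phase) \<times> (real \<times> real \<Rightarrow> 'n torus)) \<times>
     ((real \<Rightarrow> 'n phase) \<times> (real \<times> real \<Rightarrow> 'n torus))) set" where
  "capped_rel a \<tau> h = {((w, z), (w', z')). (w, z) \<in> capped_loops \<tau> h \<and>
     (w', z') \<in> capped_loops \<tau> h \<and> w = w' \<and> magnetic_area a \<tau> z = magnetic_area a \<tau> z'}"

text \<open>The class \<open>[w, z]\<close>, and the space \<open>\<L>\<^sup>h\<^sub>\<tau>(T\<^sup>*\<T>\<^sup>2\<^sup>N, \<sigma>)\<close> of all such classes.\<close>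

definition capped_class :: "('n::finite \<Rightarrow> torus2 \<Rightarrow> real) \<Rightarrow> real \<Rightarrow> int^2^'n \<Rightarrow>
    (real \<Rightarrow> 'n phase) \<Rightarrow> (real \<times> real \<Rightarrow> 'n torus) \<Rightarrow> 'n capped_class" where
  "capped_class a \<tau> h w z = capped_rel a \<tau> h `` {(w, z)}"

definition loop_space :: "('n::finite \<Rightarrow> torus2 \<Rightarrow> real) \<Rightarrow> real \<Rightarrow> int^2^'n \<Rightarrow>
    'n capped_class set" where
  "loop_space a \<tau> h = capped_loops \<tau> h // capped_rel a \<tau> h"

definition pair_action :: "('n::finite \<Rightarrow> torus2 \<Rightarrow> real) \<Rightarrow> (real \<Rightarrow> 'n torus \<Rightarrow> real) \<Rightarrow> real \<Rightarrow>
    (real \<Rightarrow> 'n phase) \<times> (real \<times> real \<Rightarrow> 'n torus) \<Rightarrow> real" where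
  "pair_action a V \<tau> = (\<lambda>(w, z).
     integral {0..\<tau>} (\<lambda>t. snd (w t) \<bullet> fst (phase_vel w t))
     - integral {0..\<tau>} (\<lambda>t. hamiltonian V t (w t)) + magnetic_area a \<tau> z)"

definition action :: "('n::finite \<Rightarrow> torus2 \<Rightarrow> real) \<Rightarrow> (real \<Rightarrow> 'n torus \<Rightarrow> real) \<Rightarrow> real \<Rightarrow>
    'n capped_class \<Rightarrow> real" where
  "action a V \<tau> c = the_elem (pair_action a V \<tau> ` c)"

definition Crit :: "('n::finite \<Rightarrow> torus2 \<Rightarrow> real) \<Rightarrow> (real \<Rightarrow> 'n torus \<Rightarrow> real) \<Rightarrow> real \<Rightarrow>
    int^2^'n \<Rightarrow> 'n capped_class set" where
  "Crit a V \<tau> h = {c \<in> loop_space a \<tau> h. \<exists>w z. (w, z) \<in> c \<and> w \<in> periodic_orbits a V \<tau> h}"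

section \<open>Almost complex structures\<close>

definition J_ref :: "real \<Rightarrow> 'n::finite tangent \<Rightarrow>\<^sub>L 'n tangent" where
  "J_ref A = Blinfun (\<lambda>(\<xi>h, \<xi>v). (- (1 / A) *\<^sub>R \<xi>v, A *\<^sub>R \<xi>h))"

definition acs_nbhd :: "('n::finite \<Rightarrow> torus2 \<Rightarrow> real) \<Rightarrow> real \<Rightarrow> real \<Rightarrow>
    ('n phase \<Rightarrow> 'n tangent \<Rightarrow>\<^sub>L 'n tangent) set" where
  "acs_nbhd a A \<epsilon> = {J :: 'n phase \<Rightarrow> 'n tangent \<Rightarrow>\<^sub>L 'n tangent.
     smooth_on UNIV (J \<circ> phase_cover) \<and>
     (\<forall>y \<xi>. blinfun_apply (J y) (blinfun_apply (J y) \<xi>) = - \<xi>) \<and>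
     (\<forall>y \<xi> \<eta>. dlambda (blinfun_apply (J y) \<xi>) \<eta> = dlambda (blinfun_apply (J y) \<eta>) \<xi>) \<and>
     (\<forall>y \<xi>. \<xi> \<noteq> 0 \<longrightarrow> dlambda (blinfun_apply (J y) \<xi>) \<xi> > 0) \<and>
     (\<forall>y \<xi>. \<xi> \<noteq> 0 \<longrightarrow> omega a y (blinfun_apply (J y) \<xi>) \<xi> > 1 / 4 * dlambda (blinfun_apply (J y) \<xi>) \<xi>) \<and>
     bdd_above (range (\<lambda>y. norm (J y - J_ref A))) \<and>
     (SUP y. norm (J y - J_ref A)) < \<epsilon>}"

definition smooth_family :: "real \<Rightarrow>
    (real \<Rightarrow> 'n::finite phase \<Rightarrow> 'n tangent \<Rightarrow>\<^sub>L 'n tangent) \<Rightarrow> bool" where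
  "smooth_family \<tau> J \<longleftrightarrow> (\<forall>t. J (t + \<tau>) = J t) \<and> smooth_on UNIV (\<lambda>(t, v). J t (phase_cover v))"

section \<open>Moduli spaces of Floer cylinders\<close>

definition concat_cyl :: "(real \<times> real \<Rightarrow> 'a) \<Rightarrow> (real \<times> real \<Rightarrow> 'a) \<Rightarrow> real \<times> real \<Rightarrow> 'a" where
  "concat_cyl z z' = (\<lambda>(s, t). if s \<le> 1 / 2 then z (2 * s, t) else z' (2 * s - 1, t))"

text \<open>Compactification of a cylinder with ends \<open>w\<^sup>-\<close>, \<open>w\<^sup>+\<close>, through the diffeomorphism
  \<open>r \<mapsto> ln (r / (1 - r))\<close> from \<open>(0,1)\<close> to \<open>\<real>\<close>.\<close>

definition compactify :: "(real \<Rightarrow> 'a) \<Rightarrow> (real \<Rightarrow> 'a) \<Rightarrow> (real \<times> real \<Rightarrow> 'a) \<Rightarrow> real \<times> real \<Rightarrow> 'a" where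
  "compactify w_minus w_plus u = (\<lambda>(r, t).
     if r \<le> 0 then w_minus t else if r \<ge> 1 then w_plus t else u (ln (r / (1 - r)), t))"

definition floer_eq :: "('n::finite \<Rightarrow> torus2 \<Rightarrow> real) \<Rightarrow> (real \<Rightarrow> 'n torus \<Rightarrow> real) \<Rightarrow>
    (real \<Rightarrow> 'n phase \<Rightarrow> 'n tangent \<Rightarrow>\<^sub>L 'n tangent) \<Rightarrow> (real \<times> real \<Rightarrow> 'n phase) \<Rightarrow> bool" where
  "floer_eq a V J u \<longleftrightarrow> (\<forall>s t. phase_vel (\<lambda>s'. u (s', t)) s +
     blinfun_apply (J t (u (s, t))) (phase_vel (\<lambda>t'. u (s, t')) t - ham_field a V t (u (s, t))) = 0)"

definition asymptotic :: "real filter \<Rightarrow> (real \<Rightarrow> 'n::finite phase) \<Rightarrow> (real \<times> real \<Rightarrow> 'n phase) \<Rightarrow> bool" where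
  "asymptotic F w u \<longleftrightarrow> uniform_limit UNIV (\<lambda>s t. u (s, t)) w F \<and>
     uniform_limit UNIV (\<lambda>s t. phase_vel (\<lambda>s'. u (s', t)) s) (\<lambda>t. 0) F"

definition moduli :: "('n::finite \<Rightarrow> torus2 \<Rightarrow> real) \<Rightarrow> (real \<Rightarrow> 'n torus \<Rightarrow> real) \<Rightarrow>
    (real \<Rightarrow> 'n phase \<Rightarrow> 'n tangent \<Rightarrow>\<^sub>L 'n tangent) \<Rightarrow> real \<Rightarrow> int^2^'n \<Rightarrow>
    'n capped_class \<Rightarrow> 'n capped_class \<Rightarrow> (real \<times> real \<Rightarrow> 'n phase) set" where
  "moduli a V J \<tau> h c_minus c_plus = {u.
     smooth_phase_on UNIV u \<and> (\<forall>s t. u (s, t + \<tau>) = u (s, t)) \<and> floer_eq a V J u \<and>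
     (\<exists>w_minus z_minus w_plus z_plus. (w_minus, z_minus) \<in> c_minus \<and> (w_plus, z_plus) \<in> c_plus \<and>
        asymptotic at_bot w_minus u \<and> asymptotic at_top w_plus u \<and>
        capped_class a \<tau> h w_plus (concat_cyl z_minus (fst \<circ> compactify w_minus w_plus u))
          = capped_class a \<tau> h w_plus z_plus)}"

end

theory Submission
  imports Defs
begin

text \<open>Take \<open>\<epsilon>\<^sub>0 = min A (1/A) / 2\<close>, so that \<open>d\<lambda>(J\<xi>, \<xi>) \<ge> \<epsilon>\<^sub>0 |\<xi>|\<^sup>2\<close>. For \<open>u = (x, p)\<close> the energy identity bounds
  \<open>\<integral> |\<partial>\<^sub>s u|\<^sup>2\<close> by a multiple of \<open>E\<close>. On a circle \<open>s = const\<close> the Floer equation says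
  \<open>\<partial>\<^sub>t p + a(x) i p = f\<close> with \<open>f\<close> bounded in terms of \<open>\<partial>\<^sub>s u\<close>, and by non-resonance the homogeneous equation
  has no periodic solution, uniformly. Hence \<open>|p|\<close> on the circle is controlled by the \<open>L\<^sup>2\<close>-norm of
  \<open>\<partial>\<^sub>s u\<close> on it, and \<open>u\<close> is bounded in \<open>W\<^sup>1\<^sup>,\<^sup>2\<close> on squares of fixed size.

  No control on derivatives of \<open>J\<close> is available, so the passage to a supremum bound avoids linear
  elliptic regularity. Since \<open>|\<nabla>u|\<^sup>2 \<le> - M d\<lambda>(\<partial>\<^sub>s u, \<partial>\<^sub>t u) + C (1 + |p|\<^sup>2)\<close> and \<open>d\<lambda>\<close> is exact, the isoperimetric
  inequality on small circles gives a decay of the energy of discs by a power of the radius (Morrey's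
  argument), which bounds \<open>p\<close> at the centre by its mean and the energy on a circle, up to a small
  multiple of \<open>sup |p|\<close>. The latter is finite by the asymptotics, and is absorbed.\<close>

section \<open>Calculus of smooth maps\<close>

text \<open>Absorbing the supremum \<open>P\<close> of |p| is delicate because the inhomogeneous
  term of the gradient bound is of order P^2, too large to be made a small multiple of
  \<open>P\<close> by itself. The interior estimate therefore has a free parameter \<open>Q\<close>:
  the inhomogeneity is divided by \<open>Q\<close>, at the price of a term proportional to
  \<open>Q\<close>. With Q = 1 + P both are linear in \<open>P\<close>, and both carry the radius as
  a factor.

  Plain finiteness of the energy is borderline: the derivative of the circular mean is then only
  just not integrable down to radius 0, as always for W^{1,2} in dimension two. Any decay of the
  energy of discs removes the logarithm, and this is what the weight r^-\<gamma> provides.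

  The energy identity has an obstacle of its own. \<sigma> is not exact, and the actions of the two
  ends are defined through separate cappings. Both are therefore read off from one lift of the
  concatenated cylinder, where magnetic areas become differences of a functional of lifted
  loops.\<close>

lemma Ck_on_cong:
  assumes "open S" "\<And>x. x \<in> S \<Longrightarrow> f x = g x"
  shows "Ck_on S k f \<longleftrightarrow> Ck_on S k g"
  using assms(2)
proof (induction k arbitrary: f g)
  case 0
  then show ?case using continuous_on_cong[of S S f g] by simp
next
  case (Suc k)
  have hd: "(f has_derivative D) (at x) \<longleftrightarrow> (g has_derivative D) (at x)" if "x \<in> S" for x D
    using has_derivative_transform_within_open[OF _ assms(1) that, of f D UNIV g]
      has_derivative_transform_within_open[OF _ assms(1) that, of g D UNIV f] Suc.prems by auto
  have "frechet_derivative f (at x) = frechet_derivative g (at x)" if "x \<in> S" for x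
    unfolding frechet_derivative_def using hd[OF that] by simp
  then have "Ck_on S k (\<lambda>x. frechet_derivative f (at x) v) \<longleftrightarrow>
      Ck_on S k (\<lambda>x. frechet_derivative g (at x) v)" for v
    by (intro Suc.IH) auto
  moreover have "f differentiable (at x) \<longleftrightarrow> g differentiable (at x)" if "x \<in> S" for x
    unfolding differentiable_def using hd[OF that] by simp
  ultimately show ?case by auto
qed

lemma Ck_on_local:
  assumes "\<And>x. x \<in> S \<Longrightarrow> \<exists>U. open U \<and> x \<in> U \<and> Ck_on U k f"
  shows "Ck_on S k f"
  using assms
proof (induction k arbitrary: f)
  case 0
  have "isCont f x" if "x \<in> S" for x
    using 0[OF that] by (auto simp: continuous_on_eq_continuous_at)
  then show ?case by (simp add: continuous_at_imp_continuous_on)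
next
  case (Suc k)
  have "Ck_on S k (\<lambda>x. frechet_derivative f (at x) v)" for v
    by (rule Suc.IH) (use Suc.prems in fastforce)
  moreover have "f differentiable (at x)" if "x \<in> S" for x
    using Suc.prems[OF that] by auto
  ultimately show ?case by simp
qed

lemma Ck_on_add_const:
  assumes "open S" "Ck_on S k f"
  shows "Ck_on S k (\<lambda>x. f x + c)"
proof (cases k)
  case 0
  then show ?thesis using assms by (auto intro: continuous_intros)
next
  case (Suc n)
  then have d: "f differentiable (at x)" if "x \<in> S" for x
    using assms(2) that by simp
  have hd: "((\<lambda>x. f x + c) has_derivative frechet_derivative f (at x)) (at x)" if "x \<in> S" for x
    using has_derivative_add_const d[OF that] frechet_derivative_works by blast
  then have "frechet_derivative (\<lambda>x. f x + c) (at x) = frechet_derivative f (at x)" if "x \<in> S" for x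
    using frechet_derivative_at that by metis
  then have "Ck_on S n (\<lambda>x. frechet_derivative (\<lambda>x. f x + c) (at x) v)" for v
    using Ck_on_cong[OF assms(1), of "\<lambda>x. frechet_derivative (\<lambda>x. f x + c) (at x) v"
        "\<lambda>x. frechet_derivative f (at x) v" n] assms(2) Suc by simp
  then show ?thesis using hd Suc by (auto simp: differentiable_def)
qed

lemma smooth_on_continuous: "smooth_on S f \<Longrightarrow> continuous_on S f"
  unfolding smooth_on_def by (drule spec[of _ 0]) simp

lemma smooth_on_has_derivative:
  assumes "smooth_on S f" "x \<in> S"
  shows "(f has_derivative frechet_derivative f (at x)) (at x)"
proof -
  have "Ck_on S 1 f" using assms(1) unfolding smooth_on_def by blast
  then show ?thesis using assms(2) by (simp add: frechet_derivative_works[symmetric])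
qed

lemma smooth_on_frechet:
  assumes "smooth_on S f"
  shows "smooth_on S (\<lambda>x. frechet_derivative f (at x) v)"
  unfolding smooth_on_def
proof
  fix k
  have "Ck_on S (Suc k) f" using assms unfolding smooth_on_def by blast
  then show "Ck_on S k (\<lambda>x. frechet_derivative f (at x) v)" by simp
qed

lemma Ck_on_subset:
  assumes "Ck_on S k f" "T \<subseteq> S"
  shows "Ck_on T k f"
  using assms(1)
proof (induction k arbitrary: f)
  case 0
  then show ?case using continuous_on_subset[OF _ assms(2)] by simp
next
  case (Suc k)
  then show ?case using assms(2) by auto
qed

lemma smooth_on_subset: "smooth_on S f \<Longrightarrow> T \<subseteq> S \<Longrightarrow> smooth_on T f"
  unfolding smooth_on_def using Ck_on_subset by blast

section \<open>Partial derivatives in the plane\<close>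

definition D1 :: "(real \<times> real \<Rightarrow> 'a::real_normed_vector) \<Rightarrow> real \<times> real \<Rightarrow> 'a" where
  "D1 f z = frechet_derivative f (at z) (1, 0)"

definition D2 :: "(real \<times> real \<Rightarrow> 'a::real_normed_vector) \<Rightarrow> real \<times> real \<Rightarrow> 'a" where
  "D2 f z = frechet_derivative f (at z) (0, 1)"

lemma smooth_on_D1: "smooth_on S f \<Longrightarrow> smooth_on S (D1 f)"
  and smooth_on_D2: "smooth_on S f \<Longrightarrow> smooth_on S (D2 f)"
  unfolding D1_def[abs_def] D2_def[abs_def] using smooth_on_frechet[of S f] by auto

lemma has_derivative_D12:
  assumes "smooth_on S f" "z \<in> S"
  shows "(f has_derivative (\<lambda>h. fst h *\<^sub>R D1 f z + snd h *\<^sub>R D2 f z)) (at z)"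
proof -
  let ?D = "frechet_derivative f (at z)"
  have 1: "(f has_derivative ?D) (at z)"
    by (rule smooth_on_has_derivative[OF assms])
  interpret linear ?D using 1 has_derivative_linear by blast
  have "?D h = fst h *\<^sub>R D1 f z + snd h *\<^sub>R D2 f z" for h
  proof -
    have "?D (fst h *\<^sub>R (1, 0) + snd h *\<^sub>R (0, 1)) = fst h *\<^sub>R D1 f z + snd h *\<^sub>R D2 f z"
      unfolding add scale D1_def D2_def ..
    then show ?thesis by simp
  qed
  then have "?D = (\<lambda>h. fst h *\<^sub>R D1 f z + snd h *\<^sub>R D2 f z)" by blast
  then show ?thesis using 1 by metis
qed

lemma has_vector_derivative_along:
  assumes "smooth_on S f" "c r \<in> S" "(c has_vector_derivative (v1, v2)) (at r)"
  shows "((\<lambda>r. f (c r)) has_vector_derivative v1 *\<^sub>R D1 f (c r) + v2 *\<^sub>R D2 f (c r)) (at r)"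
proof -
  have "((\<lambda>r. f (c r)) has_derivative
     (\<lambda>h. fst (h *\<^sub>R (v1, v2)) *\<^sub>R D1 f (c r) + snd (h *\<^sub>R (v1, v2)) *\<^sub>R D2 f (c r))) (at r)"
    using has_derivative_compose[OF assms(3)[unfolded has_vector_derivative_def]
        has_derivative_D12[OF assms(1,2)]] by (simp add: o_def)
  then show ?thesis
    unfolding has_vector_derivative_def by (simp add: scaleR_add_right)
qed

lemma D1_has_vector_derivative:
  assumes "smooth_on S f" "(s, t) \<in> S"
  shows "((\<lambda>s. f (s, t)) has_vector_derivative D1 f (s, t)) (at s)"
proof -
  have "((\<lambda>s. (s, t)) has_vector_derivative (1, 0)) (at s)"
    by (auto intro!: derivative_eq_intros has_vector_derivative_Pair)
  from has_vector_derivative_along[OF assms(1) _ this] show ?thesis using assms(2) by simp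
qed

lemma D2_has_vector_derivative:
  assumes "smooth_on S f" "(s, t) \<in> S"
  shows "((\<lambda>t. f (s, t)) has_vector_derivative D2 f (s, t)) (at t)"
proof -
  have "((\<lambda>t. (s, t)) has_vector_derivative (0, 1)) (at t)"
    by (auto intro!: derivative_eq_intros has_vector_derivative_Pair)
  from has_vector_derivative_along[OF assms(1) _ this] show ?thesis using assms(2) by simp
qed

lemma continuous_on_curry:
  assumes "continuous_on S f" "U \<times> T \<subseteq> S" "s \<in> U"
  shows "continuous_on T (\<lambda>t. f (s, t))"
proof (rule continuous_on_compose2[OF assms(1)])
  show "continuous_on T (Pair s)" by (intro continuous_intros)
  show "Pair s ` T \<subseteq> S" using assms(2,3) by auto
qed

text \<open>Writing an increment of \<open>f\<close> in the second variable as an integral of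
  \<open>D2 f\<close> and differentiating under the integral sign exhibits
  \<open>D1 f (s, q)\<close> as an indefinite integral of \<open>D1 (D2 f)\<close>, whose derivative
  in \<open>q\<close> can be read off.\<close>

lemma D1_D2_commute:
  fixes f :: "real \<times> real \<Rightarrow> 'a::banach"
  assumes "open S" "smooth_on S f" "z \<in> S"
  shows "D1 (D2 f) z = D2 (D1 f) z"
proof -
  obtain s t where z: "z = (s, t)" by (cases z)
  obtain A B where AB: "open A" "open B" "s \<in> A" "t \<in> B" "A \<times> B \<subseteq> S"
    using open_prod_elim[OF assms(1,3)] unfolding z by (metis mem_Sigma_iff)
  obtain d where d: "d > 0" "cball s d \<subseteq> A" using AB open_contains_cball[of A] by auto
  obtain e where e: "e > 0" "cball t e \<subseteq> B" using AB open_contains_cball[of B] by auto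
  define U where "U = {s-d<..<s+d}"
  have U: "open U" "convex U" "s \<in> U" "U \<times> {t-e..t+e} \<subseteq> S"
  proof -
    have "U \<subseteq> A" "{t-e..t+e} \<subseteq> B"
      using d(2) e(2) by (auto simp: U_def cball_def dist_real_def subset_iff abs_le_iff)
    then show "U \<times> {t-e..t+e} \<subseteq> S" using AB(5) by blast
  qed (use d in \<open>auto simp: U_def\<close>)
  have inS: "(r, q) \<in> S" if "r \<in> U" "q \<in> {t-e..t+e}" for r q
    using U(4) that by blast
  have c12: "continuous_on S (D1 (D2 f))"
    by (intro smooth_on_continuous smooth_on_D1 smooth_on_D2 assms(2))
  have eq: "D1 f (s, q) = D1 f (s, t-e) + integral {t-e..q} (\<lambda>q. D1 (D2 f) (s, q))"
    if q: "q \<in> {t-e..t+e}" for q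
  proof -
    have int: "((\<lambda>q. D2 f (r, q)) has_integral f (r, q) - f (r, t-e)) {t-e..q}" if "r \<in> U" for r
    proof (rule fundamental_theorem_of_calculus)
      fix p assume "p \<in> {t-e..q}"
      then show "((\<lambda>q. f (r, q)) has_vector_derivative D2 f (r, p)) (at p within {t-e..q})"
        using q that by (intro has_vector_derivative_at_within[OF D2_has_vector_derivative[OF assms(2)]] inS) auto
    qed (use q in auto)
    have "((\<lambda>r. integral (cbox (t-e) q) (\<lambda>q. D2 f (r, q))) has_vector_derivative
        integral (cbox (t-e) q) (\<lambda>q. D1 (D2 f) (s, q))) (at s within U)"
    proof (rule leibniz_rule_vector_derivative)
      fix r p assume "r \<in> U" "p \<in> cbox (t-e) q"
      then show "((\<lambda>r. D2 f (r, p)) has_vector_derivative D1 (D2 f) (r, p)) (at r within U)"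
        using q by (intro has_vector_derivative_at_within[OF
            D1_has_vector_derivative[OF smooth_on_D2[OF assms(2)]]] inS) auto
    next
      show "continuous_on (U \<times> cbox (t-e) q) (\<lambda>(x, t). D1 (D2 f) (x, t))"
        unfolding case_prod_eta
        by (rule continuous_on_subset[OF c12]) (use q inS in auto)
      show "(\<lambda>q. D2 f (r, q)) integrable_on cbox (t-e) q" if "r \<in> U" for r
        using has_integral_integrable[OF int[OF that]] by simp
    qed (use U in auto)
    then have "((\<lambda>r. f (r, q) - f (r, t-e)) has_vector_derivative
        integral {t-e..q} (\<lambda>q. D1 (D2 f) (s, q))) (at s within U)"
      unfolding cbox_interval
      by (rule has_vector_derivative_transform[OF U(3), rotated])
        (use integral_unique[OF int] in simp)
    then have 1: "((\<lambda>r. f (r, q) - f (r, t-e)) has_vector_derivative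
        integral {t-e..q} (\<lambda>q. D1 (D2 f) (s, q))) (at s)"
      using at_within_open[OF U(3,1)] by simp
    have "((\<lambda>r. f (r, q) - f (r, t-e)) has_vector_derivative D1 f (s, q) - D1 f (s, t-e)) (at s)"
      using q U(3) e(1) by (intro has_vector_derivative_diff D1_has_vector_derivative[OF assms(2)] inS) auto
    from vector_derivative_unique_at[OF this 1] show ?thesis by (simp add: algebra_simps)
  qed
  have ts: "t \<in> {t-e<..<t+e}" using e by simp
  have "((\<lambda>q. integral {t-e..q} (\<lambda>q. D1 (D2 f) (s, q))) has_vector_derivative D1 (D2 f) (s, t))
      (at t within {t-e..t+e})"
    by (rule integral_has_vector_derivative)
      (use e in \<open>auto intro!: continuous_on_curry[OF c12 U(4) U(3)]\<close>)
  then have "((\<lambda>q. D1 f (s, t-e) + integral {t-e..q} (\<lambda>q. D1 (D2 f) (s, q)))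
      has_vector_derivative D1 (D2 f) (s, t)) (at t within {t-e..t+e})"
    by (auto intro!: derivative_eq_intros)
  then have "((\<lambda>q. D1 f (s, q)) has_vector_derivative D1 (D2 f) (s, t)) (at t within {t-e..t+e})"
    by (rule has_vector_derivative_transform[rotated 2]) (use e in \<open>auto intro: eq\<close>)
  then have "((\<lambda>q. D1 f (s, q)) has_vector_derivative D1 (D2 f) (s, t)) (at t within {t-e<..<t+e})"
    by (rule has_vector_derivative_within_subset) auto
  then have 2: "((\<lambda>q. D1 f (s, q)) has_vector_derivative D1 (D2 f) (s, t)) (at t)"
    using at_within_open[OF ts] by simp
  have "((\<lambda>q. D1 f (s, q)) has_vector_derivative D2 (D1 f) (s, t)) (at t)"
    by (rule D2_has_vector_derivative[OF smooth_on_D1[OF assms(2)]]) (use assms z in auto)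
  from vector_derivative_unique_at[OF 2 this] show ?thesis unfolding z .
qed

section \<open>Stokes' theorem on a cylinder\<close>

text \<open>This is the variation of the integral of the 1-form P dX over the curves s = const. The
  term \<open>P \<bullet> X12\<close> from differentiating under the integral is traded for
  \<open>P2 \<bullet> X1\<close> by subtracting the \<open>t\<close>-derivative of
  \<open>P \<bullet> X1\<close>, which leaves the boundary values. They are kept because
  \<open>P\<close> need not be periodic in the application to the magnetic area.\<close>

lemma cylinder_stokes:
  fixes P X :: "real \<Rightarrow> real \<Rightarrow> 'a::euclidean_space"
  assumes U: "open U" "convex U" "s \<in> U" and T: "a \<le> b"
    and P1: "\<And>s t. s \<in> U \<Longrightarrow> t \<in> {a..b} \<Longrightarrow> ((\<lambda>s. P s t) has_vector_derivative P1 s t) (at s)"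
    and P2: "\<And>s t. s \<in> U \<Longrightarrow> t \<in> {a..b} \<Longrightarrow> ((\<lambda>t. P s t) has_vector_derivative P2 s t) (at t)"
    and X2: "\<And>s t. s \<in> U \<Longrightarrow> t \<in> {a..b} \<Longrightarrow> ((\<lambda>s. X2 s t) has_vector_derivative X12 s t) (at s)"
    and X1: "\<And>s t. s \<in> U \<Longrightarrow> t \<in> {a..b} \<Longrightarrow> ((\<lambda>t. X1 s t) has_vector_derivative X12 s t) (at t)"
    and c: "continuous_on (U \<times> {a..b}) (\<lambda>(s,t). P s t)"
      "continuous_on (U \<times> {a..b}) (\<lambda>(s,t). P1 s t)"
      "continuous_on (U \<times> {a..b}) (\<lambda>(s,t). P2 s t)"
      "continuous_on (U \<times> {a..b}) (\<lambda>(s,t). X1 s t)"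
      "continuous_on (U \<times> {a..b}) (\<lambda>(s,t). X2 s t)"
      "continuous_on (U \<times> {a..b}) (\<lambda>(s,t). X12 s t)"
  shows "((\<lambda>s. integral {a..b} (\<lambda>t. P s t \<bullet> X2 s t)) has_real_derivative
     integral {a..b} (\<lambda>t. P1 s t \<bullet> X2 s t - P2 s t \<bullet> X1 s t) + (P s b \<bullet> X1 s b - P s a \<bullet> X1 s a)) (at s)"
proof -
  note cc = c[unfolded case_prod_beta']
  have cs: "continuous_on {a..b} (\<lambda>t. f s t)" if "continuous_on (U \<times> {a..b}) (\<lambda>z. f (fst z) (snd z))" "s \<in> U"
    for f :: "real \<Rightarrow> real \<Rightarrow> 'a" and s
    using continuous_on_curry[OF that(1) order_refl that(2)] by simp
  have "((\<lambda>s. integral (cbox a b) (\<lambda>t. P s t \<bullet> X2 s t)) has_vector_derivative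
      integral (cbox a b) (\<lambda>t. P1 s t \<bullet> X2 s t + P s t \<bullet> X12 s t)) (at s within U)"
  proof (rule leibniz_rule_vector_derivative)
    fix s t assume "s \<in> U" "t \<in> cbox a b"
    then show "((\<lambda>s. P s t \<bullet> X2 s t) has_vector_derivative P1 s t \<bullet> X2 s t + P s t \<bullet> X12 s t) (at s within U)"
      using P1[of s t] X2[of s t]
        bounded_bilinear.has_vector_derivative[OF bounded_bilinear_inner, of "\<lambda>s. P s t" "P1 s t" s U "\<lambda>s. X2 s t" "X12 s t"]
      by (simp add: has_vector_derivative_at_within add.commute)
  next
    fix s assume "s \<in> U"
    then show "(\<lambda>t. P s t \<bullet> X2 s t) integrable_on cbox a b"
      unfolding cbox_interval
      by (intro integrable_continuous_real continuous_intros cs) (use cc in auto)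
  next
    show "continuous_on (U \<times> cbox a b) (\<lambda>(s, t). P1 s t \<bullet> X2 s t + P s t \<bullet> X12 s t)"
      unfolding case_prod_beta' using cc by (auto intro!: continuous_intros)
  qed (use U in auto)
  then have 1: "((\<lambda>s. integral {a..b} (\<lambda>t. P s t \<bullet> X2 s t)) has_real_derivative
      integral {a..b} (\<lambda>t. P1 s t \<bullet> X2 s t + P s t \<bullet> X12 s t)) (at s)"
    using at_within_open[OF U(3,1)] by (simp add: has_real_derivative_iff_has_vector_derivative)
  have i2: "((\<lambda>t. P2 s t \<bullet> X1 s t + P s t \<bullet> X12 s t) has_integral (P s b \<bullet> X1 s b - P s a \<bullet> X1 s a)) {a..b}"
  proof (rule fundamental_theorem_of_calculus[OF T])
    fix t assume "t \<in> {a..b}"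
    then show "((\<lambda>t. P s t \<bullet> X1 s t) has_vector_derivative P2 s t \<bullet> X1 s t + P s t \<bullet> X12 s t) (at t within {a..b})"
      using P2[of s t] X1[of s t] U(3)
        bounded_bilinear.has_vector_derivative[OF bounded_bilinear_inner, of "\<lambda>t. P s t" "P2 s t" t "{a..b}" "\<lambda>t. X1 s t" "X12 s t"]
      by (simp add: has_vector_derivative_at_within add.commute)
  qed
  have i1: "(\<lambda>t. P1 s t \<bullet> X2 s t - P2 s t \<bullet> X1 s t) integrable_on {a..b}"
    by (intro integrable_continuous_real continuous_intros cs U) (use cc in auto)
  have "integral {a..b} (\<lambda>t. P1 s t \<bullet> X2 s t + P s t \<bullet> X12 s t) =
     integral {a..b} (\<lambda>t. (P1 s t \<bullet> X2 s t - P2 s t \<bullet> X1 s t) + (P2 s t \<bullet> X1 s t + P s t \<bullet> X12 s t))"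
    by simp
  also have "\<dots> = integral {a..b} (\<lambda>t. P1 s t \<bullet> X2 s t - P2 s t \<bullet> X1 s t) + (P s b \<bullet> X1 s b - P s a \<bullet> X1 s a)"
    using integral_add[OF i1 has_integral_integrable[OF i2]] integral_unique[OF i2] by simp
  finally show ?thesis using 1 by simp
qed

section \<open>An interior estimate in polar coordinates\<close>

text \<open>The partial derivatives are arguments, so that a primitive can be handed on together
  with the function of which it is a primitive. One degree of differentiability suffices for
  primitives and squares of norms.\<close>

definition C1 :: "(real \<times> real \<Rightarrow> 'a::real_normed_vector) \<Rightarrow> (real \<times> real \<Rightarrow> 'a) \<Rightarrow> (real \<times> real \<Rightarrow> 'a) \<Rightarrow> bool" where
  "C1 f f1 f2 \<longleftrightarrow> (\<forall>z. (f has_derivative (\<lambda>h. fst h *\<^sub>R f1 z + snd h *\<^sub>R f2 z)) (at z)) \<and>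
     continuous_on UNIV f1 \<and> continuous_on UNIV f2"

lemma C1_has_derivative: "C1 f f1 f2 \<Longrightarrow> (f has_derivative (\<lambda>h. fst h *\<^sub>R f1 z + snd h *\<^sub>R f2 z)) (at z)"
  unfolding C1_def by blast

lemma C1_smooth: "smooth_on UNIV f \<Longrightarrow> C1 f (D1 f) (D2 f)"
  unfolding C1_def
  by (intro conjI allI has_derivative_D12[of UNIV] smooth_on_continuous smooth_on_D1 smooth_on_D2) auto

lemma C1_continuous:
  assumes "C1 f f1 f2"
  shows "continuous_on UNIV f" "continuous_on UNIV f1" "continuous_on UNIV f2"
proof -
  have "isCont f z" for z using C1_has_derivative[OF assms] by (rule has_derivative_continuous)
  then show "continuous_on UNIV f" by (simp add: continuous_at_imp_continuous_on)
qed (use assms in \<open>auto simp: C1_def\<close>)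

lemma C1_along:
  assumes "C1 f f1 f2" "(c has_vector_derivative (v1, v2)) F" "F = at r within S"
  shows "((\<lambda>r. f (c r)) has_vector_derivative v1 *\<^sub>R f1 (c r) + v2 *\<^sub>R f2 (c r)) F"
proof -
  have "((\<lambda>r. f (c r)) has_derivative
     (\<lambda>h. fst (h *\<^sub>R (v1, v2)) *\<^sub>R f1 (c r) + snd (h *\<^sub>R (v1, v2)) *\<^sub>R f2 (c r))) (at r within S)"
    by (rule has_derivative_compose[OF assms(2)[unfolded assms(3) has_vector_derivative_def]
          C1_has_derivative[OF assms(1)]])
  then show ?thesis
    unfolding has_vector_derivative_def assms(3) by (simp add: scaleR_add_right)
qed

section \<open>Polar coordinates\<close>

definition polar :: "real \<times> real \<Rightarrow> real \<Rightarrow> real \<Rightarrow> real \<times> real" where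
  "polar z r \<theta> = (fst z + r * cos \<theta>, snd z + r * sin \<theta>)"

lemma polar_vector_derivative:
  "((\<lambda>r. polar z r \<theta>) has_vector_derivative (cos \<theta>, sin \<theta>)) (at r within S)"
  "((\<lambda>\<theta>. polar z r \<theta>) has_vector_derivative (- r * sin \<theta>, r * cos \<theta>)) (at \<theta> within T)"
  unfolding polar_def
  by (intro has_vector_derivative_Pair)
    (auto intro!: derivative_eq_intros simp flip: has_real_derivative_iff_has_vector_derivative)

lemma continuous_on_polar [continuous_intros]:
  fixes r \<theta> :: "'b::t2_space \<Rightarrow> real"
  assumes "continuous_on S r" "continuous_on S \<theta>"
  shows "continuous_on S (\<lambda>x. polar z (r x) (\<theta> x))"
  unfolding polar_def by (intro continuous_intros assms)

lemma continuous_on_UNIV_compose: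
  "continuous_on UNIV f \<Longrightarrow> continuous_on S g \<Longrightarrow> continuous_on S (\<lambda>x. f (g x))"
  by (rule continuous_on_compose2) auto

lemma C1_polar:
  assumes "C1 f f1 f2"
  shows "((\<lambda>r. f (polar z r \<theta>)) has_vector_derivative
      cos \<theta> *\<^sub>R f1 (polar z r \<theta>) + sin \<theta> *\<^sub>R f2 (polar z r \<theta>)) (at r within S)"
    "((\<lambda>\<theta>. f (polar z r \<theta>)) has_vector_derivative
      r *\<^sub>R (cos \<theta> *\<^sub>R f2 (polar z r \<theta>) - sin \<theta> *\<^sub>R f1 (polar z r \<theta>))) (at \<theta> within T)"
  using C1_along[OF assms polar_vector_derivative(1) refl]
    C1_along[OF assms polar_vector_derivative(2) refl]
  by (auto simp: algebra_simps)

text \<open>\<open>cylinder_stokes\<close> with radius and angle as variables. The boundary term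
  vanishes because the angles 0 and 2*pi give the same point.\<close>

lemma polar_stokes:
  fixes P X :: "real \<times> real \<Rightarrow> 'a::euclidean_space"
  assumes P: "C1 P P1 P2" and X: "C1 X X1 X2" "C1 X1 X11 X12" "C1 X2 X12 X22"
  shows "((\<lambda>r. integral {0..2*pi} (\<lambda>\<theta>. P (polar z r \<theta>) \<bullet>
        (r *\<^sub>R (cos \<theta> *\<^sub>R X2 (polar z r \<theta>) - sin \<theta> *\<^sub>R X1 (polar z r \<theta>))))) has_real_derivative
      r * integral {0..2*pi} (\<lambda>\<theta>. P1 (polar z r \<theta>) \<bullet> X2 (polar z r \<theta>) - P2 (polar z r \<theta>) \<bullet> X1 (polar z r \<theta>))) (at r)"
proof -
  define c where "c = polar z"
  have cP: "continuous_on UNIV P" "continuous_on UNIV P1" "continuous_on UNIV P2"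
    using C1_continuous[OF P] by auto
  have cX: "continuous_on UNIV X1" "continuous_on UNIV X2" "continuous_on UNIV X11"
     "continuous_on UNIV X12" "continuous_on UNIV X22"
    using X by (auto dest: C1_continuous)
  note cc = cP[THEN continuous_on_UNIV_compose] cX[THEN continuous_on_UNIV_compose]
  define Pr where "Pr r \<theta> = cos \<theta> *\<^sub>R P1 (c r \<theta>) + sin \<theta> *\<^sub>R P2 (c r \<theta>)" for r \<theta>
  define Pt where "Pt r \<theta> = r *\<^sub>R (cos \<theta> *\<^sub>R P2 (c r \<theta>) - sin \<theta> *\<^sub>R P1 (c r \<theta>))" for r \<theta>
  define Xr where "Xr r \<theta> = cos \<theta> *\<^sub>R X1 (c r \<theta>) + sin \<theta> *\<^sub>R X2 (c r \<theta>)" for r \<theta>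
  define Xt where "Xt r \<theta> = r *\<^sub>R (cos \<theta> *\<^sub>R X2 (c r \<theta>) - sin \<theta> *\<^sub>R X1 (c r \<theta>))" for r \<theta>
  define Xrt where "Xrt r \<theta> = cos \<theta> *\<^sub>R X2 (c r \<theta>) - sin \<theta> *\<^sub>R X1 (c r \<theta>)
      + r *\<^sub>R (cos \<theta> *\<^sub>R (cos \<theta> *\<^sub>R X12 (c r \<theta>) + sin \<theta> *\<^sub>R X22 (c r \<theta>))
           - sin \<theta> *\<^sub>R (cos \<theta> *\<^sub>R X11 (c r \<theta>) + sin \<theta> *\<^sub>R X12 (c r \<theta>)))" for r \<theta>
  note dr = C1_polar(1)[where z = z, folded c_def] and dt = C1_polar(2)[where z = z, folded c_def]
  have 1: "((\<lambda>r. integral {0..2*pi} (\<lambda>\<theta>. P (c r \<theta>) \<bullet> Xt r \<theta>)) has_real_derivative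
     integral {0..2*pi} (\<lambda>\<theta>. Pr r \<theta> \<bullet> Xt r \<theta> - Pt r \<theta> \<bullet> Xr r \<theta>)
     + (P (c r (2*pi)) \<bullet> Xr r (2*pi) - P (c r 0) \<bullet> Xr r 0)) (at r)"
  proof (rule cylinder_stokes[where U = UNIV and ?X12.0 = Xrt])
    fix r \<theta> :: real
    show "((\<lambda>r. P (c r \<theta>)) has_vector_derivative Pr r \<theta>) (at r)"
      unfolding Pr_def by (rule dr[OF P])
    show "((\<lambda>\<theta>. P (c r \<theta>)) has_vector_derivative Pt r \<theta>) (at \<theta>)"
      unfolding Pt_def by (rule dt[OF P])
    have s1: "((\<lambda>r. r) has_vector_derivative 1) (at r)"
      and s2: "(cos has_vector_derivative (- sin \<theta>)) (at \<theta>)" "(sin has_vector_derivative cos \<theta>) (at \<theta>)"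
      by (auto intro!: derivative_eq_intros simp flip: has_real_derivative_iff_has_vector_derivative)
    have sm: "((\<lambda>x. f x *\<^sub>R g x) has_vector_derivative f x *\<^sub>R g' + f' *\<^sub>R g x) (at x)"
      if "(f has_vector_derivative f') (at x)" "(g has_vector_derivative g') (at x)"
      for f :: "real \<Rightarrow> real" and g :: "real \<Rightarrow> 'a" and f' g' x
      using has_vector_derivative_scaleR[of f f' x UNIV g g'] that
      by (simp add: has_real_derivative_iff_has_vector_derivative)
    show "((\<lambda>r. Xt r \<theta>) has_vector_derivative Xrt r \<theta>) (at r)"
      unfolding Xt_def
      by (rule has_vector_derivative_eq_rhs, rule sm[OF s1 has_vector_derivative_diff])
        (auto intro!: bounded_linear.has_vector_derivative[OF bounded_linear_scaleR_right] dr X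
          simp: Xrt_def algebra_simps)
    show "((\<lambda>\<theta>. Xr r \<theta>) has_vector_derivative Xrt r \<theta>) (at \<theta>)"
      unfolding Xr_def
      by (rule has_vector_derivative_eq_rhs, rule has_vector_derivative_add[OF
            sm[OF s2(1) dt[OF X(2)]] sm[OF s2(2) dt[OF X(3)]]])
        (simp add: Xrt_def algebra_simps)
  qed (auto simp: case_prod_beta' Pr_def Pt_def Xr_def Xt_def Xrt_def c_def intro!: continuous_intros cc)
  have 2: "c r (2*pi) = c r 0" by (simp add: c_def polar_def)
  \<comment> \<open>The factor \<open>r\<close> is the Jacobian of polar coordinates.\<close>
  have "Pr r \<theta> \<bullet> Xt r \<theta> - Pt r \<theta> \<bullet> Xr r \<theta> =
      r * (((sin \<theta>)\<^sup>2 + (cos \<theta>)\<^sup>2) * (P1 (c r \<theta>) \<bullet> X2 (c r \<theta>) - P2 (c r \<theta>) \<bullet> X1 (c r \<theta>)))" for \<theta>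
    by (simp only: Pr_def Xt_def Pt_def Xr_def inner_add_left inner_add_right
        inner_diff_left inner_diff_right inner_scaleR_left inner_scaleR_right) algebra
  then have "(\<lambda>\<theta>. Pr r \<theta> \<bullet> Xt r \<theta> - Pt r \<theta> \<bullet> Xr r \<theta>) =
      (\<lambda>\<theta>. r * (P1 (c r \<theta>) \<bullet> X2 (c r \<theta>) - P2 (c r \<theta>) \<bullet> X1 (c r \<theta>)))"
    by simp
  then show ?thesis using 1 2 by (simp add: Xr_def Xt_def c_def)
qed

section \<open>Primitives and integral inequalities\<close>

lemma has_antiderivative:
  fixes k :: "real \<Rightarrow> 'a::banach"
  assumes "continuous_on UNIV k"
  obtains K where "\<And>x. (K has_vector_derivative k x) (at x)"
proof
  have int: "k integrable_on {a..b}" for a b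
    using assms by (intro integrable_continuous_real) (auto intro: continuous_on_subset)
  \<comment> \<open>Intervals with reversed end points are empty, so at most one of the integrals
    contributes: this is the signed integral from 0.\<close>
  define K where "K x = integral {0..x} k - integral {x..0} k" for x
  have eq: "K y = integral {a..y} k - integral {a..0} k" if "a \<le> y" "a \<le> 0" for a y
  proof (cases "y \<le> 0")
    case True
    then show ?thesis
      using Henstock_Kurzweil_Integration.integral_combine[OF that(1) True int] by (cases "y = 0") (auto simp: K_def algebra_simps)
  next
    case False
    then show ?thesis
      using Henstock_Kurzweil_Integration.integral_combine[OF that(2) _ int, of y] by (auto simp: K_def algebra_simps)
  qed
  fix x :: real
  define a where "a = - \<bar>x\<bar> - 1"
  have "((\<lambda>y. integral {a..y} k) has_vector_derivative k x) (at x within {a..\<bar>x\<bar>+1})"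
    by (rule integral_has_vector_derivative) (use assms in \<open>auto simp: a_def intro: continuous_on_subset\<close>)
  then have "((\<lambda>y. integral {a..y} k - integral {a..0} k) has_vector_derivative k x) (at x within {a<..<\<bar>x\<bar>+1})"
    by (auto intro!: derivative_eq_intros elim: has_vector_derivative_within_subset)
  then have "(K has_vector_derivative k x) (at x within {a<..<\<bar>x\<bar>+1})"
    by (rule has_vector_derivative_transform[rotated 2]) (auto simp: a_def intro!: eq)
  moreover have "x \<in> {a<..<\<bar>x\<bar>+1}" by (auto simp: a_def)
  ultimately show "(K has_vector_derivative k x) (at x)"
    using at_within_open[of x "{a<..<\<bar>x\<bar>+1}"] by simp
qed

text \<open>Rescaling the integral over [0, t] to the fixed interval [0, 1] makes one formula serve
  both signs of \<open>t\<close> and allows differentiation under the integral in both variables at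
  once.\<close>

lemma C1_primitive:
  fixes g :: "real \<times> real \<Rightarrow> real"
  assumes "C1 g g1 g2"
  obtains G G1 where "C1 G G1 g" "\<And>s. G (s, 0) = 0"
    "\<And>s t. G (s, t) = t * integral {0..1} (\<lambda>\<sigma>. g (s, \<sigma> * t))"
proof -
  have cg: "continuous_on UNIV g" "continuous_on UNIV g1" "continuous_on UNIV g2"
    using C1_continuous[OF assms] by auto
  note cc = cg[THEN continuous_on_UNIV_compose]
  define I where "I z = integral {0..1} (\<lambda>\<sigma>. g (fst z, \<sigma> * snd z))" for z
  define I1 where "I1 z = integral {0..1} (\<lambda>\<sigma>. g1 (fst z, \<sigma> * snd z))" for z
  define I2 where "I2 z = integral {0..1} (\<lambda>\<sigma>. \<sigma> * g2 (fst z, \<sigma> * snd z))" for z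
  define f1 where "f1 = Blinfun (fst :: real \<times> real \<Rightarrow> real)"
  define f2 where "f2 = Blinfun (snd :: real \<times> real \<Rightarrow> real)"
  have f12: "blinfun_apply f1 = fst" "blinfun_apply f2 = snd"
    by (auto simp: f1_def f2_def bounded_linear_Blinfun_apply bounded_linear_fst bounded_linear_snd)
  define fx where "fx z \<sigma> = g1 (fst z, \<sigma> * snd z) *\<^sub>R f1 + (\<sigma> * g2 (fst z, \<sigma> * snd z)) *\<^sub>R f2"
    for z :: "real \<times> real" and \<sigma> :: real
  have dI: "(I has_derivative (\<lambda>h. fst h *\<^sub>R I1 z + snd h *\<^sub>R I2 z)) (at z)" for z
  proof -
    have A: "((\<lambda>z. integral (cbox 0 1) (\<lambda>\<sigma>. g (fst z, \<sigma> * snd z))) has_derivative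
        blinfun_apply (integral (cbox 0 1) (fx z))) (at z within UNIV)"
    proof (rule leibniz_rule)
      fix z :: "real \<times> real" and \<sigma> :: real
      have "((\<lambda>z. (fst z, \<sigma> * snd z)) has_derivative (\<lambda>h. (fst h, \<sigma> * snd h))) (at z)"
        by (auto intro!: derivative_eq_intros)
      from has_derivative_compose[OF this C1_has_derivative[OF assms]]
      show "((\<lambda>z. g (fst z, \<sigma> * snd z)) has_derivative blinfun_apply (fx z \<sigma>)) (at z within UNIV)"
        by (rule has_derivative_eq_rhs)
          (simp add: fun_eq_iff fx_def f12 blinfun.add_left blinfun.scaleR_left algebra_simps)
    next
      fix z :: "real \<times> real"
      show "(\<lambda>\<sigma>. g (fst z, \<sigma> * snd z)) integrable_on cbox 0 1"
        unfolding cbox_interval by (intro integrable_continuous_real cc continuous_intros)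
    qed (auto simp: case_prod_beta' fx_def intro!: continuous_intros cc)
    have B: "integral (cbox 0 1) (fx z) = I1 z *\<^sub>R f1 + I2 z *\<^sub>R f2"
    proof -
      have i: "((\<lambda>\<sigma>. g1 (fst z, \<sigma> * snd z)) has_integral I1 z) {0..1}"
        "((\<lambda>\<sigma>. \<sigma> * g2 (fst z, \<sigma> * snd z)) has_integral I2 z) {0..1}"
        unfolding I1_def I2_def
        by (intro integrable_integral integrable_continuous_real cc continuous_intros)+
      show ?thesis
        unfolding cbox_interval fx_def
        by (intro integral_unique has_integral_add i[THEN has_integral_scaleR_left])
    qed
    have B': "blinfun_apply (integral {0..1} (fx z)) = (\<lambda>h. fst h *\<^sub>R I1 z + snd h *\<^sub>R I2 z)"
      unfolding B[unfolded cbox_interval]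
      by (rule ext) (simp add: f12 blinfun.add_left blinfun.scaleR_left algebra_simps)
    show ?thesis
      using A unfolding I_def[abs_def] cbox_interval B' .
  qed
  have cI1: "continuous_on UNIV I1"
    unfolding I1_def cbox_interval[symmetric]
    by (rule integral_continuous_on_param) (auto simp: case_prod_beta' intro!: continuous_intros cc)
  \<comment> \<open>Integrating the derivative of \<open>\<sigma> * g (s, \<sigma> * t)\<close> over
    [0, 1] identifies the second partial derivative of the primitive with \<open>g\<close>.\<close>
  have g_eq: "g z = I z + snd z * I2 z" for z
  proof -
    have A: "((\<lambda>\<sigma>. g (fst z, \<sigma> * snd z) + snd z * (\<sigma> * g2 (fst z, \<sigma> * snd z))) has_integral
        1 * g (fst z, 1 * snd z) - 0 * g (fst z, 0 * snd z)) {0..1}"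
    proof (rule fundamental_theorem_of_calculus)
      fix \<sigma> :: real
      have "((\<lambda>\<sigma>. (fst z, \<sigma> * snd z)) has_vector_derivative (0, snd z)) (at \<sigma> within {0..1})"
        by (intro has_vector_derivative_Pair)
          (auto intro!: derivative_eq_intros simp flip: has_real_derivative_iff_has_vector_derivative)
      from C1_along[OF assms this refl]
      have "((\<lambda>\<sigma>. g (fst z, \<sigma> * snd z)) has_real_derivative snd z * g2 (fst z, \<sigma> * snd z)) (at \<sigma> within {0..1})"
        by (simp add: has_real_derivative_iff_has_vector_derivative)
      from DERIV_mult[OF DERIV_ident this]
      show "((\<lambda>\<sigma>. \<sigma> * g (fst z, \<sigma> * snd z)) has_vector_derivative
          g (fst z, \<sigma> * snd z) + snd z * (\<sigma> * g2 (fst z, \<sigma> * snd z))) (at \<sigma> within {0..1})"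
        unfolding has_real_derivative_iff_has_vector_derivative by (simp add: algebra_simps)
    qed simp
    have B: "((\<lambda>\<sigma>. g (fst z, \<sigma> * snd z) + snd z * (\<sigma> * g2 (fst z, \<sigma> * snd z))) has_integral
        I z + snd z * I2 z) {0..1}"
      unfolding I_def I2_def
      by (intro has_integral_add has_integral_mult_right integrable_integral integrable_continuous_real cc continuous_intros)
    show ?thesis using has_integral_unique[OF A B] by simp
  qed
  define G where "G z = snd z * I z" for z
  have "C1 G (\<lambda>z. snd z * I1 z) g"
    unfolding C1_def
  proof (intro conjI allI)
    fix z
    show "(G has_derivative (\<lambda>h. fst h *\<^sub>R (snd z * I1 z) + snd h *\<^sub>R g z)) (at z)"
      unfolding G_def[abs_def]
      by (rule has_derivative_eq_rhs[OF has_derivative_mult[OF has_derivative_snd[OF has_derivative_ident] dI]])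
        (auto simp: g_eq algebra_simps)
  qed (auto intro!: continuous_intros cI1 cg)
  then show thesis
    by (rule that) (auto simp: G_def I_def)
qed


text \<open>The Cauchy-Schwarz inequality against the constant 1, from the nonnegative integral of
  the square of \<open>f\<close> minus its mean.\<close>

lemma integral_square_le:
  fixes f :: "real \<Rightarrow> real"
  assumes "a \<le> b" "continuous_on {a..b} f"
  shows "(integral {a..b} f)\<^sup>2 \<le> (b - a) * integral {a..b} (\<lambda>x. (f x)\<^sup>2)"
proof (cases "a = b")
  case False
  then have ab: "b - a > 0" using assms by simp
  define I where "I = integral {a..b} f"
  define Q where "Q = integral {a..b} (\<lambda>x. (f x)\<^sup>2)"
  define c where "c = I / (b - a)"
  have i: "(f has_integral I) {a..b}" "((\<lambda>x. (f x)\<^sup>2) has_integral Q) {a..b}"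
    unfolding I_def Q_def
    by (intro integrable_integral integrable_continuous_real continuous_intros assms)+
  have "((\<lambda>x. (f x)\<^sup>2 - 2 * c * f x + c\<^sup>2) has_integral Q - 2 * c * I + (b - a) *\<^sub>R c\<^sup>2) {a..b}"
    by (intro has_integral_add has_integral_diff has_integral_mult_right i)
      (use has_integral_const_real[of "c\<^sup>2" a b] assms in simp)
  moreover have "(f x)\<^sup>2 - 2 * c * f x + c\<^sup>2 = (f x - c)\<^sup>2" for x
    by (simp add: power2_eq_square algebra_simps)
  ultimately have "((\<lambda>x. (f x - c)\<^sup>2) has_integral Q - 2 * c * I + (b - a) * c\<^sup>2) {a..b}"
    by simp
  then have "0 \<le> Q - 2 * c * I + (b - a) * c\<^sup>2"
    by (rule has_integral_nonneg) simp
  also have "\<dots> = Q - I\<^sup>2 / (b - a)"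
    using ab by (simp add: c_def power2_eq_square)
  finally show ?thesis
    using ab by (simp add: I_def Q_def pos_divide_le_eq mult.commute)
qed simp

text \<open>With \<open>\<partial>\<^sub>t G = g\<close>, the integral of \<open>g\<close> over the disc is the integral of \<open>- G ds\<close> over its boundary, where
  \<open>G\<close> is compared with its values on the horizontal sides of the square. This replaces the
  transformation formula for polar coordinates.\<close>

lemma disc_integral_le_square:
  fixes g :: "real \<times> real \<Rightarrow> real"
  assumes g: "C1 g g1 g2" and pos: "\<And>w. 0 \<le> g w" and R: "0 < R"
  shows "integral {0..R} (\<lambda>r. r * integral {0..2*pi} (\<lambda>\<theta>. g (polar z r \<theta>))) \<le>
    integral {fst z - R..fst z + R} (\<lambda>s. integral {snd z - R..snd z + R} (\<lambda>t. g (s, t)))"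
proof -
  obtain s0 t0 where z: "z = (s0, t0)" by (cases z)
  obtain G G1 where G: "C1 G G1 g" using C1_primitive[OF g] by metis
  note cG = C1_continuous[OF G]
  define \<Gamma> where "\<Gamma> r = integral {0..2*pi} (\<lambda>\<theta>. G (polar z r \<theta>) * (r * sin \<theta>))" for r
  have zero: "C1 (\<lambda>_. c) (\<lambda>_. 0) (\<lambda>_. 0)" for c :: real
    by (simp add: C1_def)
  \<comment> \<open>For this choice of X the integrand of \<open>polar_stokes\<close> is
    \<open>g\<close>, and the line integral is that of - G ds.\<close>
  have X: "C1 (\<lambda>w. - fst w :: real) (\<lambda>_. -1) (\<lambda>_. 0)"
    unfolding C1_def by (auto intro!: derivative_eq_intros)
  have "(\<Gamma> has_real_derivative r * integral {0..2*pi} (\<lambda>\<theta>. g (polar z r \<theta>))) (at r)" for r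
    using polar_stokes[OF G X zero zero, of z r] by (simp add: \<Gamma>_def[abs_def])
  then have "((\<lambda>r. r * integral {0..2*pi} (\<lambda>\<theta>. g (polar z r \<theta>))) has_integral \<Gamma> R - \<Gamma> 0) {0..R}"
    using R by (intro fundamental_theorem_of_calculus)
      (auto simp: has_real_derivative_iff_has_vector_derivative[symmetric] intro: has_field_derivative_at_within)
  then have lhs: "integral {0..R} (\<lambda>r. r * integral {0..2*pi} (\<lambda>\<theta>. g (polar z r \<theta>))) = \<Gamma> R"
    by (simp add: integral_unique \<Gamma>_def)
  have Gt: "((\<lambda>t. G (s, t)) has_vector_derivative g (s, t)) (at t within T)" for s t T
  proof -
    have "((\<lambda>t. (s, t)) has_vector_derivative (0, 1)) (at t within T)"
      by (auto intro!: derivative_eq_intros has_vector_derivative_Pair)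
    from C1_along[OF G this refl] show ?thesis by simp
  qed
  have mono: "G (s, t) \<le> G (s, t')" if "t \<le> t'" for s t t'
    by (rule DERIV_nonneg_imp_nondecreasing[OF that, of "\<lambda>t. G (s, t)"])
      (use Gt pos in \<open>blast intro: has_real_derivative_iff_has_vector_derivative[THEN iffD2]\<close>)
  \<comment> \<open>Since \<open>g\<close> is nonnegative, \<open>G\<close> increases in
    \<open>t\<close>. On the upper half circle it is at most its value on the top side, on the lower
    half circle at least its value on the bottom side, and the sign of \<open>sin \<theta>\<close>
    turns both into upper bounds. The comparison functions depend on \<open>s\<close> only, so their
    integrals are evaluated by substitution.\<close>
  define kp where "kp \<sigma> = G (\<sigma>, t0 + R)" for \<sigma>
  define km where "km \<sigma> = G (\<sigma>, t0 - R)" for \<sigma>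
  have ck: "continuous_on UNIV kp" "continuous_on UNIV km"
    unfolding kp_def km_def by (intro cG[THEN continuous_on_UNIV_compose] continuous_intros)+
  obtain Kp where Kp: "\<And>x. (Kp has_vector_derivative kp x) (at x)"
    using has_antiderivative[OF ck(1)] by blast
  obtain Km where Km: "\<And>x. (Km has_vector_derivative km x) (at x)"
    using has_antiderivative[OF ck(2)] by blast
  have sub: "((\<lambda>\<theta>. k (s0 + R * cos \<theta>) * (R * sin \<theta>)) has_integral K (s0 + R * cos a) - K (s0 + R * cos b)) {a..b}"
    if "\<And>x. (K has_vector_derivative k x) (at x)" "a \<le> b" for k K and a b :: real
  proof -
    have "((\<lambda>\<theta>. - K (s0 + R * cos \<theta>)) has_real_derivative k (s0 + R * cos \<theta>) * (R * sin \<theta>)) (at \<theta> within {a..b})" for \<theta>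
    proof -
      have "((\<lambda>\<theta>. s0 + R * cos \<theta>) has_real_derivative - R * sin \<theta>) (at \<theta> within {a..b})"
        by (auto intro!: derivative_eq_intros)
      from DERIV_minus[OF DERIV_chain2[OF that(1)[unfolded has_real_derivative_iff_has_vector_derivative[symmetric]] this]]
      show ?thesis by simp
    qed
    then have "((\<lambda>\<theta>. k (s0 + R * cos \<theta>) * (R * sin \<theta>)) has_integral
       - K (s0 + R * cos b) - - K (s0 + R * cos a)) {a..b}"
      by (intro fundamental_theorem_of_calculus that(2))
        (auto simp: has_real_derivative_iff_has_vector_derivative)
    then show ?thesis by simp
  qed
  have int: "(\<lambda>\<theta>. G (polar z R \<theta>) * (R * sin \<theta>)) integrable_on {a..b}" for a b
    by (intro integrable_continuous_real continuous_intros cG[THEN continuous_on_UNIV_compose])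
  have 1: "integral {0..pi} (\<lambda>\<theta>. G (polar z R \<theta>) * (R * sin \<theta>)) \<le> Kp (s0 + R) - Kp (s0 - R)"
  proof -
    have "integral {0..pi} (\<lambda>\<theta>. G (polar z R \<theta>) * (R * sin \<theta>)) \<le>
       integral {0..pi} (\<lambda>\<theta>. kp (s0 + R * cos \<theta>) * (R * sin \<theta>))"
      by (intro integral_le int has_integral_integrable[OF sub[OF Kp]] mult_right_mono)
        (use R in \<open>auto simp: kp_def polar_def z sin_ge_zero intro!: mono\<close>)
    also have "\<dots> = Kp (s0 + R) - Kp (s0 - R)"
      using integral_unique[OF sub[OF Kp, of 0 pi]] by simp
    finally show ?thesis .
  qed
  have 2: "integral {pi..2*pi} (\<lambda>\<theta>. G (polar z R \<theta>) * (R * sin \<theta>)) \<le> Km (s0 - R) - Km (s0 + R)"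
  proof -
    have "integral {pi..2*pi} (\<lambda>\<theta>. G (polar z R \<theta>) * (R * sin \<theta>)) \<le>
       integral {pi..2*pi} (\<lambda>\<theta>. km (s0 + R * cos \<theta>) * (R * sin \<theta>))"
    proof (intro integral_le int has_integral_integrable[OF sub[OF Km]] mult_right_mono_neg)
      fix \<theta> assume th: "\<theta> \<in> {pi..2*pi}"
      then show "R * sin \<theta> \<le> 0"
        using R sin_le_zero[of \<theta>] by (cases "\<theta> = 2*pi") (auto simp: mult_le_0_iff)
      have "R * (-1) \<le> R * sin \<theta>" using R by (intro mult_left_mono) auto
      then show "km (s0 + R * cos \<theta>) \<le> G (polar z R \<theta>)"
        by (auto simp: km_def polar_def z intro!: mono)
    qed simp
    also have "\<dots> = Km (s0 - R) - Km (s0 + R)"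
      using integral_unique[OF sub[OF Km, of pi "2*pi"]] by simp
    finally show ?thesis .
  qed
  have "\<Gamma> R = integral {0..pi} (\<lambda>\<theta>. G (polar z R \<theta>) * (R * sin \<theta>))
      + integral {pi..2*pi} (\<lambda>\<theta>. G (polar z R \<theta>) * (R * sin \<theta>))"
    unfolding \<Gamma>_def by (rule Henstock_Kurzweil_Integration.integral_combine[symmetric, OF _ _ int]) auto
  also have "\<dots> \<le> (Kp (s0 + R) - Km (s0 + R)) - (Kp (s0 - R) - Km (s0 - R))"
    using 1 2 by simp
  also have "\<dots> = integral {s0 - R..s0 + R} (\<lambda>s. kp s - km s)"
    using R by (intro integral_unique[symmetric] fundamental_theorem_of_calculus
        has_vector_derivative_diff Kp[THEN has_vector_derivative_at_within] Km[THEN has_vector_derivative_at_within]) auto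
  also have "(\<lambda>s. kp s - km s) = (\<lambda>s. integral {t0 - R..t0 + R} (\<lambda>t. g (s, t)))"
    using R unfolding kp_def km_def
    by (intro ext integral_unique[symmetric] fundamental_theorem_of_calculus Gt) auto
  finally show ?thesis using lhs by (simp add: z)
qed

text \<open>Let \<open>e(r) = r \<integral> |\<nabla>(x, p)|\<^sup>2 d\<theta>\<close> and \<open>a(r) = - \<integral> p \<bullet> \<partial>\<^sub>\<theta> x d\<theta>\<close> on the circle of radius \<open>r\<close>. Then
  \<open>e \<le> M a' + 2 \<pi> r F\<close> and \<open>|a| \<le> 2 \<pi> r e\<close>, hence \<open>r\<^sup>-\<^sup>\<gamma> e\<close> is at most \<open>2 M (r\<^sup>-\<^sup>\<gamma> a)'\<close> plus an integrable term
  for \<open>\<gamma> = 1 / (4 \<pi> M)\<close>. As \<open>e\<close> dominates the derivative of the circular mean \<open>m\<close> of \<open>p\<close>, adding a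
  multiple of \<open>r\<^sup>-\<^sup>\<gamma> a\<close> and suitable powers of \<open>r\<close> makes \<open>\<nu> \<bullet> m\<close> monotone for every unit vector \<open>\<nu>\<close>.
  The weight \<open>\<kappa>\<close> balances these terms and \<open>Q\<close> is a free parameter.\<close>

lemma interior_estimate:
  fixes x p :: "real \<times> real \<Rightarrow> 'a::euclidean_space"
  assumes x: "smooth_on UNIV x" and p: "smooth_on UNIV p"
    and M: "1 \<le> M" and F: "0 \<le> F" and R: "0 < R" and Q: "0 < Q"
    and g: "\<And>w. g w = (norm (D1 x w))\<^sup>2 + (norm (D2 x w))\<^sup>2 + (norm (D1 p w))\<^sup>2 + (norm (D2 p w))\<^sup>2"
    and le: "\<And>w. g w \<le> M * (D2 p w \<bullet> D1 x w - D1 p w \<bullet> D2 x w) + F"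
  shows "norm (p z) \<le> norm (integral {0..2*pi} (\<lambda>\<theta>. p (polar z R \<theta>))) / (2*pi)
    + R * (M * integral {0..2*pi} (\<lambda>\<theta>. g (polar z R \<theta>)) / Q + F / Q + 2 * pi * M * Q)"
proof -
  note Cx = C1_smooth[OF x] C1_smooth[OF smooth_on_D1[OF x]] C1_smooth[OF smooth_on_D2[OF x]]
  note Cp = C1_smooth[OF p]
  have comm: "D1 (D2 x) = D2 (D1 x)"
    by (rule ext) (rule D1_D2_commute[OF open_UNIV x UNIV_I])
  have cont: "continuous_on UNIV p" "continuous_on UNIV x" "continuous_on UNIV (D1 x)" "continuous_on UNIV (D2 x)"
    "continuous_on UNIV (D1 p)" "continuous_on UNIV (D2 p)"
    using C1_continuous[OF Cx(1)] C1_continuous[OF Cp] by auto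
  have cg: "continuous_on UNIV g"
    unfolding g by (intro continuous_intros cont)
  note cc = cont[THEN continuous_on_UNIV_compose] cg[THEN continuous_on_UNIV_compose]
  have g0: "0 \<le> g w" for w by (simp add: g)
  have sqg: "continuous_on S (\<lambda>\<theta>. sqrt (g (polar z r \<theta>)))" for r S
    by (intro continuous_intros cc)
  define d where "d r = integral {0..2*pi} (\<lambda>\<theta>. g (polar z r \<theta>))" for r
  define m where "m r = (1 / (2*pi)) *\<^sub>R integral {0..2*pi} (\<lambda>\<theta>. p (polar z r \<theta>))" for r
  define Xt where "Xt r \<theta> = r *\<^sub>R (cos \<theta> *\<^sub>R D2 x (polar z r \<theta>) - sin \<theta> *\<^sub>R D1 x (polar z r \<theta>))" for r \<theta>
  define Pt where "Pt r \<theta> = r *\<^sub>R (cos \<theta> *\<^sub>R D2 p (polar z r \<theta>) - sin \<theta> *\<^sub>R D1 p (polar z r \<theta>))" for r \<theta>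
  define Pr where "Pr r \<theta> = cos \<theta> *\<^sub>R D1 p (polar z r \<theta>) + sin \<theta> *\<^sub>R D2 p (polar z r \<theta>)" for r \<theta>
  define q where "q w = D2 p w \<bullet> D1 x w - D1 p w \<bullet> D2 x w" for w
  define a where "a r = - integral {0..2*pi} (\<lambda>\<theta>. p (polar z r \<theta>) \<bullet> Xt r \<theta>)" for r
  define a' where "a' r = r * integral {0..2*pi} (\<lambda>\<theta>. q (polar z r \<theta>))" for r
  have cXt: "continuous_on S (\<lambda>\<theta>. Xt r \<theta>)" and cPt: "continuous_on S (\<lambda>\<theta>. Pt r \<theta>)"
    and cPr: "continuous_on S (\<lambda>\<theta>. Pr r \<theta>)" and cq: "continuous_on S (\<lambda>\<theta>. q (polar z r \<theta>))" for r S
    unfolding Xt_def Pt_def Pr_def q_def by (intro continuous_intros cc)+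
  have d0: "0 \<le> d r" for r
    unfolding d_def by (intro integral_nonneg integrable_continuous_real continuous_intros cc g0)
  have cd: "continuous_on UNIV d" and cm: "continuous_on UNIV m"
    unfolding d_def[abs_def] m_def[abs_def] cbox_interval[symmetric]
    by (intro continuous_intros integral_continuous_on_param; auto simp: case_prod_beta' intro!: continuous_intros cc)+

  have da: "(a has_real_derivative a' r) (at r)" for r
  proof -
    have "q w = - (D1 p w \<bullet> D2 x w - D2 p w \<bullet> D1 x w)" for w
      by (simp add: q_def)
    then have "q = (\<lambda>w. - (D1 p w \<bullet> D2 x w - D2 p w \<bullet> D1 x w))" by blast
    then have "a' r = - (r * integral {0..2*pi} (\<lambda>\<theta>. D1 p (polar z r \<theta>) \<bullet> D2 x (polar z r \<theta>)
        - D2 p (polar z r \<theta>) \<bullet> D1 x (polar z r \<theta>)))"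
      unfolding a'_def by (simp only: integral_neg)
    then show ?thesis
      using DERIV_minus[OF polar_stokes[OF Cp Cx(1) _ Cx(3)], of "D1 (D1 x)" z r] Cx(2)
      unfolding comm a_def[abs_def] Xt_def by simp
  qed
  have rot: "norm (cos \<theta> *\<^sub>R v + sin \<theta> *\<^sub>R w) \<le> sqrt ((norm v)\<^sup>2 + (norm w)\<^sup>2)" for \<theta> and v w :: 'a
  proof (rule real_le_rsqrt)
    have "(norm (cos \<theta> *\<^sub>R v + sin \<theta> *\<^sub>R w))\<^sup>2 \<le> (\<bar>cos \<theta>\<bar> * norm v + \<bar>sin \<theta>\<bar> * norm w)\<^sup>2"
      by (intro power_mono norm_triangle_le) auto
    also have "\<dots> \<le> (\<bar>cos \<theta>\<bar> * norm v + \<bar>sin \<theta>\<bar> * norm w)\<^sup>2 + (\<bar>sin \<theta>\<bar> * norm v - \<bar>cos \<theta>\<bar> * norm w)\<^sup>2"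
      by simp
    also have "\<dots> = (\<bar>cos \<theta>\<bar>\<^sup>2 + \<bar>sin \<theta>\<bar>\<^sup>2) * ((norm v)\<^sup>2 + (norm w)\<^sup>2)"
      by algebra
    finally show "(norm (cos \<theta> *\<^sub>R v + sin \<theta> *\<^sub>R w))\<^sup>2 \<le> (norm v)\<^sup>2 + (norm w)\<^sup>2"
      unfolding power2_abs sin_cos_squared_add2 mult_1_left .
  qed
  have nPr: "norm (Pr r \<theta>) \<le> sqrt (g (polar z r \<theta>))" for r \<theta>
    unfolding Pr_def by (rule order_trans[OF rot real_sqrt_le_mono]) (simp add: g)
  have nXt: "norm (Xt r \<theta>) \<le> r * sqrt (g (polar z r \<theta>))" if "0 \<le> r" for r \<theta>
  proof -
    have "norm (cos \<theta> *\<^sub>R D2 x (polar z r \<theta>) + sin \<theta> *\<^sub>R (- D1 x (polar z r \<theta>))) \<le> sqrt (g (polar z r \<theta>))"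
      by (rule order_trans[OF rot real_sqrt_le_mono]) (simp add: g)
    then show ?thesis using that by (simp add: Xt_def mult_left_mono)
  qed
  have nPt: "norm (Pt r \<theta>) \<le> r * sqrt (g (polar z r \<theta>))" if "0 \<le> r" for r \<theta>
  proof -
    have "norm (cos \<theta> *\<^sub>R D2 p (polar z r \<theta>) + sin \<theta> *\<^sub>R (- D1 p (polar z r \<theta>))) \<le> sqrt (g (polar z r \<theta>))"
      by (rule order_trans[OF rot real_sqrt_le_mono]) (simp add: g)
    then show ?thesis using that by (simp add: Pt_def mult_left_mono)
  qed
  define L where "L r = integral {0..2*pi} (\<lambda>\<theta>. sqrt (g (polar z r \<theta>)))" for r
  have L2: "(L r)\<^sup>2 \<le> 2*pi * d r" for r
    using integral_square_le[OF _ sqg, of 0 "2*pi" r] g0 by (simp add: L_def d_def)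
  have L0: "0 \<le> L r" for r
    unfolding L_def by (intro integral_nonneg integrable_continuous_real sqg) (simp add: g0)

  have abound: "\<bar>a r\<bar> \<le> 2*pi * r\<^sup>2 * d r" if r: "0 \<le> r" for r
  proof -
    have "(Xt r has_integral x (polar z r (2*pi)) - x (polar z r 0)) {0..2*pi}"
      unfolding Xt_def by (intro fundamental_theorem_of_calculus C1_polar[OF Cx(1)]) simp
    \<comment> \<open>\<open>x\<close> closes up along the circle, so \<open>p\<close> may be
      replaced by its deviation from the value at angle 0. This makes the bound for
      \<open>a r\<close> quadratic in the gradient, as in the isoperimetric inequality.\<close>
    then have X0: "(Xt r has_integral 0) {0..2*pi}" by (simp add: polar_def)
    have i1: "((\<lambda>\<theta>. p (polar z r \<theta>) \<bullet> Xt r \<theta>) has_integral - a r) {0..2*pi}"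
      unfolding a_def minus_minus
      by (intro integrable_integral integrable_continuous_real continuous_intros cc cXt)
    have i2: "((\<lambda>\<theta>. p (polar z r 0) \<bullet> Xt r \<theta>) has_integral p (polar z r 0) \<bullet> 0) {0..2*pi}"
      using has_integral_linear[OF X0 bounded_linear_inner_right] by (simp add: o_def)
    have i: "((\<lambda>\<theta>. (p (polar z r \<theta>) - p (polar z r 0)) \<bullet> Xt r \<theta>) has_integral - a r) {0..2*pi}"
      using has_integral_diff[OF i1 i2] by (simp add: inner_diff_left)
    have osc: "norm (p (polar z r \<theta>) - p (polar z r 0)) \<le> r * L r" if th: "\<theta> \<in> {0..2*pi}" for \<theta>
    proof -
      have "(Pt r has_integral p (polar z r \<theta>) - p (polar z r 0)) {0..\<theta>}"
        unfolding Pt_def by (intro fundamental_theorem_of_calculus C1_polar[OF Cp]) (use th in simp)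
      then have "norm (p (polar z r \<theta>) - p (polar z r 0)) = norm (integral {0..\<theta>} (Pt r))"
        by (simp add: integral_unique)
      also have "\<dots> \<le> integral {0..\<theta>} (\<lambda>\<theta>. r * sqrt (g (polar z r \<theta>)))"
        by (intro integral_norm_bound_integral integrable_continuous_real cPt continuous_intros sqg nPt r)
      also have "\<dots> \<le> integral {0..2*pi} (\<lambda>\<theta>. r * sqrt (g (polar z r \<theta>)))"
        by (intro integral_subset_le integrable_continuous_real continuous_intros sqg)
          (use th r g0 in auto)
      finally show ?thesis by (simp add: L_def)
    qed
    have "norm (integral {0..2*pi} (\<lambda>\<theta>. (p (polar z r \<theta>) - p (polar z r 0)) \<bullet> Xt r \<theta>)) \<le>
        integral {0..2*pi} (\<lambda>\<theta>. r * L r * (r * sqrt (g (polar z r \<theta>))))"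
    proof (intro integral_norm_bound_integral integrable_continuous_real continuous_intros sqg cXt cc)
      fix \<theta> assume "\<theta> \<in> {0..2*pi}"
      then have "norm (p (polar z r \<theta>) - p (polar z r 0)) * norm (Xt r \<theta>) \<le> r * L r * (r * sqrt (g (polar z r \<theta>)))"
        using osc nXt[OF r] r L0 by (intro mult_mono) auto
      then show "norm ((p (polar z r \<theta>) - p (polar z r 0)) \<bullet> Xt r \<theta>) \<le> r * L r * (r * sqrt (g (polar z r \<theta>)))"
        unfolding real_norm_def by (rule order_trans[OF Cauchy_Schwarz_ineq2])
    qed
    also have "\<dots> = r\<^sup>2 * (L r)\<^sup>2"
      by (simp add: L_def power2_eq_square)
    also have "\<dots> \<le> r\<^sup>2 * (2*pi * d r)"
      by (intro mult_left_mono L2) simp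
    finally show ?thesis using integral_unique[OF i] by (simp add: algebra_simps)
  qed

  have ebound: "r * d r \<le> M * a' r + 2*pi*r*F" if r: "0 \<le> r" for r
  proof -
    have "d r \<le> integral {0..2*pi} (\<lambda>\<theta>. M * q (polar z r \<theta>) + F)"
      unfolding d_def q_def
      by (intro integral_le integrable_continuous_real continuous_intros cc le)
    also have "\<dots> = M * integral {0..2*pi} (\<lambda>\<theta>. q (polar z r \<theta>)) + 2*pi*F"
      by (subst integral_add) (auto intro!: integrable_continuous_real continuous_intros cq)
    finally have "r * d r \<le> r * (M * integral {0..2*pi} (\<lambda>\<theta>. q (polar z r \<theta>)) + 2*pi*F)"
      using r by (rule mult_left_mono)
    then show ?thesis by (simp add: a'_def algebra_simps)
  qed

  define m' where "m' r = (1 / (2*pi)) *\<^sub>R integral {0..2*pi} (Pr r)" for r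
  have dm: "(m has_vector_derivative m' r) (at r)" for r
  proof -
    have "((\<lambda>r. integral (cbox 0 (2*pi)) (\<lambda>\<theta>. p (polar z r \<theta>))) has_vector_derivative
        integral (cbox 0 (2*pi)) (Pr r)) (at r within UNIV)"
      by (rule leibniz_rule_vector_derivative)
        (auto simp: case_prod_beta' Pr_def intro!: continuous_intros cc C1_polar[OF Cp] integrable_continuous_real)
    from bounded_linear.has_vector_derivative[OF bounded_linear_scaleR_right[of "1 / (2*pi)"] this]
    show ?thesis unfolding m_def[abs_def] m'_def cbox_interval .
  qed
  \<comment> \<open>Young's inequality with a weight \<open>c\<close>, which will depend on the
    radius.\<close>
  have m'bound: "norm (m' r) \<le> c * d r / (4*pi) + 1 / (2 * c)" if "0 < c" for r c
  proof -
    have "norm (integral {0..2*pi} (Pr r)) \<le> integral {0..2*pi} (\<lambda>\<theta>. c / 2 * g (polar z r \<theta>) + 1 / (2 * c))"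
    proof (intro integral_norm_bound_integral integrable_continuous_real continuous_intros cPr cc)
      fix \<theta>
      have "0 \<le> (c * sqrt (g (polar z r \<theta>)) - 1)\<^sup>2" by simp
      also have "\<dots> = c\<^sup>2 * g (polar z r \<theta>) - 2 * c * sqrt (g (polar z r \<theta>)) + 1"
        using g0[of "polar z r \<theta>"] by (simp add: power2_diff power_mult_distrib)
      finally have "sqrt (g (polar z r \<theta>)) \<le> c / 2 * g (polar z r \<theta>) + 1 / (2 * c)"
        using that by (simp add: field_simps power2_eq_square)
      then show "norm (Pr r \<theta>) \<le> c / 2 * g (polar z r \<theta>) + 1 / (2 * c)"
        using nPr order_trans by blast
    qed
    also have "\<dots> = c / 2 * d r + pi / c"
      unfolding d_def by (subst integral_add) (auto intro!: integrable_continuous_real continuous_intros cc)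
    finally have "norm (integral {0..2*pi} (Pr r)) / (2*pi) \<le> (c / 2 * d r + pi / c) / (2*pi)"
      by (intro divide_right_mono) auto
    then show ?thesis using that by (simp add: m'_def field_simps)
  qed

  \<comment> \<open>Differentiating the weight in r^-\<gamma> a produces \<gamma> a / r. With this
    \<gamma> the isoperimetric bound makes \<open>M\<close> times that term at most half of
    \<open>r * d r\<close>, so the other half survives.\<close>
  define \<gamma> where "\<gamma> = 1 / (4 * pi * M)"
  have gam: "0 < \<gamma>" "\<gamma> < 1" "2 * pi * \<gamma> = 1 / (2 * M)"
  proof -
    have M0: "0 < M" using M by simp
    have "1 < 4 * pi * M" using M pi_gt3 mult_mono[of 1 M 12 "4 * pi"] by (simp add: mult.commute)
    then show "\<gamma> < 1" unfolding \<gamma>_def using M0 by (subst divide_less_eq_1_pos) auto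
    show "0 < \<gamma>" using M0 by (simp add: \<gamma>_def)
    show "2 * pi * \<gamma> = 1 / (2 * M)" unfolding \<gamma>_def using M0 by (simp add: field_simps)
  qed
  \<comment> \<open>Chosen so that \<kappa> R^(2-\<gamma>) = R / Q and R^\<gamma> / \<kappa> = R Q:
    at radius \<open>R\<close> all correction terms then have \<open>R\<close> as a factor.\<close>
  define \<kappa> where "\<kappa> = R powr (\<gamma> - 1) / Q"
  have kap: "0 < \<kappa>" using R Q by (simp add: \<kappa>_def)
  define h where "h r = r powr (-\<gamma>) * a r" for r
  \<comment> \<open>Up to the factor \<open>\<kappa> / (4*pi)\<close>, the bracket has a derivative
    dominating the weighted energy r^(1-\<gamma>) d. The last summand integrates the remainder
    \<open>1 / (2 * c)\<close> of Young's inequality.\<close>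
  define Sf where "Sf r = \<kappa> / (4*pi) * (2 * M * h r + 4*pi*F * (r powr (2-\<gamma>) / (2-\<gamma>))) + r powr \<gamma> / (2 * \<kappa> * \<gamma>)" for r
  \<comment> \<open>Pairing with the direction of \<open>p z\<close> reduces the vector estimate to
    the monotonicity of a scalar function. If \<open>p z = 0\<close>, then \<open>sgn\<close> is 0
    and the identity \<open>\<nu> \<bullet> p z = norm (p z)\<close> still holds.\<close>
  define \<nu> where "\<nu> = sgn (p z)"
  have nu: "norm \<nu> \<le> 1" "\<nu> \<bullet> p z = norm (p z)"
  proof -
    show "norm \<nu> \<le> 1" by (simp add: \<nu>_def norm_sgn)
    show "\<nu> \<bullet> p z = norm (p z)"
      by (cases "p z = 0") (simp_all add: \<nu>_def sgn_div_norm dot_square_norm power2_eq_square)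
  qed
  define \<Psi> where "\<Psi> r = \<nu> \<bullet> m r + Sf r" for r
  have mono: "\<Psi> r \<le> \<Psi> R" if r: "0 < r" "r \<le> R" for r
  proof (rule DERIV_nonneg_imp_nondecreasing[OF r(2)])
    fix \<rho> assume rho: "r \<le> \<rho>" "\<rho> \<le> R"
    then have rp: "0 < \<rho>" using r by simp
    define h' where "h' = \<rho> powr (-\<gamma>) * (a' \<rho> - \<gamma> * a \<rho> / \<rho>)"
    define S' where "S' = \<kappa> / (4*pi) * (2 * M * h' + 4*pi*F * \<rho> powr (1-\<gamma>)) + \<rho> powr (\<gamma>-1) / (2 * \<kappa>)"
    have dh: "(h has_real_derivative h') (at \<rho>)"
    proof -
      have "(h has_real_derivative (-\<gamma> * \<rho> powr (-\<gamma> - 1)) * a \<rho> + \<rho> powr (-\<gamma>) * a' \<rho>) (at \<rho>)"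
        unfolding h_def[abs_def]
        using DERIV_mult[OF has_real_derivative_powr[OF rp, of "-\<gamma>"] da] by (simp add: algebra_simps)
      moreover have "\<rho> powr (-\<gamma> - 1) = \<rho> powr (-\<gamma>) / \<rho>"
        using rp by (simp add: powr_diff)
      ultimately show ?thesis by (simp add: h'_def algebra_simps)
    qed
    have dS: "(Sf has_real_derivative S') (at \<rho>)"
    proof -
      have 1: "((\<lambda>r. r powr (2-\<gamma>) / (2-\<gamma>)) has_real_derivative \<rho> powr (1-\<gamma>)) (at \<rho>)"
        using DERIV_cdivide[OF has_real_derivative_powr[OF rp, of "2-\<gamma>"], of "2-\<gamma>"] gam by simp
      have 2: "((\<lambda>r. r powr \<gamma> / (2*\<kappa>*\<gamma>)) has_real_derivative \<rho> powr (\<gamma>-1) / (2*\<kappa>)) (at \<rho>)"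
        using DERIV_cdivide[OF has_real_derivative_powr[OF rp, of \<gamma>], of "2*\<kappa>*\<gamma>"] gam by simp
      show ?thesis
        unfolding Sf_def[abs_def] S'_def
        by (intro DERIV_add DERIV_cmult 2 dh 1)
    qed
    have dPsi: "(\<Psi> has_real_derivative \<nu> \<bullet> m' \<rho> + S') (at \<rho>)"
    proof -
      have "((\<lambda>r. \<nu> \<bullet> m r) has_real_derivative \<nu> \<bullet> m' \<rho>) (at \<rho>)"
        unfolding has_real_derivative_iff_has_vector_derivative
        by (rule bounded_linear.has_vector_derivative[OF bounded_linear_inner_right dm])
      from DERIV_add[OF this dS] show ?thesis by (simp add: \<Psi>_def[abs_def])
    qed
    have "0 \<le> \<nu> \<bullet> m' \<rho> + S'"
    proof -
      \<comment> \<open>With this weight \<open>c * d \<rho>\<close> becomes \<open>\<kappa>\<close>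
        times the left-hand side of \<open>key\<close>, and \<open>1 / (2*c)\<close> becomes the
        last summand of \<open>S'\<close>.\<close>
      define c where "c = \<kappa> * \<rho> powr (1-\<gamma>)"
      have c: "0 < c" "1 / (2*c) = \<rho> powr (\<gamma>-1) / (2*\<kappa>)"
        using kap rp powr_minus[of \<rho> "1-\<gamma>"] by (auto simp: c_def field_simps)
      have rr: "\<rho> powr (1-\<gamma>) = \<rho> powr (-\<gamma>) * \<rho>"
        using rp powr_add[of \<rho> "-\<gamma>" 1] by simp
      have key: "\<rho> powr (-\<gamma>) * (\<rho> * d \<rho>) \<le> 2 * M * h' + 4*pi*F * \<rho> powr (1-\<gamma>)"
      proof -
        have "\<gamma> * a \<rho> / \<rho> \<le> \<gamma> * (2*pi * \<rho>\<^sup>2 * d \<rho>) / \<rho>"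
          using abound[of \<rho>] rp gam by (intro divide_right_mono mult_left_mono) auto
        also have "\<dots> = (2 * pi * \<gamma>) * (\<rho> * d \<rho>)"
          using rp by (simp add: power2_eq_square)
        also have "\<dots> = \<rho> * d \<rho> / (2 * M)" by (simp add: gam)
        finally have "2 * M * (\<gamma> * a \<rho> / \<rho>) \<le> \<rho> * d \<rho>"
          using M by (simp add: field_simps)
        then have "\<rho> * d \<rho> \<le> 2 * M * (a' \<rho> - \<gamma> * a \<rho> / \<rho>) + 4*pi*F*\<rho>"
          using ebound[of \<rho>] rp by (simp add: algebra_simps)
        then have "\<rho> powr (-\<gamma>) * (\<rho> * d \<rho>) \<le> \<rho> powr (-\<gamma>) * (2 * M * (a' \<rho> - \<gamma> * a \<rho> / \<rho>) + 4*pi*F*\<rho>)"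
          by (intro mult_left_mono) auto
        then show ?thesis unfolding h'_def rr by (simp add: algebra_simps)
      qed
      have "- (\<nu> \<bullet> m' \<rho>) \<le> norm (m' \<rho>)"
        using norm_cauchy_schwarz[of "-\<nu>" "m' \<rho>"] nu(1) mult_right_mono[OF nu(1) norm_ge_zero, of "m' \<rho>"] by simp
      also have "\<dots> \<le> c * d \<rho> / (4*pi) + 1 / (2*c)"
        by (rule m'bound[OF c(1)])
      also have "c * d \<rho> / (4*pi) = \<kappa> / (4*pi) * (\<rho> powr (-\<gamma>) * (\<rho> * d \<rho>))"
        by (simp add: c_def rr)
      also have "\<kappa> / (4*pi) * (\<rho> powr (-\<gamma>) * (\<rho> * d \<rho>)) \<le>
          \<kappa> / (4*pi) * (2 * M * h' + 4*pi*F * \<rho> powr (1-\<gamma>))"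
        using kap by (intro mult_left_mono key) auto
      finally have "- (\<nu> \<bullet> m' \<rho>) \<le> S'"
        unfolding c(2) S'_def by simp
      then show ?thesis by simp
    qed
    then show "\<exists>y. (\<Psi> has_real_derivative y) (at \<rho>) \<and> 0 \<le> y"
      using dPsi by blast
  qed

  \<comment> \<open>At the centre the circular mean is \<open>p z\<close> and the corrections
    disappear: by the isoperimetric bound, \<open>h\<close> is of order r^(2-\<gamma>), with
    \<gamma> < 1.\<close>
  have lim: "(\<Psi> \<longlongrightarrow> norm (p z)) (at_right 0)"
  proof -
    have m0: "(m \<longlongrightarrow> p z) (at_right 0)"
    proof -
      have "m 0 = p z" by (simp add: m_def polar_def)
      moreover have "isCont m 0" using cm by (simp add: continuous_on_eq_continuous_at)
      ultimately show ?thesis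
        unfolding isCont_def using tendsto_within_subset[of m _ 0 UNIV] by auto
    qed
    have pw: "((\<lambda>r::real. r powr b) \<longlongrightarrow> 0) (at_right 0)" if "0 < b" for b
      using tendsto_neg_powr that
      by (intro tendsto_eq_rhs[OF tendsto_powr'[OF tendsto_ident_at tendsto_const]]) (auto simp: eventually_at_filter)
    have h0: "(h \<longlongrightarrow> 0) (at_right 0)"
    proof -
      have "compact (d ` {0..1})"
        by (intro compact_continuous_image continuous_on_subset[OF cd]) auto
      then obtain B where B: "\<And>r. r \<in> {0..1} \<Longrightarrow> norm (d r) \<le> B"
        using compact_imp_bounded bounded_iff by (metis imageI)
      have 1: "\<forall>\<^sub>F r in at_right 0. norm (h r) \<le> 2*pi*B * r powr (2-\<gamma>)"
        using eventually_at_right_real[of 0 1, OF zero_less_one]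
      proof eventually_elim
        case (elim r)
        then have r: "0 < r" "r \<le> 1" by auto
        have "norm (h r) = r powr (-\<gamma>) * \<bar>a r\<bar>" by (simp add: h_def abs_mult)
        also have "\<dots> \<le> r powr (-\<gamma>) * (2*pi * r\<^sup>2 * d r)"
          using abound[of r] r by (intro mult_left_mono) auto
        also have "\<dots> \<le> r powr (-\<gamma>) * (2*pi * r\<^sup>2 * B)"
          using B[of r] r by (intro mult_left_mono) auto
        also have "\<dots> = 2*pi*B * r powr (2-\<gamma>)"
          using r powr_add[of r 2 "-\<gamma>"] by (simp add: powr_numeral)
        finally show ?case .
      qed
      have "((\<lambda>r. 2*pi*B * r powr (2-\<gamma>)) \<longlongrightarrow> 0) (at_right 0)"
        by (rule tendsto_mult_right_zero[OF pw]) (use gam in simp)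
      then show ?thesis by (rule Lim_null_comparison[OF 1])
    qed
    have "(\<Psi> \<longlongrightarrow> \<nu> \<bullet> p z + (\<kappa> / (4*pi) * (2 * M * 0 + 4*pi*F * (0 / (2-\<gamma>))) + 0 / (2 * \<kappa> * \<gamma>))) (at_right 0)"
      unfolding \<Psi>_def[abs_def] Sf_def by (intro tendsto_intros m0 h0 pw) (use gam kap in auto)
    then show ?thesis by (simp add: nu)
  qed
  have "norm (p z) \<le> \<Psi> R"
    by (rule tendsto_upperbound[OF lim]) 
      (use eventually_at_right_real[OF R] in \<open>auto elim!: eventually_mono intro!: mono\<close>)
  also have "\<dots> \<le> norm (m R) + R * (M * d R / Q + F / Q + 2 * pi * M * Q)"
  proof -
    have 1: "\<nu> \<bullet> m R \<le> norm (m R)"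
      using norm_cauchy_schwarz[of \<nu> "m R"] mult_right_mono[OF nu(1) norm_ge_zero, of "m R"] by simp
    have k1: "\<kappa> * R powr (2-\<gamma>) = R / Q"
      using R powr_add[of R "\<gamma>-1" "2-\<gamma>"] by (simp add: \<kappa>_def)
    have "h R \<le> R powr (-\<gamma>) * (2*pi * R\<^sup>2 * d R)"
      unfolding h_def using abound[of R] R by (intro mult_left_mono) auto
    also have "\<dots> = 2*pi * R powr (2-\<gamma>) * d R"
      using R powr_add[of R 2 "-\<gamma>"] by (simp add: powr_numeral)
    finally have "\<kappa> / (4*pi) * (2 * M * h R) \<le> \<kappa> / (4*pi) * (2 * M * (2*pi * R powr (2-\<gamma>) * d R))"
      using kap M by (intro mult_left_mono) auto
    also have "\<dots> = M * d R * (\<kappa> * R powr (2-\<gamma>))"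
      by simp
    also have "\<dots> = R * (M * d R / Q)" unfolding k1 by simp
    finally have 2: "\<kappa> / (4*pi) * (2 * M * h R) \<le> R * (M * d R / Q)" .
    have "\<kappa> / (4*pi) * (4*pi*F * (R powr (2-\<gamma>) / (2-\<gamma>))) = (\<kappa> * R powr (2-\<gamma>)) * F / (2-\<gamma>)"
      by simp
    also have "\<dots> = R * F / Q / (2-\<gamma>)" unfolding k1 by simp
    also have "\<dots> \<le> R * F / Q / 1"
      using R F Q gam by (intro divide_left_mono) auto
    finally have 3: "\<kappa> / (4*pi) * (4*pi*F * (R powr (2-\<gamma>) / (2-\<gamma>))) \<le> R * (F / Q)" by simp
    have "R powr \<gamma> / \<kappa> = R * Q"
      using R Q powr_add[of R "\<gamma>-1" 1] by (simp add: \<kappa>_def)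
    then have "R powr \<gamma> / (2 * \<kappa> * \<gamma>) = R * Q / (2 * \<gamma>)" 
      by (metis (no_types, lifting) divide_divide_eq_left mult.commute mult.assoc)
    also have "\<dots> = R * (2 * pi * M * Q)"
      by (simp add: \<gamma>_def)
    finally have 4: "R powr \<gamma> / (2 * \<kappa> * \<gamma>) = R * (2 * pi * M * Q)" .
    show ?thesis
      using 1 2 3 4 unfolding \<Psi>_def Sf_def distrib_left by linarith
  qed
  finally show ?thesis by (simp add: m_def d_def)
qed

section \<open>Lifts of maps into the torus\<close>

lemma torus_cover_add: "torus_cover x = torus_cover y \<Longrightarrow> torus_cover (x + v) = torus_cover (y + v)"
  by (simp add: torus_cover_eq_iff)

lemma surj_torus_cover: "\<exists>x. torus_cover x = (a :: 'n::finite torus)"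
proof -
  have "\<forall>j. \<exists>x. q2 x = a $ j" using surj_q2 by (metis surjD)
  then obtain f where "\<And>j. q2 (f j) = a $ j" by metis
  then have "torus_cover (\<chi> j. f j) = a" by (simp add: torus_cover_def vec_eq_iff)
  then show ?thesis by blast
qed

lemma torus_cover_eq_small:
  assumes "torus_cover v = torus_cover w" "norm (v - w) < 1"
  shows "v = w"
proof -
  have "v $ j $ i = w $ j $ i" for j i
  proof -
    have "v $ j - w $ j \<in> lattice2" using assms(1) by (simp add: torus_cover_eq_iff)
    then have "v $ j $ i - w $ j $ i \<in> \<int>" by (simp add: lattice2_def)
    moreover have "\<bar>v $ j $ i - w $ j $ i\<bar> \<le> norm (v - w)"
      using component_le_norm_cart[of "(v - w) $ j" i] Finite_Cartesian_Product.norm_nth_le[of "v - w" j] by simp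
    ultimately show ?thesis
      using assms(2) Ints_nonzero_abs_less1[of "v $ j $ i - w $ j $ i"] by force
  qed
  then show ?thesis by (simp add: vec_eq_iff)
qed

lemma dist_torus_cover_le: "dist (torus_cover x) (torus_cover y) \<le> dist x y"
proof -
  have "dist (q2 (x $ j)) (q2 (y $ j)) \<le> dist (x $ j) (y $ j)" for j
    unfolding dist_q2 using infdist_le[OF lattice2_zero, of "x $ j - y $ j"] by (simp add: dist_norm)
  then show ?thesis
    unfolding dist_vec_def[of x] dist_vec_def[of "torus_cover x"]
    by (intro L2_set_mono) (auto simp: torus_cover_def)
qed

lemma continuous_on_torus_cover: "continuous_on S torus_cover"
proof -
  have "1-lipschitz_on S torus_cover" by (rule lipschitz_onI) (simp_all add: dist_torus_cover_le)
  then show ?thesis by (rule lipschitz_on_continuous_on)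
qed

section \<open>Continuous lifts of cylinders\<close>

lemma torus_difference_exists:
  "\<exists>v. norm v = dist a b \<and> (\<forall>x. torus_cover x = a \<longrightarrow> torus_cover (x + v) = (b :: 'n::finite torus))"
proof -
  have ne: "lattice2 \<noteq> {}" using lattice2_zero by auto
  obtain x y where xy: "torus_cover x = a" "torus_cover y = b" using surj_torus_cover by metis
  have "\<forall>j. \<exists>l\<in>lattice2. infdist (y $ j - x $ j) lattice2 = dist (y $ j - x $ j) l"
    using infdist_attains_inf[OF closed_lattice2 ne] by blast
  then obtain l where l: "\<And>j. l j \<in> lattice2" "\<And>j. infdist (y $ j - x $ j) lattice2 = dist (y $ j - x $ j) (l j)"
    by metis
  define v where "v = (\<chi> j. y $ j - x $ j - l j)"
  have "norm v = dist b a"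
  proof -
    have "norm (v $ j) = dist (b $ j) (a $ j)" for j
      unfolding xy[symmetric] using l(2)[of j] by (simp add: torus_cover_def dist_q2 v_def dist_norm)
    then show ?thesis by (simp add: norm_vec_def[of v] dist_vec_def[of b a])
  qed
  moreover have "torus_cover (x + v) = b"
    unfolding xy(2)[symmetric] torus_cover_eq_iff using l(1) by (simp add: v_def lattice2_minus)
  ultimately show ?thesis
    using torus_cover_add xy(1) by (metis dist_commute)
qed

text \<open>A shortest displacement on the cover that leads from \<open>a\<close> to
  \<open>b\<close>. For distant points it is an arbitrary choice; for distance below 1/4 it is
  unique and depends continuously on the points.\<close>

definition torus_difference :: "'n::finite torus \<Rightarrow> 'n torus \<Rightarrow> 'n vect" where
  "torus_difference a b = (SOME v. norm v = dist a b \<and> (\<forall>x. torus_cover x = a \<longrightarrow> torus_cover (x + v) = b))"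

lemma norm_torus_difference: "norm (torus_difference a b) = dist a b"
  and torus_cover_add_difference: "torus_cover x = a \<Longrightarrow> torus_cover (x + torus_difference a b) = b"
  using someI_ex[OF torus_difference_exists[of a b]] unfolding torus_difference_def by blast+

lemma continuous_on_torus_difference:
  fixes f g :: "'a::topological_space \<Rightarrow> 'n::finite torus"
  assumes "continuous_on S f" "continuous_on S g" "\<And>z. z \<in> S \<Longrightarrow> dist (f z) (g z) < 1/4"
  shows "continuous_on S (\<lambda>z. torus_difference (f z) (g z))"
  unfolding continuous_on_def
proof
  fix z assume z: "z \<in> S"
  show "((\<lambda>z. torus_difference (f z) (g z)) \<longlongrightarrow> torus_difference (f z) (g z)) (at z within S)"
  proof (rule tendstoI)
    fix e :: real assume e: "0 < e"
    define d where "d = min (e/2) (1/8)"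
    have d: "0 < d" using e by (simp add: d_def)
    have "\<forall>\<^sub>F y in at z within S. dist (f y) (f z) < d" "\<forall>\<^sub>F y in at z within S. dist (g y) (g z) < d"
      using assms(1,2) z d unfolding continuous_on_def by (auto dest: tendstoD)
    moreover have "\<forall>\<^sub>F y in at z within S. y \<in> S"
      by (simp add: eventually_at_filter)
    ultimately show "\<forall>\<^sub>F y in at z within S. dist (torus_difference (f y) (g y)) (torus_difference (f z) (g z)) < e"
    proof eventually_elim
      case (elim y)
      \<comment> \<open>The detour from \<open>f y\<close> to \<open>g y\<close> via
        \<open>f z\<close> and \<open>g z\<close> is another displacement. It is shorter than 1/2,
        the direct one is shorter than 1/4, and they are congruent modulo the lattice, so they
        agree.\<close>
      define w where "w = torus_difference (f y) (f z) + torus_difference (f z) (g z) + torus_difference (g z) (g y)"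
      obtain x where x: "torus_cover x = f y" using surj_torus_cover by blast
      have "torus_cover (x + w) = g y"
        unfolding w_def add.assoc[symmetric]
        by (intro torus_cover_add_difference x)
      then have cov: "torus_cover (x + torus_difference (f y) (g y)) = torus_cover (x + w)"
        using torus_cover_add_difference[OF x, of "g y"] by simp
      have "norm w \<le> dist (f y) (f z) + dist (f z) (g z) + dist (g z) (g y)"
        unfolding w_def norm_torus_difference[symmetric] by (intro norm_triangle_le add_mono order_refl)
      also have "\<dots> < 1/8 + 1/4 + 1/8"
        using elim assms(3)[OF z] by (simp add: d_def dist_commute)
      finally have "norm (x + torus_difference (f y) (g y) - (x + w)) < 1"
        using assms(3)[OF elim(3)] norm_triangle_ineq4[of "torus_difference (f y) (g y)" w]
        by (simp add: norm_torus_difference)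
      from torus_cover_eq_small[OF cov this] have "torus_difference (f y) (g y) = w" by simp
      then have "dist (torus_difference (f y) (g y)) (torus_difference (f z) (g z)) =
          norm (torus_difference (f y) (f z) + torus_difference (g z) (g y))"
        by (simp add: w_def dist_norm)
      also have "\<dots> \<le> dist (f y) (f z) + dist (g z) (g y)"
        unfolding norm_torus_difference[symmetric] by (rule norm_triangle_ineq)
      also have "\<dots> < e" using elim by (simp add: d_def dist_commute)
      finally show ?case .
    qed
  qed
qed

lemma periodic_int:
  fixes f :: "real \<Rightarrow> 'a"
  assumes "\<And>t. f (t + \<tau>) = f t"
  shows "f (t + of_int k * \<tau>) = f t"
proof (induction k arbitrary: t rule: int_induct[where k = 0])
  case (step1 i)
  then show ?case using assms[of "t + of_int i * \<tau>"] by (simp add: algebra_simps)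
next
  case (step2 i)
  then show ?case using assms[of "t + of_int i * \<tau> - \<tau>"] by (simp add: algebra_simps)
qed simp

lemma periodic_reduce:
  fixes \<tau> :: real
  assumes "0 < \<tau>"
  obtains k :: int where "t + of_int k * \<tau> \<in> {0..\<tau>}"
proof -
  have "of_int \<lfloor>t / \<tau>\<rfloor> \<le> t / \<tau>" "t / \<tau> \<le> of_int \<lfloor>t / \<tau>\<rfloor> + 1" by linarith+
  then have "of_int \<lfloor>t / \<tau>\<rfloor> * \<tau> \<le> t" "t \<le> (of_int \<lfloor>t / \<tau>\<rfloor> + 1) * \<tau>"
    using assms by (simp_all only: pos_le_divide_eq pos_divide_le_eq)
  then have "t + of_int (- \<lfloor>t / \<tau>\<rfloor>) * \<tau> \<in> {0..\<tau>}"
    by (auto simp: algebra_simps)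
  then show thesis by (rule that)
qed

text \<open>The lift \<open>c\<close> of the initial circle is continued in the direction of
  \<open>s\<close> by adding short displacements. These depend only on \<open>z\<close>, hence are
  \<tau>-periodic, so the translation \<open>h\<close> of \<open>c\<close> is inherited by the whole
  lift.\<close>

lemma cylinder_lift:
  fixes z :: "real \<times> real \<Rightarrow> 'n::finite torus"
  assumes tau: "0 < \<tau>" and z: "continuous_on ({0..1} \<times> UNIV) z"
    and per: "\<And>s t. s \<in> {0..1} \<Longrightarrow> z (s, t + \<tau>) = z (s, t)"
    and c: "continuous_on UNIV c" "\<And>t. torus_cover (c t) = z (0, t)" "\<And>t. c (t + \<tau>) = c t + h"
  obtains Z where "continuous_on ({0..1} \<times> UNIV) Z" "\<And>s t. s \<in> {0..1} \<Longrightarrow> torus_cover (Z (s, t)) = z (s, t)"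
    "\<And>s t. s \<in> {0..1} \<Longrightarrow> Z (s, t + \<tau>) = Z (s, t) + h"
proof -
  have "uniformly_continuous_on ({0..1} \<times> {0..\<tau>}) z"
    by (intro compact_uniformly_continuous compact_Times) (auto intro: continuous_on_subset[OF z])
  then obtain d where d: "d > 0" "\<And>w w'. w \<in> {0..1} \<times> {0..\<tau>} \<Longrightarrow> w' \<in> {0..1} \<times> {0..\<tau>} \<Longrightarrow> dist w' w < d \<Longrightarrow> dist (z w') (z w) < 1/4"
    unfolding uniformly_continuous_on_def by (drule_tac spec[of _ "1/4"]) auto
  obtain N :: nat where N: "N \<noteq> 0" "inverse (real N) < d" using real_arch_inverse[of d] d(1) by auto
  have near: "dist (z (s, t)) (z (s', t)) < 1/4" if "s \<in> {0..1}" "s' \<in> {0..1}" "\<bar>s - s'\<bar> < d" for s s' t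
  proof -
    obtain k :: int where k: "t + of_int k * \<tau> \<in> {0..\<tau>}" using periodic_reduce[OF tau] by blast
    have "z (r, t) = z (r, t + of_int k * \<tau>)" if "r \<in> {0..1}" for r
      using periodic_int[of "\<lambda>t. z (r, t)" \<tau> t k] per[OF that] by simp
    then show ?thesis using that k d(2)[of "(s', t + of_int k * \<tau>)" "(s, t + of_int k * \<tau>)"]
      by (simp add: dist_Pair_Pair dist_real_def)
  qed
  \<comment> \<open>The segment from 0 to \<open>s\<close> is divided into \<open>N\<close> equal
    pieces for every \<open>s\<close>; as the number of summands of \<open>Z\<close> does not vary
    with \<open>s\<close>, continuity is immediate.\<close>
  define y where "y k w = z (real k * fst w / N, snd w)" for k :: nat and w :: "real \<times> real"
  have in01: "real k * s / N \<in> {0..1}" if "s \<in> {0..1}" "k \<le> N" for s and k :: nat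
    using that N mult_mono[of "real k" "real N" s 1] by (auto simp: field_simps)
  define Z where "Z w = c (snd w) + (\<Sum>k<N. torus_difference (y k w) (y (Suc k) w))" for w
  have cy: "continuous_on ({0..1} \<times> UNIV) (y k)" if "k \<le> N" for k
    unfolding y_def by (rule continuous_on_compose2[OF z])
      (use in01 that N in \<open>auto intro!: continuous_intros\<close>)
  have "continuous_on ({0..1} \<times> UNIV) Z"
    unfolding Z_def
  proof (intro continuous_intros continuous_on_torus_difference cy)
    show "continuous_on ({0..1} \<times> UNIV) (\<lambda>w. c (snd w))"
      by (intro continuous_on_compose2[OF c(1)] continuous_intros) auto
    fix k w assume kw: "k \<in> {..<N}" "w \<in> {0..1::real} \<times> (UNIV :: real set)"
    have "\<bar>real k * fst w / N - real (Suc k) * fst w / N\<bar> = fst w / N"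
      using kw N by (auto simp: field_simps abs_if)
    also have "\<dots> \<le> inverse (real N)" using kw N by (auto simp: field_simps)
    also have "\<dots> < d" by (rule N)
    finally show "dist (y k w) (y (Suc k) w) < 1/4"
      unfolding y_def using kw by (intro near in01) auto
  qed auto
  moreover have "torus_cover (Z (s, t)) = z (s, t)" if "s \<in> {0..1}" for s t
  proof -
    have "torus_cover (c t + (\<Sum>k<m. torus_difference (y k (s, t)) (y (Suc k) (s, t)))) = y m (s, t)" for m
    proof (induction m)
      case 0
      then show ?case by (simp add: y_def c)
    next
      case (Suc m)
      then show ?case by (simp add: torus_cover_add_difference flip: add.assoc)
    qed
    from this[of N] show ?thesis using N by (simp add: Z_def y_def)
  qed
  moreover have "Z (s, t + \<tau>) = Z (s, t) + h" if "s \<in> {0..1}" for s t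
  proof -
    have "y k (s, t + \<tau>) = y k (s, t)" if "k \<le> N" for k
      using per in01[OF \<open>s \<in> {0..1}\<close> that] by (simp add: y_def)
    then show ?thesis by (simp add: Z_def c(3))
  qed
  ultimately show thesis by (rule that)
qed

section \<open>Velocities and smoothness of lifts\<close>

lemma lifts_differ_by_constant:
  fixes F G :: "'a::t2_space \<Rightarrow> 'n::finite vect"
  assumes "isCont F x" "isCont G x" "\<forall>\<^sub>F y in nhds x. torus_cover (F y) = torus_cover (G y)"
  shows "\<forall>\<^sub>F y in nhds x. F y = G y + (F x - G x)"
proof -
  have "((\<lambda>y. F y - G y) \<longlongrightarrow> F x - G x) (nhds x)"
    using assms(1,2) unfolding isCont_def tendsto_at_iff_tendsto_nhds by (rule tendsto_diff)
  then have "\<forall>\<^sub>F y in nhds x. dist (F y - G y) (F x - G x) < 1" by (rule tendstoD) simp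
  with assms(3) show ?thesis
  proof eventually_elim
    case (elim y)
    have "torus_cover (F x) = torus_cover (G x)"
      using eventually_nhds_x_imp_x[OF assms(3)] .
    have "torus_cover (F y + (G x - F x)) = torus_cover (G y)"
      unfolding torus_cover_eq_iff
    proof
      fix j
      have "(F y $ j - G y $ j) - (F x $ j - G x $ j) \<in> lattice2"
        by (rule lattice2_diff) (use elim(1) \<open>torus_cover (F x) = torus_cover (G x)\<close> in \<open>auto simp: torus_cover_eq_iff\<close>)
      then show "(F y + (G x - F x)) $ j - G y $ j \<in> lattice2"
        by (simp add: algebra_simps)
    qed
    moreover have "norm (F y + (G x - F x) - G y) < 1"
      using elim(2) by (simp add: dist_norm algebra_simps)
    ultimately have "F y + (G x - F x) = G y" by (rule torus_cover_eq_small)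
    then show ?case by (simp add: algebra_simps)
  qed
qed

text \<open>Any continuous lift may be used to compute the velocity, since near \<open>t\<close> it
  differs from a differentiable one by a constant.\<close>

lemma has_torus_vel_lift:
  assumes "isCont F t" "\<forall>\<^sub>F r in nhds t. torus_cover (F r) = c r"
  shows "has_torus_vel c v t \<longleftrightarrow> (F has_vector_derivative v) (at t)"
proof
  assume "has_torus_vel c v t"
  then obtain C where C: "(C has_vector_derivative v) (at t)" "\<forall>\<^sub>F r in nhds t. c r = torus_cover (C r)"
    unfolding has_torus_vel_def by blast
  have "\<forall>\<^sub>F r in nhds t. torus_cover (F r) = torus_cover (C r)"
    using assms(2) C(2) by eventually_elim simp
  from lifts_differ_by_constant[OF assms(1) _ this] C(1)
  have "\<forall>\<^sub>F r in nhds t. F r = C r + (F t - C t)"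
    using has_vector_derivative_continuous by blast
  then have "\<forall>\<^sub>F r in nhds t. r \<in> UNIV \<longrightarrow> C r + (F t - C t) = F r"
    by eventually_elim simp
  moreover have "((\<lambda>r. C r + (F t - C t)) has_vector_derivative v) (at t)"
    using C(1) by (auto intro!: derivative_eq_intros)
  ultimately show "(F has_vector_derivative v) (at t)"
    using has_vector_derivative_cong_ev[of UNIV "\<lambda>r. C r + (F t - C t)" F t v] by simp
next
  assume "(F has_vector_derivative v) (at t)"
  then show "has_torus_vel c v t"
    unfolding has_torus_vel_def using assms(2) by (intro exI[of _ F]) (auto elim: eventually_mono)
qed

lemma torus_vel_lift:
  assumes "(F has_vector_derivative v) (at t)" "\<forall>\<^sub>F r in nhds t. torus_cover (F r) = c r"
  shows "torus_vel c t = v"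
proof -
  have "has_torus_vel c v t"
    using has_torus_vel_lift[OF has_vector_derivative_continuous[OF assms(1)] assms(2)] assms(1) by blast
  then show ?thesis unfolding torus_vel_def by (blast intro: the_equality has_torus_vel_unique)
qed

lemma phase_vel_eq:
  assumes "has_phase_vel w v t"
  shows "phase_vel w t = v"
  unfolding phase_vel_def
proof (rule the_equality[of "\<lambda>v. has_phase_vel w v t", OF assms])
  fix v' assume "has_phase_vel w v' t"
  then show "v' = v"
    using assms has_torus_vel_unique vector_derivative_unique_at
    unfolding has_phase_vel_def by (metis prod_eqI)
qed

text \<open>The smooth local lifts supplied by \<open>smooth_torus_on\<close> differ from
  \<open>F\<close> by local constants, and smoothness is a local property.\<close>

lemma smooth_lift:
  assumes "open S" "smooth_torus_on S f" "continuous_on S F" "\<And>w. w \<in> S \<Longrightarrow> torus_cover (F w) = f w"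
  shows "smooth_on S F"
  unfolding smooth_on_def
proof (intro allI Ck_on_local)
  fix k x assume x: "x \<in> S"
  obtain U G where U: "open U" "x \<in> U" "smooth_on U G" "\<And>y. y \<in> U \<Longrightarrow> f y = torus_cover (G y)"
    using assms(2)[unfolded smooth_torus_on_def, rule_format, OF x] by auto
  have "isCont F x" using assms(1,3) x by (simp add: continuous_on_eq_continuous_at)
  moreover have "isCont G x"
    using smooth_on_continuous[OF U(3)] U(1,2) by (simp add: continuous_on_eq_continuous_at)
  moreover have "\<forall>\<^sub>F y in nhds x. torus_cover (F y) = torus_cover (G y)"
    using eventually_nhds_in_open[OF assms(1) x] eventually_nhds_in_open[OF U(1,2)]
    by eventually_elim (simp add: assms(4) U(4)[symmetric])
  ultimately have "\<forall>\<^sub>F y in nhds x. F y = G y + (F x - G x)" by (rule lifts_differ_by_constant)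
  then obtain W where W: "open W" "x \<in> W" "\<And>y. y \<in> W \<Longrightarrow> F y = G y + (F x - G x)"
    unfolding eventually_nhds by blast
  have "Ck_on (U \<inter> W) k (\<lambda>y. G y + (F x - G x))"
    by (rule Ck_on_add_const[OF open_Int[OF U(1) W(1)] Ck_on_subset[OF U(3)[unfolded smooth_on_def, rule_format]]]) simp
  then have "Ck_on (U \<inter> W) k F"
    using Ck_on_cong[of "U \<inter> W" F "\<lambda>y. G y + (F x - G x)" k] U(1) W(1,3) by auto
  then show "\<exists>U. open U \<and> x \<in> U \<and> Ck_on U k F"
    using U(1,2) W(1,2) by blast
qed

section \<open>Compactness of the torus\<close>

lemma torus_cover_bounded_lift: "\<exists>y\<in>cball 0 (2 * real CARD('n)). torus_cover y = torus_cover (x :: 'n::finite vect)"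
proof -
  define y :: "'n vect" where "y = (\<chi> j i. frac (x $ j $ i))"
  have "torus_cover y = torus_cover x"
    unfolding torus_cover_eq_iff lattice2_def by (auto simp: y_def frac_def)
  moreover have "norm y \<le> 2 * real CARD('n)"
  proof -
    have "norm (y $ j) \<le> 2" for j
    proof -
      have "norm (y $ j) \<le> (\<Sum>i\<in>UNIV. \<bar>y $ j $ i\<bar>)" by (rule norm_le_l1_cart)
      also have "\<dots> \<le> (\<Sum>i\<in>(UNIV :: 2 set). 1)"
        by (intro sum_mono) (simp add: y_def frac_ge_0 less_imp_le[OF frac_lt_1])
      finally show ?thesis by simp
    qed
    then have "(\<Sum>j\<in>UNIV. norm (y $ j)) \<le> (\<Sum>j\<in>(UNIV :: 'n set). 2)"
      by (intro sum_mono) simp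
    moreover have "norm y \<le> (\<Sum>j\<in>UNIV. norm (y $ j))"
      unfolding norm_vec_def[of y] by (rule L2_set_le_sum) simp
    ultimately show ?thesis by simp
  qed
  ultimately show ?thesis by (intro bexI[of _ y]) auto
qed

lemma compact_torus: "compact (UNIV :: 'n::finite torus set)"
proof -
  have "a \<in> torus_cover ` cball 0 (2 * real CARD('n))" for a :: "'n torus"
    using surj_torus_cover[of a] torus_cover_bounded_lift by (metis imageI)
  then have "(UNIV :: 'n torus set) = torus_cover ` cball 0 (2 * real CARD('n))" by blast
  then show ?thesis
    using compact_continuous_image[OF continuous_on_torus_cover compact_cball] by metis
qed

lemma periodic_bounded:
  fixes f :: "real \<times> 'n::finite vect \<Rightarrow> 'b::real_normed_vector"
  assumes "0 < \<tau>" "continuous_on UNIV f" "\<And>t x. f (t + \<tau>, x) = f (t, x)"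
    "\<And>t x y. torus_cover x = torus_cover y \<Longrightarrow> f (t, x) = f (t, y)"
  obtains C where "0 < C" "\<And>t x. norm (f (t, x)) \<le> C"
proof -
  have "compact (f ` ({0..\<tau>} \<times> cball 0 (2 * real CARD('n))))"
    by (intro compact_continuous_image compact_Times continuous_on_subset[OF assms(2)]) auto
  then obtain C where C: "0 < C" "\<And>w. w \<in> {0..\<tau>} \<times> cball 0 (2 * real CARD('n)) \<Longrightarrow> norm (f w) \<le> C"
    using compact_imp_bounded bounded_pos by (metis imageI)
  have "norm (f (t, x)) \<le> C" for t x
  proof -
    obtain k :: int where k: "t + of_int k * \<tau> \<in> {0..\<tau>}" using periodic_reduce[OF assms(1)] by blast
    obtain y where y: "y \<in> cball 0 (2 * real CARD('n))" "torus_cover y = torus_cover x"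
      using torus_cover_bounded_lift[of x] by blast
    have "f (t, x) = f (t + of_int k * \<tau>, y)"
      using periodic_int[of "\<lambda>t. f (t, x)" \<tau> t k] assms(3) assms(4)[OF y(2)] by metis
    then show ?thesis using C(2)[of "(t + of_int k * \<tau>, y)"] k y by simp
  qed
  then show thesis using C(1) that by blast
qed

section \<open>The Hamiltonian vector field and the Floer equation\<close>

text \<open>Multiplication by the imaginary unit on the plane; \<open>area_form v w\<close> is the
  inner product of \<open>rot v\<close> with \<open>w\<close>.\<close>

definition rot :: "real^2 \<Rightarrow> real^2" where
  "rot v = vector [- (v $ 2), v $ 1]"

definition magnetic_map :: "('n::finite \<Rightarrow> torus2 \<Rightarrow> real) \<Rightarrow> 'n torus \<Rightarrow> 'n vect \<Rightarrow> 'n vect" where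
  "magnetic_map a y v = (\<chi> j. a j (y $ j) *\<^sub>R rot (v $ j))"

lemma magnetic_form_map: "magnetic_form a y v w = magnetic_map a y v \<bullet> w"
  by (auto simp: magnetic_form_def area_form_def magnetic_map_def rot_def inner_vec_def sum_2 algebra_simps intro!: sum.cong)

lemma norm_rot: "norm (rot v) = norm v"
  by (simp add: norm_vec_def L2_set_def sum_2 rot_def add.commute)

definition grad_V :: "(real \<Rightarrow> 'n::finite torus \<Rightarrow> real) \<Rightarrow> real \<Rightarrow> 'n vect \<Rightarrow> 'n vect" where
  "grad_V V t x = (\<Sum>b\<in>Basis. frechet_derivative (\<lambda>(t, x). V t (torus_cover x)) (at (t, x)) (0, b) *\<^sub>R b)"

lemma V_has_derivative:
  assumes "smooth_potential \<tau> V"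
  shows "((\<lambda>x. V t (torus_cover x)) has_derivative (\<lambda>h. grad_V V t x \<bullet> h)) (at x)"
proof -
  let ?W = "\<lambda>(t, x). V t (torus_cover x)"
  let ?D = "frechet_derivative ?W (at (t, x))"
  have W: "smooth_on UNIV ?W" using assms by (simp add: smooth_potential_def)
  have D: "(?W has_derivative ?D) (at (t, x))"
    by (rule smooth_on_has_derivative[OF W]) simp
  have "((\<lambda>x. (t, x)) has_derivative (\<lambda>h. (0, h))) (at x)"
    by (auto intro!: derivative_eq_intros)
  from has_derivative_compose[OF this D]
  have 1: "((\<lambda>x. V t (torus_cover x)) has_derivative (\<lambda>h. ?D (0, h))) (at x)"
    by simp
  then interpret linear "\<lambda>h. ?D (0, h)" by (rule has_derivative_linear)
  have "?D (0, h) = grad_V V t x \<bullet> h" for h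
  proof -
    have "?D (0, h) = ?D (0, \<Sum>b\<in>Basis. (h \<bullet> b) *\<^sub>R b)" by (simp add: euclidean_representation)
    also have "\<dots> = (\<Sum>b\<in>Basis. (h \<bullet> b) *\<^sub>R ?D (0, b))" unfolding sum scale ..
    also have "\<dots> = grad_V V t x \<bullet> h"
      by (simp add: grad_V_def inner_sum_left inner_commute[of h] mult.commute)
    finally show ?thesis .
  qed
  then show ?thesis using 1 by simp
qed

lemma continuous_on_grad_V:
  assumes "smooth_potential \<tau> V"
  shows "continuous_on UNIV (\<lambda>(t, x). grad_V V t x)"
proof -
  have "smooth_on UNIV (\<lambda>(t, x). V t (torus_cover x))" using assms by (simp add: smooth_potential_def)
  then have "continuous_on UNIV (\<lambda>w. frechet_derivative (\<lambda>(t, x). V t (torus_cover x)) (at w) (0, b))" for b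
    by (intro smooth_on_continuous smooth_on_frechet)
  then show ?thesis
    unfolding grad_V_def case_prod_beta' prod.collapse by (intro continuous_intros)
qed

lemma grad_V_cover:
  assumes "smooth_potential \<tau> V" "torus_cover x = torus_cover y"
  shows "grad_V V t x = grad_V V t y"
proof -
  have eq: "torus_cover (w + (y - x)) = torus_cover w" for w
    using torus_cover_add[OF assms(2), of "w - x"] by (simp add: algebra_simps)
  have "((\<lambda>w. w + (y - x)) has_derivative (\<lambda>h. h)) (at x)"
    by (auto intro!: derivative_eq_intros)
  moreover have "((\<lambda>x. V t (torus_cover x)) has_derivative (\<lambda>h. grad_V V t y \<bullet> h)) (at (x + (y - x)))"
    using V_has_derivative[OF assms(1), of t y] by simp
  ultimately have "((\<lambda>w. V t (torus_cover (w + (y - x)))) has_derivative (\<lambda>h. grad_V V t y \<bullet> h)) (at x)"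
    by (rule has_derivative_compose)
  then have "(\<lambda>h. grad_V V t y \<bullet> h) = (\<lambda>h. grad_V V t x \<bullet> h)"
    unfolding eq using has_derivative_unique V_has_derivative[OF assms(1)] by blast
  then show ?thesis by (metis vector_eq_rdot)
qed

lemma grad_V_bounded:
  assumes "0 < \<tau>" "smooth_potential \<tau> V"
  obtains C where "0 < C" "\<And>t x. norm (grad_V V t x) \<le> C"
proof (rule periodic_bounded[OF assms(1) continuous_on_grad_V[OF assms(2)]])
  have per: "V (t + \<tau>) = V t" for t using assms(2) by (simp add: smooth_potential_def)
  show "(case (t + \<tau>, x) of (t, x) \<Rightarrow> grad_V V t x) = (case (t, x) of (t, x) \<Rightarrow> grad_V V t x)" for t x
  proof -
    have "(\<lambda>h. grad_V V (t + \<tau>) x \<bullet> h) = (\<lambda>h. grad_V V t x \<bullet> h)"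
      using has_derivative_unique V_has_derivative[OF assms(2), of "t + \<tau>" x]
        V_has_derivative[OF assms(2), of t x] unfolding per by blast
    then show ?thesis by (simp add: fun_eq_iff) (metis vector_eq_rdot)
  qed
  show "(case (t, x) of (t, x) \<Rightarrow> grad_V V t x) = (case (t, y) of (t, x) \<Rightarrow> grad_V V t x)"
    if "torus_cover x = torus_cover y" for t x y
    using grad_V_cover[OF assms(2) that] by simp
qed (use that in auto)

lemma coeffs_bounded:
  fixes a :: "'n::finite \<Rightarrow> torus2 \<Rightarrow> real"
  assumes "smooth_coeffs a"
  obtains C where "0 < C" "\<And>j y. \<bar>a j y\<bar> \<le> C"
proof -
  have "\<exists>C. \<forall>y. \<bar>a j y\<bar> \<le> C" for j
  proof -
    have "continuous_on UNIV (a j \<circ> q2)"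
      using assms by (intro smooth_on_continuous) (simp add: smooth_coeffs_def)
    define f where "f w = (a j \<circ> q2) (snd w $ j)" for w :: "real \<times> 'n vect"
    have cf: "continuous_on UNIV f"
      unfolding f_def
      by (rule continuous_on_compose2[OF \<open>continuous_on UNIV (a j \<circ> q2)\<close>, of UNIV "\<lambda>w. snd w $ j"])
        (intro continuous_intros, simp)
    have f_cover: "f (t, x) = f (t, y)" if "torus_cover x = torus_cover y" for t x y
      using that by (auto simp: torus_cover_def vec_eq_iff f_def)
    have f_per: "f (t + 1, x) = f (t, x)" for t x by (simp add: f_def)
    obtain C where C: "\<And>t x. norm (f (t, x)) \<le> C"
      using periodic_bounded[OF zero_less_one cf f_per f_cover] by metis
    have "\<bar>a j y\<bar> \<le> C" for y
    proof -
      obtain v where "y = q2 v" using surjD[OF surj_q2] by blast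
      then show ?thesis using C[of 0 "\<chi> j. v"] by (simp add: f_def)
    qed
    then show ?thesis by blast
  qed
  then obtain C where C: "\<And>j y. \<bar>a j y\<bar> \<le> C j" by metis
  have "C j \<le> (\<Sum>j\<in>UNIV. \<bar>C j\<bar>) + 1" for j
    using member_le_sum[of j UNIV "\<lambda>j. \<bar>C j\<bar>"] by simp
  then show thesis
    using C by (intro that[of "(\<Sum>j\<in>UNIV. \<bar>C j\<bar>) + 1"]) (auto intro: order_trans add_nonneg_pos sum_nonneg)
qed

lemma norm_magnetic_map_le:
  assumes "\<And>j y. \<bar>a j y\<bar> \<le> C"
  shows "norm (magnetic_map a y v) \<le> C * norm v"
proof -
  have C: "0 \<le> C" using assms[of undefined undefined] by linarith
  have "norm (magnetic_map a y v) \<le> L2_set (\<lambda>j. C * norm (v $ j)) UNIV"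
    unfolding norm_vec_def[of "magnetic_map a y v"]
    by (intro L2_set_mono) (auto simp: magnetic_map_def norm_rot intro!: mult_right_mono assms)
  also have "\<dots> = C * norm v"
    unfolding norm_vec_def[of v] using L2_set_right_distrib[OF C] by metis
  finally show ?thesis .
qed

lemma ham_field_lift:
  assumes "smooth_potential \<tau> V"
  shows "ham_field a V t (torus_cover x, p) = (p, - grad_V V t x - magnetic_map a (torus_cover x) p)"
proof -
  define y where "y = (torus_cover x, p)"
  \<comment> \<open>\<open>phase_diff\<close> is evaluated at the lift chosen by \<open>inv\<close>,
    which may differ from \<open>(x, p)\<close> by a lattice vector; the invariance of
    \<open>grad_V\<close> under such vectors removes the difference.\<close>
  define b where "b = inv phase_cover y"
  have "phase_cover (x, p) = y" by (simp add: phase_cover_def y_def)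
  then have "phase_cover b = y" unfolding b_def by (metis surj_f_inv_f f_inv_into_f rangeI)
  then have b: "torus_cover (fst b) = torus_cover x" "snd b = p"
    by (auto simp: phase_cover_def y_def)
  have A: "((\<lambda>v. (norm (snd v))\<^sup>2 / 2 + V t (torus_cover (fst v))) has_derivative
      (\<lambda>h. snd b \<bullet> snd h + grad_V V t (fst b) \<bullet> fst h)) (at b)"
    unfolding power2_norm_eq_inner
    by (rule has_derivative_eq_rhs, rule has_derivative_add[OF _
          has_derivative_compose[OF has_derivative_fst[OF has_derivative_ident] V_has_derivative[OF assms]]])
      (auto intro!: derivative_eq_intros simp: inner_commute)
  have B: "hamiltonian V t \<circ> phase_cover = (\<lambda>v. (norm (snd v))\<^sup>2 / 2 + V t (torus_cover (fst v)))"
    by (auto simp: hamiltonian_def phase_cover_def)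
  have pd: "phase_diff (hamiltonian V t) y = (\<lambda>h. p \<bullet> snd h + grad_V V t x \<bullet> fst h)"
    unfolding phase_diff_def b_def[symmetric] B frechet_derivative_at[OF A, symmetric]
      b(2) grad_V_cover[OF assms b(1)] ..
  have lin: "linear (\<lambda>h. p \<bullet> snd h + grad_V V t x \<bullet> fst h)" for p
    by (intro linearI) (auto simp: inner_add_right algebra_simps)
  show ?thesis
    unfolding ham_field_def y_def[symmetric] pd
  proof (rule the1_equality[OF omega_nondegenerate[OF lin]])
    show "\<forall>\<eta>. omega a y (p, - grad_V V t x - magnetic_map a (torus_cover x) p) \<eta>
        = - (p \<bullet> snd \<eta> + grad_V V t x \<bullet> fst \<eta>)"
      by (simp add: omega_def dlambda_def magnetic_form_map y_def inner_diff_left)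
  qed
qed

section \<open>Uniform bounds for the almost complex structures and the Floer equation on
  lifts\<close>

lemma dlambda_bound: "\<bar>dlambda \<xi> \<eta>\<bar> \<le> norm \<xi> * norm \<eta>"
proof -
  have "dlambda \<xi> \<eta> = (snd \<xi>, - fst \<xi>) \<bullet> \<eta>"
    by (simp add: dlambda_def inner_prod_def)
  also have "\<bar>\<dots>\<bar> \<le> norm (snd \<xi>, - fst \<xi>) * norm \<eta>" by (rule Cauchy_Schwarz_ineq2)
  also have "norm (snd \<xi>, - fst \<xi>) = norm \<xi>" by (simp add: norm_prod_def add.commute)
  finally show ?thesis .
qed

lemma J_ref_apply:
  fixes \<xi> :: "'n::finite tangent"
  shows "blinfun_apply (J_ref A) \<xi> = (- (1 / A) *\<^sub>R snd \<xi>, A *\<^sub>R fst \<xi>)"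
proof -
  have "bounded_linear (\<lambda>(\<xi>h, \<xi>v). (- (1 / A) *\<^sub>R \<xi>v, A *\<^sub>R \<xi>h) :: 'n tangent)"
    by (rule linear_conv_bounded_linear[THEN iffD1], rule linearI) (auto simp: algebra_simps)
  then show ?thesis
    unfolding J_ref_def by (simp add: bounded_linear_Blinfun_apply case_prod_beta)
qed

text \<open>For \<open>J_ref A\<close> the value of \<open>dlambda\<close> on (J \<xi>, \<xi>) is A
  |\<xi>h|^2 + |\<xi>v|^2 / A, hence at least 2 e |\<xi>|^2, and a perturbation of norm at most
  \<open>e\<close> costs at most half of this. Strict positivity at each point alone would not be
  uniform over the noncompact fibres.\<close>

lemma acs_nbhd_properties:
  fixes J :: "'n::finite phase \<Rightarrow> 'n tangent \<Rightarrow>\<^sub>L 'n tangent"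
  assumes A: "0 < A" and e: "e = min A (1 / A) / 2" and J: "J \<in> acs_nbhd a A e"
  shows "blinfun_apply (J y) (blinfun_apply (J y) \<xi>) = - \<xi>"
    and "e * (norm \<xi>)\<^sup>2 \<le> dlambda (blinfun_apply (J y) \<xi>) \<xi>"
    and "norm (blinfun_apply (J y) \<xi>) \<le> (norm (J_ref A :: 'n tangent \<Rightarrow>\<^sub>L 'n tangent) + e) * norm \<xi>"
    and "e / 4 * (norm \<xi>)\<^sup>2 \<le> omega a y (blinfun_apply (J y) \<xi>) \<xi>"
proof -
  show "blinfun_apply (J y) (blinfun_apply (J y) \<xi>) = - \<xi>"
    using J[unfolded acs_nbhd_def mem_Collect_eq] by blast
  have "norm (J y - J_ref A) \<le> (SUP y. norm (J y - J_ref A))"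
    by (rule cSUP_upper[OF UNIV_I]) (use J[unfolded acs_nbhd_def mem_Collect_eq] in \<open>elim conjE\<close>)
  also have "\<dots> < e" using J[unfolded acs_nbhd_def mem_Collect_eq] by (elim conjE)
  finally have J': "norm (J y - J_ref A) \<le> e" by simp
  have "norm (J y) \<le> norm (J_ref A :: 'n tangent \<Rightarrow>\<^sub>L 'n tangent) + e"
    using J' norm_triangle_sub[of "J y" "J_ref A"] by linarith
  then show "norm (blinfun_apply (J y) \<xi>) \<le> (norm (J_ref A :: 'n tangent \<Rightarrow>\<^sub>L 'n tangent) + e) * norm \<xi>"
    by (rule order_trans[OF norm_blinfun mult_right_mono[OF _ norm_ge_zero]])
  show 1: "e * (norm \<xi>)\<^sup>2 \<le> dlambda (blinfun_apply (J y) \<xi>) \<xi>"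
  proof -
    have "2 * e * (norm \<xi>)\<^sup>2 = min A (1/A) * (norm (fst \<xi>))\<^sup>2 + min A (1/A) * (norm (snd \<xi>))\<^sup>2"
      by (simp add: e norm_prod_def algebra_simps)
    also have "\<dots> \<le> A * (norm (fst \<xi>))\<^sup>2 + (1/A) * (norm (snd \<xi>))\<^sup>2"
      by (intro add_mono mult_right_mono) auto
    also have "\<dots> = dlambda (blinfun_apply (J_ref A) \<xi>) \<xi>"
      by (simp add: J_ref_apply dlambda_def power2_norm_eq_inner)
    also have "\<dots> = dlambda (blinfun_apply (J y) \<xi>) \<xi> - dlambda (blinfun_apply (J y - J_ref A) \<xi>) \<xi>"
      by (simp add: dlambda_def blinfun.diff_left inner_diff_left)
    also have "\<dots> \<le> dlambda (blinfun_apply (J y) \<xi>) \<xi> + norm (blinfun_apply (J y - J_ref A) \<xi>) * norm \<xi>"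
      using dlambda_bound[of "blinfun_apply (J y - J_ref A) \<xi>" \<xi>] by linarith
    also have "norm (blinfun_apply (J y - J_ref A) \<xi>) * norm \<xi> \<le> (e * norm \<xi>) * norm \<xi>"
      by (intro mult_right_mono order_trans[OF norm_blinfun mult_right_mono[OF J' norm_ge_zero]] norm_ge_zero)
    finally show ?thesis by (simp add: power2_eq_square algebra_simps)
  qed
  show "e / 4 * (norm \<xi>)\<^sup>2 \<le> omega a y (blinfun_apply (J y) \<xi>) \<xi>"
  proof (cases "\<xi> = 0")
    case True
    then show ?thesis by (simp add: omega_def dlambda_def magnetic_form_map blinfun.zero_right)
  next
    case False
    then have "1 / 4 * dlambda (blinfun_apply (J y) \<xi>) \<xi> < omega a y (blinfun_apply (J y) \<xi>) \<xi>"
      using J[unfolded acs_nbhd_def mem_Collect_eq] by blast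
    then show ?thesis using 1 by simp
  qed
qed

text \<open>The first bound serves the integral estimates. For the second, - dlambda(us, ut) equals
  dlambda(J us, us) - dlambda(us, X), which dominates e |us|^2 up to a mixed term absorbed by
  Young's inequality; it is the exact form to which the isoperimetric argument applies.\<close>

lemma J_gradient_bounds:
  fixes us ut X :: "'n::finite tangent" and J :: "'n tangent \<Rightarrow>\<^sub>L 'n tangent"
  assumes e: "0 < e" and pos: "e * (norm us)\<^sup>2 \<le> dlambda (blinfun_apply J us) us"
    and L: "norm (blinfun_apply J us) \<le> L * norm us" and ut: "ut = X + blinfun_apply J us"
  shows "(norm us)\<^sup>2 + (norm ut)\<^sup>2 \<le> (1 + 2 * L\<^sup>2) * (norm us)\<^sup>2 + 2 * (norm X)\<^sup>2"
    and "(norm us)\<^sup>2 + (norm ut)\<^sup>2 \<le> (1 + 2 * L\<^sup>2 + e) * (2 / e) * (fst us \<bullet> snd ut - snd us \<bullet> fst ut)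
       + ((1 + 2 * L\<^sup>2 + e) / e\<^sup>2 + 2) * (norm X)\<^sup>2"
proof -
  have "(norm ut)\<^sup>2 \<le> (norm X + L * norm us)\<^sup>2"
    unfolding ut by (intro power_mono norm_triangle_le add_mono L order_refl) auto
  also have "\<dots> \<le> (norm X + L * norm us)\<^sup>2 + (norm X - L * norm us)\<^sup>2" by simp
  also have "\<dots> = 2 * (norm X)\<^sup>2 + 2 * L\<^sup>2 * (norm us)\<^sup>2"
    by (simp add: power2_eq_square algebra_simps)
  finally show 1: "(norm us)\<^sup>2 + (norm ut)\<^sup>2 \<le> (1 + 2 * L\<^sup>2) * (norm us)\<^sup>2 + 2 * (norm X)\<^sup>2"
    by (simp add: algebra_simps)
  define q where "q = fst us \<bullet> snd ut - snd us \<bullet> fst ut"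
  have "q = dlambda (blinfun_apply J us) us - dlambda us X"
    by (simp add: q_def ut dlambda_def inner_add_right inner_commute)
  then have "e * (norm us)\<^sup>2 \<le> q + norm us * norm X"
    using pos dlambda_bound[of us X] by linarith
  moreover have "norm us * norm X \<le> e / 2 * (norm us)\<^sup>2 + (norm X)\<^sup>2 / (2 * e)"
  proof -
    have "0 \<le> (e * norm us - norm X)\<^sup>2 / (2 * e)" using e by simp
    also have "\<dots> = e / 2 * (norm us)\<^sup>2 + (norm X)\<^sup>2 / (2 * e) - norm us * norm X"
      using e by (simp add: power2_eq_square field_simps)
    finally show ?thesis by simp
  qed
  ultimately have "e / 2 * (norm us)\<^sup>2 \<le> q + (norm X)\<^sup>2 / (2 * e)" by linarith
  then have "(2 / e) * (e / 2 * (norm us)\<^sup>2) \<le> (2 / e) * (q + (norm X)\<^sup>2 / (2 * e))"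
    using e by (intro mult_left_mono) auto
  then have us: "(norm us)\<^sup>2 \<le> (2 / e) * q + (norm X)\<^sup>2 / e\<^sup>2"
    using e by (simp add: power2_eq_square field_simps)
  \<comment> \<open>The summand \<open>e\<close> makes the coefficient \<open>K * (2 / e)\<close> at
    least 1, as \<open>interior_estimate\<close> requires of its constant \<open>M\<close>.\<close>
  define K where "K = 1 + 2 * L\<^sup>2 + e"
  have "(1 + 2 * L\<^sup>2) * (norm us)\<^sup>2 \<le> K * (norm us)\<^sup>2"
    using e by (intro mult_right_mono) (auto simp: K_def)
  also have "\<dots> \<le> K * ((2 / e) * q + (norm X)\<^sup>2 / e\<^sup>2)"
    using e by (intro mult_left_mono us) (auto simp: K_def)
  finally have "(norm us)\<^sup>2 + (norm ut)\<^sup>2 \<le> K * ((2 / e) * q + (norm X)\<^sup>2 / e\<^sup>2) + 2 * (norm X)\<^sup>2"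
    using 1 by linarith
  also have "\<dots> = K * (2 / e) * q + (K / e\<^sup>2 + 2) * (norm X)\<^sup>2"
    by (simp add: algebra_simps)
  finally show "(norm us)\<^sup>2 + (norm ut)\<^sup>2 \<le> (1 + 2 * L\<^sup>2 + e) * (2 / e) * (fst us \<bullet> snd ut - snd us \<bullet> fst ut)
       + ((1 + 2 * L\<^sup>2 + e) / e\<^sup>2 + 2) * (norm X)\<^sup>2"
    unfolding K_def q_def .
qed

text \<open>Applying \<open>J\<close> to the Floer equation and using J^2 = -1 solves it for the
  derivative in \<open>t\<close>.\<close>

lemma floer_eq_lift:
  fixes u :: "real \<times> real \<Rightarrow> 'n::finite phase"
  assumes V: "smooth_potential \<tau> V" and J2: "\<And>y \<xi>. blinfun_apply (J t y) (blinfun_apply (J t y) \<xi>) = - \<xi>"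
    and u: "\<And>w. u w = (torus_cover (x w), p w)" and x: "smooth_on UNIV x" and p: "smooth_on UNIV p"
    and fl: "floer_eq a V J u"
  shows "(D2 x (s, t), D2 p (s, t)) =
     (p (s, t), - grad_V V t (x (s, t)) - magnetic_map a (torus_cover (x (s, t))) (p (s, t)))
     + blinfun_apply (J t (u (s, t))) (D1 x (s, t), D1 p (s, t))"
proof -
  have 1: "phase_vel (\<lambda>s'. u (s', t)) s = (D1 x (s, t), D1 p (s, t))"
  proof (rule phase_vel_eq)
    have "((\<lambda>s. x (s, t)) has_vector_derivative D1 x (s, t)) (at s)"
      "((\<lambda>s. p (s, t)) has_vector_derivative D1 p (s, t)) (at s)"
      using D1_has_vector_derivative x p UNIV_I by blast+
    then show "has_phase_vel (\<lambda>s'. u (s', t)) (D1 x (s, t), D1 p (s, t)) s"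
      unfolding has_phase_vel_def o_def u by (auto simp: has_torus_vel_def)
  qed
  have 2: "phase_vel (\<lambda>t'. u (s, t')) t = (D2 x (s, t), D2 p (s, t))"
  proof (rule phase_vel_eq)
    have "((\<lambda>t. x (s, t)) has_vector_derivative D2 x (s, t)) (at t)"
      "((\<lambda>t. p (s, t)) has_vector_derivative D2 p (s, t)) (at t)"
      using D2_has_vector_derivative x p UNIV_I by blast+
    then show "has_phase_vel (\<lambda>t'. u (s, t')) (D2 x (s, t), D2 p (s, t)) t"
      unfolding has_phase_vel_def o_def u by (auto simp: has_torus_vel_def)
  qed
  define us where "us = (D1 x (s, t), D1 p (s, t))"
  define R where "R = (D2 x (s, t), D2 p (s, t)) - ham_field a V t (u (s, t))"
  have "us + blinfun_apply (J t (u (s, t))) R = 0"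
    using fl unfolding floer_eq_def us_def R_def 1[symmetric] 2[symmetric] by blast
  then have "us = - blinfun_apply (J t (u (s, t))) R"
    unfolding eq_neg_iff_add_eq_0 .
  then have "blinfun_apply (J t (u (s, t))) us = blinfun_apply (J t (u (s, t))) (- blinfun_apply (J t (u (s, t))) R)"
    by (rule arg_cong)
  then have "blinfun_apply (J t (u (s, t))) us = R"
    by (simp add: blinfun.minus_right J2)
  then show ?thesis
    unfolding us_def R_def u ham_field_lift[OF V] by (simp add: algebra_simps)
qed

section \<open>Non-resonance\<close>

text \<open>The extrema of each \<open>a j\<close> are attained on a compact set of representatives,
  so the strict inequalities leave room, and there are finitely many \<open>j\<close>. The bound
  \<open>\<delta> \<le> 1\<close> keeps \<delta> below pi, where the cosine is decreasing.\<close>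

lemma non_resonant_margin:
  fixes a :: "'n::finite \<Rightarrow> torus2 \<Rightarrow> real"
  assumes "0 < \<tau>" "smooth_coeffs a" "non_resonant a \<tau>"
  obtains \<delta> where "0 < \<delta>" "\<delta> \<le> 1"
    "\<And>j. \<exists>k::int. \<forall>y. 2 * pi * of_int k + \<delta> \<le> \<tau> * a j y \<and> \<tau> * a j y \<le> 2 * pi * (of_int k + 1) - \<delta>"
proof -
  have "\<exists>d>0. \<exists>k::int. \<forall>y. 2 * pi * of_int k + d \<le> \<tau> * a j y \<and> \<tau> * a j y \<le> 2 * pi * (of_int k + 1) - d" for j
  proof -
    obtain k :: int where k: "\<And>y. 2 * pi * of_int k / \<tau> < a j y" "\<And>y. a j y < 2 * pi * (of_int k + 1) / \<tau>"
      using assms(3) unfolding non_resonant_def by blast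
    define f where "f x = (a j \<circ> q2) (x $ j)" for x :: "'n vect"
    define B where "B = cball (0 :: 'n vect) (2 * real CARD('n))"
    have ca: "continuous_on UNIV (a j \<circ> q2)"
      using assms(2) by (intro smooth_on_continuous) (simp add: smooth_coeffs_def)
    have "continuous_on B f"
      unfolding f_def by (rule continuous_on_compose2[OF ca]) (intro continuous_intros, simp)
    moreover have "compact B" "B \<noteq> {}" by (auto simp: B_def)
    ultimately obtain m M where m: "\<And>x. x \<in> B \<Longrightarrow> f m \<le> f x" and M: "\<And>x. x \<in> B \<Longrightarrow> f x \<le> f M"
      using continuous_attains_inf[of B f] continuous_attains_sup[of B f] by metis
    have bd: "f m \<le> a j y \<and> a j y \<le> f M" for y
    proof -
      obtain v where v: "y = q2 v" using surjD[OF surj_q2] by blast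
      obtain x where x: "x \<in> B" "torus_cover x = torus_cover (\<chi> i. v :: 'n vect)"
        using torus_cover_bounded_lift[of "\<chi> i. v"] unfolding B_def by blast
      have "q2 (x $ j) = y"
        using arg_cong[OF x(2), of "\<lambda>w. w $ j"] v by (simp add: torus_cover_def)
      then have "f x = a j y" by (simp add: f_def)
      then show ?thesis using m[OF x(1)] M[OF x(1)] by simp
    qed
    define d where "d = min (\<tau> * f m - 2 * pi * of_int k) (2 * pi * (of_int k + 1) - \<tau> * f M)"
    have "2 * pi * of_int k < f m * \<tau>" "f M * \<tau> < 2 * pi * (of_int k + 1)"
      using k[of "q2 (m $ j)"] k[of "q2 (M $ j)"] assms(1)
      by (simp_all add: f_def pos_divide_less_eq pos_less_divide_eq)
    then have "0 < d" by (simp add: d_def mult.commute)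
    moreover have "2 * pi * of_int k + d \<le> \<tau> * a j y \<and> \<tau> * a j y \<le> 2 * pi * (of_int k + 1) - d" for y
    proof -
      have "\<tau> * f m \<le> \<tau> * a j y" "\<tau> * a j y \<le> \<tau> * f M"
        using bd[of y] assms(1) by (auto intro!: mult_left_mono)
      then show ?thesis unfolding d_def by linarith
    qed
    ultimately show ?thesis by blast
  qed
  then obtain d where d: "\<And>j. 0 < d j"
    "\<And>j. \<exists>k::int. \<forall>y. 2 * pi * of_int k + d j \<le> \<tau> * a j y \<and> \<tau> * a j y \<le> 2 * pi * (of_int k + 1) - d j"
    by metis
  define \<delta> where "\<delta> = Min (insert 1 (range d))"
  have le: "\<delta> \<le> d j" for j unfolding \<delta>_def by (rule Min_le) auto
  show thesis
  proof (rule that)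
    show "0 < \<delta>" "\<delta> \<le> 1" using d(1) by (auto simp: \<delta>_def)
    fix j
    obtain k :: int where k: "\<And>y. 2 * pi * of_int k + d j \<le> \<tau> * a j y \<and> \<tau> * a j y \<le> 2 * pi * (of_int k + 1) - d j"
      using d(2) by blast
    have "2 * pi * of_int k + \<delta> \<le> \<tau> * a j y \<and> \<tau> * a j y \<le> 2 * pi * (of_int k + 1) - \<delta>" for y
      using k[of y] le[of j] by linarith
    then show "\<exists>k::int. \<forall>y. 2 * pi * of_int k + \<delta> \<le> \<tau> * a j y \<and> \<tau> * a j y \<le> 2 * pi * (of_int k + 1) - \<delta>"
      by blast
  qed
qed

text \<open>The squared chord is 2 - 2 cos \<theta>, and \<theta> keeps distance \<delta> from all
  multiples of 2*pi.\<close>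

lemma norm_cis_minus_one_ge:
  assumes "0 < \<delta>" "\<delta> \<le> 1" "2 * pi * of_int k + \<delta> \<le> \<theta>" "\<theta> \<le> 2 * pi * (of_int k + 1) - \<delta>"
  shows "sqrt (2 - 2 * cos \<delta>) \<le> norm (cis \<theta> - 1)"
proof -
  define \<phi> where "\<phi> = \<theta> - 2 * pi * of_int k"
  have phi: "\<delta> \<le> \<phi>" "\<phi> \<le> 2 * pi - \<delta>" using assms(3,4) by (auto simp: \<phi>_def algebra_simps)
  have "cos \<phi> \<le> cos \<delta>"
  proof (cases "\<phi> \<le> pi")
    case True
    then show ?thesis using phi assms(1) by (intro cos_monotone_0_pi_le) auto
  next
    case False
    have "cos (2 * pi - \<phi>) \<le> cos \<delta>" using False phi assms(1) by (intro cos_monotone_0_pi_le) auto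
    then show ?thesis by (simp add: cos_diff)
  qed
  moreover have "cos \<phi> = cos \<theta>"
    unfolding \<phi>_def by (metis cos_int_2pin cos_diff sin_int_2pin diff_zero mult.commute mult.right_neutral mult_zero_right add_0_right)
  moreover have "(norm (cis \<theta> - 1))\<^sup>2 = 2 - 2 * cos \<theta>"
  proof -
    have "(norm (cis \<theta> - 1))\<^sup>2 = ((cos \<theta>)\<^sup>2 + (sin \<theta>)\<^sup>2) - 2 * cos \<theta> + 1"
      unfolding cmod_power2 by (simp add: power2_eq_square algebra_simps)
    then show ?thesis unfolding sin_cos_squared_add2 by simp
  qed
  ultimately show ?thesis by (intro real_le_lsqrt) auto
qed

text \<open>After multiplication by e^(i \<theta>) the homogeneous part disappears, so
  \<open>Q\<close> varies by at most the integral of |f|. As \<open>P\<close> is periodic, the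
  increment of \<open>Q\<close> over one period is (e^(i \<theta>(\<tau>)) - 1) P(0). Non-resonance
  bounds this factor away from 0, which controls P(0) and then every P(t), as |P| = |Q|.\<close>

lemma slice_estimate:
  fixes P f :: "real \<Rightarrow> real^2" and \<alpha> :: "real \<Rightarrow> real"
  assumes tau: "0 < \<tau>" and d: "0 < \<delta>" "\<delta> \<le> 1"
    and P: "\<And>t. (P has_vector_derivative f t - \<alpha> t *\<^sub>R rot (P t)) (at t)" "P \<tau> = P 0"
    and cont: "continuous_on UNIV \<alpha>" "continuous_on UNIV f"
    and al: "\<And>t. 2 * pi * of_int k + \<delta> \<le> \<tau> * \<alpha> t" "\<And>t. \<tau> * \<alpha> t \<le> 2 * pi * (of_int k + 1) - \<delta>"
    and t: "t \<in> {0..\<tau>}"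
  shows "norm (P t) \<le> (1 / sqrt (2 - 2 * cos \<delta>) + 1) * integral {0..\<tau>} (\<lambda>t. norm (f t))"
proof -
  define \<phi> where "\<phi> v = Complex (v $ 1) (v $ 2)" for v :: "real^2"
  have bl: "bounded_linear \<phi>"
    by (rule linear_conv_bounded_linear[THEN iffD1], rule linearI) (auto simp: \<phi>_def complex_eq_iff)
  have norm_phi: "norm (\<phi> v) = norm v" for v
    by (simp add: \<phi>_def cmod_def norm_vec_def L2_set_def sum_2)
  have phi_rot: "\<phi> (rot v) = \<i> * \<phi> v" for v
    by (simp add: \<phi>_def rot_def complex_eq_iff)
  interpret \<phi>: bounded_linear \<phi> by (rule bl)
  define \<theta> where "\<theta> t = integral {0..t} \<alpha>" for t
  \<comment> \<open>integrating factor, after identifying the plane with the complex numbers\<close>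
  define Q where "Q t = cis (\<theta> t) * \<phi> (P t)" for t
  define g where "g t = cis (\<theta> t) * \<phi> (f t)" for t
  define I where "I = integral {0..\<tau>} (\<lambda>t. norm (f t))"
  have c2: "continuous_on S \<alpha>" "continuous_on S f" for S
    using cont continuous_on_subset by blast+
  have dtheta: "(\<theta> has_real_derivative \<alpha> t) (at t within {0..\<tau>})" if "t \<in> {0..\<tau>}" for t
    unfolding \<theta>_def has_real_derivative_iff_has_vector_derivative
    by (rule integral_has_vector_derivative[OF c2(1) that])
  have dQ: "(Q has_vector_derivative g t) (at t within {0..\<tau>})" if t: "t \<in> {0..\<tau>}" for t
  proof -
    have 1: "((\<lambda>t. cis (\<theta> t)) has_vector_derivative \<alpha> t *\<^sub>R (\<i> * cis (\<theta> t))) (at t within {0..\<tau>})"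
    proof -
      have "((\<lambda>t. Complex (cos (\<theta> t)) (sin (\<theta> t))) has_vector_derivative Complex (- sin (\<theta> t) * \<alpha> t) (cos (\<theta> t) * \<alpha> t)) (at t within {0..\<tau>})"
        unfolding has_vector_derivative_complex_iff using dtheta[OF t]
        by (auto intro!: derivative_eq_intros)
      moreover have "Complex (- sin (\<theta> t) * \<alpha> t) (cos (\<theta> t) * \<alpha> t) = \<alpha> t *\<^sub>R (\<i> * cis (\<theta> t))"
        by (simp add: complex_eq_iff)
      ultimately show ?thesis by (simp add: cis.code)
    qed
    have 2: "((\<lambda>t. \<phi> (P t)) has_vector_derivative \<phi> (f t - \<alpha> t *\<^sub>R rot (P t))) (at t within {0..\<tau>})"
      by (rule bounded_linear.has_vector_derivative[OF bl has_vector_derivative_at_within[OF P(1)]])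
    show ?thesis
      unfolding Q_def[abs_def]
      by (rule has_vector_derivative_eq_rhs[OF has_vector_derivative_mult[OF 1 2]])
        (simp add: g_def \<phi>.diff \<phi>.scaleR phi_rot algebra_simps)
  qed
  have cg: "continuous_on {0..t} g" if "t \<in> {0..\<tau>}" for t
  proof -
    have "continuous_on {0..\<tau>} \<theta>"
      using dtheta by (intro continuous_on_eq_continuous_within[THEN iffD2] ballI) (rule DERIV_continuous)
    then have "continuous_on {0..t} \<theta>" by (rule continuous_on_subset) (use that in auto)
    then show ?thesis
      unfolding g_def by (intro continuous_intros \<phi>.continuous_on c2)
  qed
  have osc: "norm (Q t - Q 0) \<le> I" if t: "t \<in> {0..\<tau>}" for t
  proof -
    have "(g has_integral Q t - Q 0) {0..t}"
      by (rule fundamental_theorem_of_calculus)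
        (use t in \<open>auto intro: has_vector_derivative_within_subset[OF dQ]\<close>)
    then have "norm (Q t - Q 0) = norm (integral {0..t} g)" by (simp add: integral_unique)
    also have "\<dots> \<le> integral {0..t} (\<lambda>t. norm (f t))"
      by (intro integral_norm_bound_integral integrable_continuous_real cg[OF t] continuous_intros c2)
        (simp add: g_def norm_mult norm_phi)
    also have "\<dots> \<le> I"
      unfolding I_def using t by (intro integral_subset_le integrable_continuous_real continuous_intros c2) auto
    finally show ?thesis .
  qed
  have Q0: "Q 0 = \<phi> (P 0)" by (simp add: Q_def \<theta>_def)
  have Qt: "Q \<tau> - Q 0 = (cis (\<theta> \<tau>) - 1) * \<phi> (P 0)" unfolding Q0 by (simp add: Q_def P(2) algebra_simps)
  have th: "2 * pi * of_int k + \<delta> \<le> \<theta> \<tau>" "\<theta> \<tau> \<le> 2 * pi * (of_int k + 1) - \<delta>"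
  proof -
    have i: "\<alpha> integrable_on {0..\<tau>}" by (intro integrable_continuous_real c2)
    have "integral {0..\<tau>} (\<lambda>t. (2 * pi * of_int k + \<delta>) / \<tau>) \<le> \<theta> \<tau>"
      unfolding \<theta>_def using al(1) tau
      by (intro integral_le i) (auto simp: pos_divide_le_eq mult.commute)
    then show "2 * pi * of_int k + \<delta> \<le> \<theta> \<tau>" using tau by simp
    have "\<theta> \<tau> \<le> integral {0..\<tau>} (\<lambda>t. (2 * pi * (of_int k + 1) - \<delta>) / \<tau>)"
      unfolding \<theta>_def using al(2) tau
      by (intro integral_le i) (auto simp: pos_le_divide_eq mult.commute)
    then show "\<theta> \<tau> \<le> 2 * pi * (of_int k + 1) - \<delta>" using tau by simp
  qed
  define c where "c = sqrt (2 - 2 * cos \<delta>)"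
  have "cos \<delta> < cos 0" using d pi_gt3 by (intro cos_monotone_0_pi) auto
  then have c: "0 < c" by (simp add: c_def)
  have "c * norm (P 0) \<le> norm (cis (\<theta> \<tau>) - 1) * norm (P 0)"
    unfolding c_def by (intro mult_right_mono norm_cis_minus_one_ge[OF d th]) auto
  also have "\<dots> = norm (Q \<tau> - Q 0)" unfolding Qt by (simp add: norm_mult norm_phi)
  also have "\<dots> \<le> I" using osc tau by simp
  finally have "norm (P 0) \<le> I / c" using c by (simp add: field_simps)
  moreover have "norm (P t) \<le> norm (P 0) + I"
  proof -
    have "norm (P t) = norm (Q t)" by (simp add: Q_def norm_mult norm_phi)
    also have "\<dots> \<le> norm (Q 0) + norm (Q t - Q 0)" by (rule norm_triangle_sub)
    finally show ?thesis using osc[OF t] by (simp add: Q0 norm_phi)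
  qed
  ultimately show ?thesis by (simp add: I_def c_def algebra_simps)
qed

text \<open>The magnetic map acts on each planar factor separately, so \<open>slice_estimate\<close>
  applies to every component with its own integer \<open>k\<close>; the margin \<delta>, and with it
  the constant, is common to all components.\<close>

lemma momentum_slice_bound:
  fixes a :: "'n::finite \<Rightarrow> torus2 \<Rightarrow> real"
  assumes tau: "0 < \<tau>" and a: "smooth_coeffs a" and nr: "non_resonant a \<tau>"
  obtains C where "0 < C"
    "\<And>x p f t. continuous_on UNIV x \<Longrightarrow> continuous_on UNIV f \<Longrightarrow>
      (\<And>t. (p has_vector_derivative f t - magnetic_map a (torus_cover (x t)) (p t)) (at t)) \<Longrightarrow>
      p \<tau> = p 0 \<Longrightarrow> t \<in> {0..\<tau>} \<Longrightarrow> norm (p t) \<le> C * integral {0..\<tau>} (\<lambda>t. norm (f t))"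
proof -
  obtain \<delta> where d: "0 < \<delta>" "\<delta> \<le> 1"
    "\<And>j. \<exists>k::int. \<forall>y. 2 * pi * of_int k + \<delta> \<le> \<tau> * a j y \<and> \<tau> * a j y \<le> 2 * pi * (of_int k + 1) - \<delta>"
    by (rule non_resonant_margin[OF assms]) blast
  define c where "c = 1 / sqrt (2 - 2 * cos \<delta>) + 1"
  have c: "0 < c" unfolding c_def by (intro add_nonneg_pos divide_nonneg_nonneg) auto
  show thesis
  proof (rule that)
    show "0 < real CARD('n) * c" using c by simp
    fix x p f :: "real \<Rightarrow> 'n vect" and t
    assume x: "continuous_on UNIV x" and f: "continuous_on UNIV f"
      and p: "\<And>t. (p has_vector_derivative f t - magnetic_map a (torus_cover (x t)) (p t)) (at t)"
      and per: "p \<tau> = p 0" and t: "t \<in> {0..\<tau>}"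
    define I where "I = integral {0..\<tau>} (\<lambda>t. norm (f t))"
    have cf: "continuous_on S f" for S using f continuous_on_subset by blast
    have "norm (p t $ j) \<le> c * I" for j
    proof -
      obtain k :: int where k: "\<And>y. 2 * pi * of_int k + \<delta> \<le> \<tau> * a j y" "\<And>y. \<tau> * a j y \<le> 2 * pi * (of_int k + 1) - \<delta>"
        using d(3) by blast
      have ca: "continuous_on UNIV (a j \<circ> q2)"
        using a by (intro smooth_on_continuous) (simp add: smooth_coeffs_def)
      have "norm (p t $ j) \<le> c * integral {0..\<tau>} (\<lambda>t. norm (f t $ j))"
        unfolding c_def
      proof (rule slice_estimate[OF tau d(1,2) _ _ _ _ _ _ t, where P = "\<lambda>t. p t $ j" and f = "\<lambda>t. f t $ j"
            and \<alpha> = "\<lambda>t. a j (q2 (x t $ j))" and k = k])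
        fix t
        show "((\<lambda>t. p t $ j) has_vector_derivative f t $ j - a j (q2 (x t $ j)) *\<^sub>R rot (p t $ j)) (at t)"
          using bounded_linear.has_vector_derivative[OF bounded_linear_vec_nth p[of t], of j]
          by (simp add: magnetic_map_def torus_cover_def)
        have "continuous_on UNIV (\<lambda>t. (a j \<circ> q2) (x t $ j))"
          by (rule continuous_on_compose2[OF ca]) (intro continuous_intros x, simp)
        then show "continuous_on UNIV (\<lambda>t. a j (q2 (x t $ j)))" by simp
        show "continuous_on UNIV (\<lambda>t. f t $ j)" by (intro continuous_intros f)
      qed (use per k in auto)
      also have "\<dots> \<le> c * I"
        unfolding I_def using c
        by (intro mult_left_mono integral_le integrable_continuous_real continuous_intros cf Finite_Cartesian_Product.norm_nth_le) auto
      finally show ?thesis .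
    qed
    then have "(\<Sum>j\<in>UNIV. norm (p t $ j)) \<le> (\<Sum>j\<in>(UNIV :: 'n set). c * I)" by (intro sum_mono)
    moreover have "norm (p t) \<le> (\<Sum>j\<in>UNIV. norm (p t $ j))"
      unfolding norm_vec_def[of "p t"] by (rule L2_set_le_sum) simp
    ultimately show "norm (p t) \<le> real CARD('n) * c * integral {0..\<tau>} (\<lambda>t. norm (f t))"
      by (simp add: I_def)
  qed
qed

section \<open>Magnetic area and action\<close>

text \<open>The primitive inherits periodicity in \<open>s\<close> from \<alpha>. In
  \<open>t\<close> the increment over a period has derivative 0, hence equals its value
  \<open>G (s, m)\<close> at \<open>t = 0\<close>.\<close>

lemma magnetic_primitive:
  fixes a :: "torus2 \<Rightarrow> real"
  assumes a: "smooth_on UNIV (a \<circ> q2)"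
  obtains G G1 \<alpha> where "C1 G G1 \<alpha>" "\<And>s t. \<alpha> (s, t) = a (q2 (vector [t, s]))"
    "\<And>s t m n. m \<in> \<int> \<Longrightarrow> n \<in> \<int> \<Longrightarrow> G (s + n, t + m) = G (s, t) + G (s, m)"
proof -
  \<comment> \<open>Coordinates are swapped because \<open>C1_primitive\<close> integrates in the
    second variable.\<close>
  define L :: "real \<times> real \<Rightarrow> real^2" where "L w = snd w *\<^sub>R axis 1 1 + fst w *\<^sub>R axis 2 1" for w :: "real \<times> real"
  have L: "L (s, t) = vector [t, s]" for s t
    by (auto simp: L_def vec_eq_iff forall_2 axis_def)
  define \<alpha> where "\<alpha> w = (a \<circ> q2) (L w)" for w
  have \<alpha>: "\<alpha> (s, t) = a (q2 (vector [t, s]))" for s t by (simp add: \<alpha>_def L)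
  define D where "D v b = frechet_derivative (a \<circ> q2) (at v) b" for v b
  have cD: "continuous_on UNIV (\<lambda>v. D v b)" for b
    unfolding D_def by (intro smooth_on_continuous smooth_on_frechet a)
  have cL: "continuous_on UNIV L" unfolding L_def by (intro continuous_intros)
  have "C1 \<alpha> (\<lambda>w. D (L w) (axis 2 1)) (\<lambda>w. D (L w) (axis 1 1))"
    unfolding C1_def
  proof (intro conjI allI continuous_on_UNIV_compose[OF cD cL])
    fix w
    have 1: "((a \<circ> q2) has_derivative D (L w)) (at (L w))"
      unfolding D_def by (rule smooth_on_has_derivative[OF a]) simp
    then interpret linear "D (L w)" by (rule has_derivative_linear)
    have "(L has_derivative L) (at w)"
      unfolding L_def by (auto intro!: derivative_eq_intros)
    have 2: "D (L w) (L h) = fst h *\<^sub>R D (L w) (axis 2 1) + snd h *\<^sub>R D (L w) (axis 1 1)" for h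
      unfolding L_def[of h] add scale by (rule add.commute)
    from has_derivative_compose[OF \<open>(L has_derivative L) (at w)\<close> 1]
    show "(\<alpha> has_derivative (\<lambda>h. fst h *\<^sub>R D (L w) (axis 2 1) + snd h *\<^sub>R D (L w) (axis 1 1))) (at w)"
      unfolding \<alpha>_def[abs_def] by (rule has_derivative_eq_rhs) (rule ext, rule 2)
  qed
  then obtain G G1 where G: "C1 G G1 \<alpha>" "\<And>s. G (s, 0) = 0"
    "\<And>s t. G (s, t) = t * integral {0..1} (\<lambda>\<sigma>. \<alpha> (s, \<sigma> * t))"
    by (rule C1_primitive) blast
  have per: "\<alpha> (s + n, t + m) = \<alpha> (s, t)" if "m \<in> \<int>" "n \<in> \<int>" for s t m n
  proof -
    have "q2 (vector [t + m, s + n]) = q2 (vector [t, s])"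
      unfolding q2_eq_iff lattice2_def using that by (simp add: forall_2)
    then show ?thesis by (simp add: \<alpha>)
  qed
  have "G (s + n, t + m) = G (s, t) + G (s, m)" if "m \<in> \<int>" "n \<in> \<int>" for s t m n
  proof -
    have 1: "G (s + n, t) = G (s, t)" for t
      using per[of 0 n s] that by (simp add: G(3))
    have Gt: "((\<lambda>t. G (s, t)) has_real_derivative \<alpha> (s, t)) (at t)" for s t
    proof -
      have "((\<lambda>t. (s, t)) has_vector_derivative (0, 1)) (at t)"
        by (auto intro!: derivative_eq_intros has_vector_derivative_Pair)
      from C1_along[OF G(1) this refl] show ?thesis
        by (simp add: has_real_derivative_iff_has_vector_derivative)
    qed
    have "((\<lambda>t. G (s, t + m) - G (s, t)) has_real_derivative 0) (at t)" for t
    proof -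
      have "((\<lambda>t. G (s, t + m)) has_real_derivative \<alpha> (s, t + m)) (at t)"
        using DERIV_shift[of "\<lambda>t. G (s, t)" "\<alpha> (s, t + m)" t m] Gt by simp
      from DERIV_diff[OF this Gt[of s t]] show ?thesis using per[of m 0 s t] that by simp
    qed
    then have "G (s, t + m) - G (s, t) = G (s, 0 + m) - G (s, 0)"
      by (rule DERIV_isconst_all[OF allI])
    then show ?thesis using 1 by (simp add: G(2))
  qed
  then show thesis using that[OF G(1) \<alpha>] by blast
qed

text \<open>\<open>B\<close> plays the role of a primitive of \<sigma> on lifted loops with
  translation \<open>h\<close>: by the second clause its variation is the magnetic area swept out.
  The velocity is a separate argument because on the exceptional circles and at the ends only a
  continuous velocity \<open>G\<close> is given, and the first clause carries \<open>B\<close>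
  across them.\<close>

definition loop_area :: "('n::finite \<Rightarrow> torus2 \<Rightarrow> real) \<Rightarrow> real \<Rightarrow> 'n vect \<Rightarrow>
    ((real \<Rightarrow> 'n vect) \<Rightarrow> (real \<Rightarrow> 'n vect) \<Rightarrow> real) \<Rightarrow> bool" where
  "loop_area a \<tau> h B \<longleftrightarrow>
     (\<forall>(U::real set) Z G. continuous_on (U \<times> UNIV) Z \<longrightarrow> continuous_on (U \<times> UNIV) G \<longrightarrow>
       continuous_on U (\<lambda>s. B (\<lambda>t. Z (s, t)) (\<lambda>t. G (s, t)))) \<and>
     (\<forall>U Z s. open U \<longrightarrow> s \<in> U \<longrightarrow> smooth_on (U \<times> UNIV) Z \<longrightarrow>
       (\<forall>s\<in>U. Z (s, \<tau>) = Z (s, 0) + h) \<longrightarrow>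
       ((\<lambda>s. B (\<lambda>t. Z (s, t)) (\<lambda>t. D2 Z (s, t))) has_real_derivative
         integral {0..\<tau>} (\<lambda>t. magnetic_form a (torus_cover (Z (s, t))) (D1 Z (s, t)) (D2 Z (s, t)))) (at s))"

lemma loop_area_continuous:
  fixes U :: "real set"
  assumes "loop_area a \<tau> h B" "continuous_on (U \<times> UNIV) Z" "continuous_on (U \<times> UNIV) G"
  shows "continuous_on U (\<lambda>s. B (\<lambda>t. Z (s, t)) (\<lambda>t. G (s, t)))"
  by (rule assms(1)[unfolded loop_area_def, THEN conjunct1, rule_format, OF assms(2,3)])

lemma loop_area_derivative:
  fixes U :: "real set"
  assumes "loop_area a \<tau> h B" "open U" "s \<in> U" "smooth_on (U \<times> UNIV) Z"
    "\<And>s. s \<in> U \<Longrightarrow> Z (s, \<tau>) = Z (s, 0) + h"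
  shows "((\<lambda>s. B (\<lambda>t. Z (s, t)) (\<lambda>t. D2 Z (s, t))) has_real_derivative
    integral {0..\<tau>} (\<lambda>t. magnetic_form a (torus_cover (Z (s, t))) (D1 Z (s, t)) (D2 Z (s, t)))) (at s)"
  by (rule assms(1)[unfolded loop_area_def, THEN conjunct2, rule_format, OF assms(2-5)])

text \<open>\<open>\<sigma>\<close> has on the universal cover the primitive \<open>\<Sum>\<^sub>j b\<^sub>j dy\<^sub>j\<close>, where \<open>b\<^sub>j\<close> is the primitive of \<open>a\<^sub>j\<close> in
  the first coordinate and \<open>g j\<close> below is \<open>b\<^sub>j\<close> with its arguments swapped. It is not periodic, so that
  Stokes' theorem leaves a boundary term on the sides of the cut cylinder. As this term depends on
  \<open>y\<^sub>j\<close> only, it is absorbed in a primitive \<open>\<Xi> j\<close>.\<close>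

lemma loop_area_functional:
  fixes a :: "'n::finite \<Rightarrow> torus2 \<Rightarrow> real" and h :: "'n vect"
  assumes a: "smooth_coeffs a" and tau: "0 < \<tau>" and h: "\<And>j i. h $ j $ i \<in> \<int>"
  obtains B where "loop_area a \<tau> h B"
proof -
  have "\<forall>j. \<exists>G G1 \<alpha>. C1 G G1 \<alpha> \<and> (\<forall>s t. \<alpha> (s, t) = a j (q2 (vector [t, s]))) \<and>
     (\<forall>s t m n. m \<in> \<int> \<longrightarrow> n \<in> \<int> \<longrightarrow> G (s + n, t + m) = G (s, t) + G (s, m))"
  proof
    fix j
    have "smooth_on UNIV (a j \<circ> q2)" using a by (simp add: smooth_coeffs_def)
    then show "\<exists>G G1 \<alpha>. C1 G G1 \<alpha> \<and> (\<forall>s t. \<alpha> (s, t) = a j (q2 (vector [t, s]))) \<and>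
      (\<forall>s t m n. m \<in> \<int> \<longrightarrow> n \<in> \<int> \<longrightarrow> G (s + n, t + m) = G (s, t) + G (s, m))"
      by (rule magnetic_primitive) blast
  qed
  then obtain g g1 \<alpha> where g: "\<And>j. C1 (g j) (g1 j) (\<alpha> j)" "\<And>j s t. \<alpha> j (s, t) = a j (q2 (vector [t, s]))"
    "\<And>j s t m n. m \<in> \<int> \<Longrightarrow> n \<in> \<int> \<Longrightarrow> g j (s + n, t + m) = g j (s, t) + g j (s, m)"
    by metis
  note cg = C1_continuous[OF g(1)]
  have "\<forall>j. \<exists>\<Xi>. \<forall>y. (\<Xi> has_vector_derivative g j (y, h $ j $ 1)) (at y)"
  proof
    fix j
    have "continuous_on UNIV (\<lambda>y. g j (y, h $ j $ 1))"
      by (intro continuous_on_UNIV_compose[OF cg(1)] continuous_intros)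
    then show "\<exists>\<Xi>. \<forall>y. (\<Xi> has_vector_derivative g j (y, h $ j $ 1)) (at y)"
      by (rule has_antiderivative) blast
  qed
  then obtain \<Xi> where Xi: "\<And>j y. (\<Xi> j has_vector_derivative g j (y, h $ j $ 1)) (at y)" by metis
  have cXi: "continuous_on UNIV (\<Xi> j)" for j
    using Xi has_vector_derivative_continuous by (metis continuous_at_imp_continuous_on)
  define sw where "sw v = (v $ 2, v $ 1)" for v :: "real^2"
  define B where "B c c' = (\<Sum>j\<in>UNIV. integral {0..\<tau>} (\<lambda>t. g j (sw (c t $ j)) \<bullet> (c' t $ j $ 2)) - \<Xi> j (c 0 $ j $ 2))"
    for c c' :: "real \<Rightarrow> 'n vect"
  show thesis
  proof (rule that[of B], unfold loop_area_def, intro conjI allI impI)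
    fix U :: "real set" and Z G :: "real \<times> real \<Rightarrow> 'n vect"
    assume Z: "continuous_on (U \<times> UNIV) Z" and G: "continuous_on (U \<times> UNIV) G"
    have Z0: "continuous_on U (\<lambda>s. Z (s, 0))"
      by (rule continuous_on_compose2[OF Z]) (auto intro!: continuous_intros)
    have ZZ: "continuous_on (U \<times> {0..\<tau>}) Z" "continuous_on (U \<times> {0..\<tau>}) G"
      using Z G by (auto intro: continuous_on_subset)
    show "continuous_on U (\<lambda>s. B (\<lambda>t. Z (s, t)) (\<lambda>t. G (s, t)))"
      unfolding B_def cbox_interval[symmetric]
      by (intro continuous_intros integral_continuous_on_param continuous_on_UNIV_compose[OF cXi] Z0)
        (auto simp: case_prod_beta' sw_def intro!: continuous_intros ZZ continuous_on_UNIV_compose[OF cg(1)])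
  next
    fix U :: "real set" and Z :: "real \<times> real \<Rightarrow> 'n vect" and s
    assume U: "open U" "s \<in> U" and Z: "smooth_on (U \<times> UNIV) Z"
      and "\<forall>s\<in>U. Z (s, \<tau>) = Z (s, 0) + h"
    then have per: "\<And>s. s \<in> U \<Longrightarrow> Z (s, \<tau>) = Z (s, 0) + h" by blast
    obtain d where d: "0 < d" "ball s d \<subseteq> U" using U open_contains_ball by blast
    define I where "I = ball s d"
    have I: "open I" "convex I" "s \<in> I" "I \<subseteq> U" using d by (auto simp: I_def)
    have op: "open (U \<times> (UNIV :: real set))" using U by (simp add: open_Times)
    have Z': "smooth_on (I \<times> UNIV) Z" by (rule smooth_on_subset[OF Z]) (use I(4) in auto)
    have cont: "continuous_on (I \<times> {0..\<tau>}) Z" "continuous_on (I \<times> {0..\<tau>}) (D1 Z)" "continuous_on (I \<times> {0..\<tau>}) (D2 Z)"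
      "continuous_on (I \<times> {0..\<tau>}) (D1 (D2 Z))"
      by (rule continuous_on_subset[of "I \<times> UNIV"]; (intro smooth_on_continuous smooth_on_D1 smooth_on_D2 Z' | force))+
    have comp: "((\<lambda>r. F r $ j $ i) has_vector_derivative F' $ j $ i) (at x)"
      if "(F has_vector_derivative F') (at x)" for F :: "real \<Rightarrow> 'n vect" and F' x j i
      by (intro bounded_linear.has_vector_derivative[OF bounded_linear_vec_nth] that)
    have dg: "((\<lambda>r. g j (sw (F r $ j))) has_vector_derivative
        F' $ j $ 2 * g1 j (sw (F x $ j)) + F' $ j $ 1 * \<alpha> j (sw (F x $ j))) (at x)"
      if "(F has_vector_derivative F') (at x)" for F :: "real \<Rightarrow> 'n vect" and F' x j
    proof -
      have "((\<lambda>r. sw (F r $ j)) has_vector_derivative (F' $ j $ 2, F' $ j $ 1)) (at x)"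
        unfolding sw_def by (intro has_vector_derivative_Pair comp that)
      from C1_along[OF g(1) this refl] show ?thesis by simp
    qed
    define P1 where "P1 j s t = D1 Z (s, t) $ j $ 2 * g1 j (sw (Z (s, t) $ j)) + D1 Z (s, t) $ j $ 1 * \<alpha> j (sw (Z (s, t) $ j))" for j s t
    define P2 where "P2 j s t = D2 Z (s, t) $ j $ 2 * g1 j (sw (Z (s, t) $ j)) + D2 Z (s, t) $ j $ 1 * \<alpha> j (sw (Z (s, t) $ j))" for j s t
    have main: "((\<lambda>s. integral {0..\<tau>} (\<lambda>t. g j (sw (Z (s, t) $ j)) \<bullet> (D2 Z (s, t) $ j $ 2)) - \<Xi> j (Z (s, 0) $ j $ 2))
      has_real_derivative integral {0..\<tau>} (\<lambda>t. a j (torus_cover (Z (s, t)) $ j) * area_form (D1 Z (s, t) $ j) (D2 Z (s, t) $ j))) (at s)" for j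
    proof -
      have A: "((\<lambda>s. integral {0..\<tau>} (\<lambda>t. g j (sw (Z (s, t) $ j)) \<bullet> (D2 Z (s, t) $ j $ 2))) has_real_derivative
        integral {0..\<tau>} (\<lambda>t. P1 j s t \<bullet> (D2 Z (s, t) $ j $ 2) - P2 j s t \<bullet> (D1 Z (s, t) $ j $ 2))
        + (g j (sw (Z (s, \<tau>) $ j)) \<bullet> (D1 Z (s, \<tau>) $ j $ 2) - g j (sw (Z (s, 0) $ j)) \<bullet> (D1 Z (s, 0) $ j $ 2))) (at s)"
      proof (rule cylinder_stokes[OF I(1-3), where ?X12.0 = "\<lambda>s t. D1 (D2 Z) (s, t) $ j $ 2"])
        fix s t :: real assume "s \<in> I"
        then have st: "(s, t) \<in> I \<times> UNIV" "(s, t) \<in> U \<times> UNIV" using I(4) by auto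
        show "((\<lambda>s. g j (sw (Z (s, t) $ j))) has_vector_derivative P1 j s t) (at s)"
          unfolding P1_def by (rule dg[OF D1_has_vector_derivative[OF Z st(2)]])
        show "((\<lambda>t. g j (sw (Z (s, t) $ j))) has_vector_derivative P2 j s t) (at t)"
          unfolding P2_def by (rule dg[OF D2_has_vector_derivative[OF Z st(2)]])
        show "((\<lambda>s. D2 Z (s, t) $ j $ 2) has_vector_derivative D1 (D2 Z) (s, t) $ j $ 2) (at s)"
          by (rule comp[OF D1_has_vector_derivative[OF smooth_on_D2[OF Z] st(2)]])
        show "((\<lambda>t. D1 Z (s, t) $ j $ 2) has_vector_derivative D1 (D2 Z) (s, t) $ j $ 2) (at t)"
          unfolding D1_D2_commute[OF op Z st(2)]
          by (rule comp[OF D2_has_vector_derivative[OF smooth_on_D1[OF Z] st(2)]])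
      qed (use tau cont in \<open>auto simp: case_prod_beta' P1_def P2_def sw_def intro!: continuous_intros cg[THEN continuous_on_UNIV_compose]\<close>)
      have X: "((\<lambda>s. \<Xi> j (Z (s, 0) $ j $ 2)) has_real_derivative g j (Z (s, 0) $ j $ 2, h $ j $ 1) * (D1 Z (s, 0) $ j $ 2)) (at s)"
      proof -
        have "((\<lambda>s. Z (s, 0) $ j $ 2) has_real_derivative D1 Z (s, 0) $ j $ 2) (at s)"
          using comp[OF D1_has_vector_derivative[OF Z, of s 0]] U(2)
          by (simp add: has_real_derivative_iff_has_vector_derivative)
        from DERIV_chain2[OF Xi[of j, unfolded has_real_derivative_iff_has_vector_derivative[symmetric]] this]
        show ?thesis .
      qed
      have per1: "D1 Z (s, \<tau>) = D1 Z (s, 0)"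
      proof -
        have "((\<lambda>s. Z (s, \<tau>)) has_vector_derivative D1 Z (s, \<tau>)) (at s within I)"
          by (rule has_vector_derivative_at_within[OF D1_has_vector_derivative[OF Z]]) (use U in simp)
        then have "((\<lambda>s. Z (s, 0) + h) has_vector_derivative D1 Z (s, \<tau>)) (at s within I)"
          by (rule has_vector_derivative_transform[OF I(3), rotated]) (use per I(4) in auto)
        then have 1: "((\<lambda>s. Z (s, 0) + h) has_vector_derivative D1 Z (s, \<tau>)) (at s)"
          using at_within_open[OF I(3,1)] by simp
        have "((\<lambda>s. Z (s, 0)) has_vector_derivative D1 Z (s, 0)) (at s)"
          by (rule D1_has_vector_derivative[OF Z]) (use U in simp)
        then have "((\<lambda>s. Z (s, 0) + h) has_vector_derivative D1 Z (s, 0)) (at s)"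
          by (auto intro!: derivative_eq_intros)
        from vector_derivative_unique_at[OF 1 this] show ?thesis .
      qed
      have "g j (sw (Z (s, \<tau>) $ j)) = g j (sw (Z (s, 0) $ j)) + g j (Z (s, 0) $ j $ 2, h $ j $ 1)"
        unfolding per[OF U(2)] sw_def using g(3)[OF h h] by simp
      then have bd: "g j (sw (Z (s, \<tau>) $ j)) \<bullet> (D1 Z (s, \<tau>) $ j $ 2) - g j (sw (Z (s, 0) $ j)) \<bullet> (D1 Z (s, 0) $ j $ 2)
          = g j (Z (s, 0) $ j $ 2, h $ j $ 1) * (D1 Z (s, 0) $ j $ 2)"
        unfolding per1 by (simp add: algebra_simps)
      have vec2: "vector [v $ 1, v $ 2] = v" for v :: "real^2"
        by (simp add: vec_eq_iff forall_2)
      have "P1 j s t \<bullet> (D2 Z (s, t) $ j $ 2) - P2 j s t \<bullet> (D1 Z (s, t) $ j $ 2) =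
          a j (torus_cover (Z (s, t)) $ j) * area_form (D1 Z (s, t) $ j) (D2 Z (s, t) $ j)" for t
        by (simp add: P1_def P2_def area_form_def g(2) sw_def vec2 torus_cover_def algebra_simps)
      then show ?thesis using DERIV_diff[OF A X] unfolding bd by simp
    qed
    have "((\<lambda>s. B (\<lambda>t. Z (s, t)) (\<lambda>t. D2 Z (s, t))) has_real_derivative
       (\<Sum>j\<in>UNIV. integral {0..\<tau>} (\<lambda>t. a j (torus_cover (Z (s, t)) $ j) * area_form (D1 Z (s, t) $ j) (D2 Z (s, t) $ j)))) (at s)"
      unfolding B_def by (intro DERIV_sum main)
    moreover have "(\<Sum>j\<in>UNIV. integral {0..\<tau>} (\<lambda>t. a j (torus_cover (Z (s, t)) $ j) * area_form (D1 Z (s, t) $ j) (D2 Z (s, t) $ j)))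
      = integral {0..\<tau>} (\<lambda>t. magnetic_form a (torus_cover (Z (s, t))) (D1 Z (s, t)) (D2 Z (s, t)))"
      unfolding magnetic_form_def
    proof (rule integral_sum[symmetric])
      fix j
      have c1: "continuous_on {0..\<tau>} (\<lambda>t. f (s, t))" if "continuous_on (I \<times> {0..\<tau>}) f" for f :: "real \<times> real \<Rightarrow> 'n vect"
        by (rule continuous_on_curry[OF that order_refl I(3)])
      have "continuous_on UNIV (a j \<circ> q2)"
        using a by (intro smooth_on_continuous) (simp add: smooth_coeffs_def)
      then have "continuous_on {0..\<tau>} (\<lambda>t. (a j \<circ> q2) (Z (s, t) $ j))"
        by (rule continuous_on_UNIV_compose) (intro continuous_intros c1 cont)
      then have "continuous_on {0..\<tau>} (\<lambda>t. a j (torus_cover (Z (s, t)) $ j))"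
        by (simp add: torus_cover_def)
      then show "(\<lambda>t. a j (torus_cover (Z (s, t)) $ j) * area_form (D1 Z (s, t) $ j) (D2 Z (s, t) $ j)) integrable_on {0..\<tau>}"
        unfolding area_form_def by (intro integrable_continuous_real continuous_intros c1 cont)
    qed simp
    ultimately show "((\<lambda>s. B (\<lambda>t. Z (s, t)) (\<lambda>t. D2 Z (s, t))) has_real_derivative
         integral {0..\<tau>} (\<lambda>t. magnetic_form a (torus_cover (Z (s, t))) (D1 Z (s, t)) (D2 Z (s, t)))) (at s)"
      by simp
  qed
qed

text \<open>The reference loop has the linear lift, whose translation over one period is
  \<open>h\<close>; continuing it over the cylinder turns the torus velocity in
  \<open>capping\<close> into an ordinary derivative.\<close>

lemma capping_lift:
  fixes z :: "real \<times> real \<Rightarrow> 'n::finite torus"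
  assumes tau: "0 < \<tau>" and cap: "capping \<tau> h w z"
  obtains Z G where "continuous_on ({0..1} \<times> UNIV) Z" "continuous_on ({0..1} \<times> UNIV) G"
    "\<And>s t. s \<in> {0..1} \<Longrightarrow> torus_cover (Z (s, t)) = z (s, t)"
    "\<And>s t. s \<in> {0..1} \<Longrightarrow> Z (s, t + \<tau>) = Z (s, t) + of_int_vect h"
    "\<And>s t. s \<in> {0..1} \<Longrightarrow> ((\<lambda>t. Z (s, t)) has_vector_derivative G (s, t)) (at t)"
proof -
  have z: "continuous_on ({0..1} \<times> UNIV) z" "\<And>s t. s \<in> {0..1} \<Longrightarrow> z (s, t + \<tau>) = z (s, t)"
    "\<And>t. z (0, t) = ref_loop h (t / \<tau>)"
    using cap unfolding capping_def by blast+
  obtain G where G: "continuous_on ({0..1} \<times> UNIV) G" "\<And>s t. s \<in> {0..1} \<Longrightarrow> has_torus_vel (\<lambda>t'. z (s, t')) (G (s, t)) t"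
    using cap unfolding capping_def by blast
  have c: "continuous_on UNIV (\<lambda>t. (t / \<tau>) *\<^sub>R of_int_vect h :: 'n vect)"
    "torus_cover ((t / \<tau>) *\<^sub>R of_int_vect h) = z (0, t)"
    "((t + \<tau>) / \<tau>) *\<^sub>R of_int_vect h = (t / \<tau>) *\<^sub>R of_int_vect h + (of_int_vect h :: 'n vect)" for t
    using tau by (auto intro!: continuous_intros simp: z(3) ref_loop_def add_divide_distrib scaleR_add_left)
  obtain Z where Z: "continuous_on ({0..1} \<times> UNIV) Z" "\<And>s t. s \<in> {0..1} \<Longrightarrow> torus_cover (Z (s, t)) = z (s, t)"
    "\<And>s t. s \<in> {0..1} \<Longrightarrow> Z (s, t + \<tau>) = Z (s, t) + of_int_vect h"
    using cylinder_lift[OF tau z(1,2) c] by metis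
  have "((\<lambda>t. Z (s, t)) has_vector_derivative G (s, t)) (at t)" if s: "s \<in> {0..1}" for s t
  proof -
    have "continuous_on UNIV (\<lambda>t. Z (s, t))"
      by (rule continuous_on_curry[OF Z(1) order_refl s])
    then have 1: "isCont (\<lambda>t. Z (s, t)) t" by (simp add: continuous_on_eq_continuous_at)
    have 2: "\<forall>\<^sub>F r in nhds t. torus_cover (Z (s, r)) = z (s, r)" using Z(2)[OF s] by simp
    show ?thesis by (rule has_torus_vel_lift[OF 1 2, THEN iffD1, OF G(2)[OF s]])
  qed
  with Z G(1) that show thesis by metis
qed

text \<open>The integrand of the outer integral may be unbounded at the exceptional circles, but it is the
  derivative of a function that is continuous there, hence Henstock--Kurzweil integrable.\<close>

lemma magnetic_area_lift:
  fixes z :: "real \<times> real \<Rightarrow> 'n::finite torus"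
  assumes B: "loop_area a \<tau> h B"
    and S: "finite S" "smooth_torus_on (({0<..<1} - S) \<times> UNIV) z"
    and Z: "continuous_on ({0..1} \<times> UNIV) Z" "continuous_on ({0..1} \<times> UNIV) G"
    "\<And>s t. s \<in> {0..1} \<Longrightarrow> torus_cover (Z (s, t)) = z (s, t)"
    "\<And>s t. s \<in> {0..1} \<Longrightarrow> Z (s, t + \<tau>) = Z (s, t) + h"
    "\<And>s t. s \<in> {0..1} \<Longrightarrow> ((\<lambda>t. Z (s, t)) has_vector_derivative G (s, t)) (at t)"
  shows "magnetic_area a \<tau> z = B (\<lambda>t. Z (1, t)) (\<lambda>t. G (1, t)) - B (\<lambda>t. Z (0, t)) (\<lambda>t. G (0, t))"
proof -
  define U where "U = {0<..<1} - S"
  have U: "open U" "U \<subseteq> {0..1}" using S(1) by (auto simp: U_def open_Diff finite_imp_closed)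
  have op: "open (U \<times> (UNIV :: real set))" using U by (simp add: open_Times)
  have sm: "smooth_on (U \<times> UNIV) Z"
  proof (rule smooth_lift[OF op])
    show "smooth_torus_on (U \<times> UNIV) z" using S(2) by (simp add: U_def)
    show "continuous_on (U \<times> UNIV) Z" by (rule continuous_on_subset[OF Z(1)]) (use U in auto)
  qed (use U Z(3) in auto)
  \<comment> \<open>On the smooth part both clauses of \<open>loop_area\<close> thus concern the
    same function of \<open>s\<close>.\<close>
  have GD: "G (s, t) = D2 Z (s, t)" if "s \<in> U" for s t
  proof -
    have "((\<lambda>t. Z (s, t)) has_vector_derivative D2 Z (s, t)) (at t)"
      by (rule D2_has_vector_derivative[OF sm]) (use that in simp)
    from vector_derivative_unique_at[OF Z(5) this] show ?thesis using that U by auto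
  qed
  have "((\<lambda>s. integral {0..\<tau>} (\<lambda>t. magnetic_form a (z (s, t)) (torus_vel (\<lambda>s'. z (s', t)) s) (torus_vel (\<lambda>t'. z (s, t')) t)))
      has_integral B (\<lambda>t. Z (1, t)) (\<lambda>t. G (1, t)) - B (\<lambda>t. Z (0, t)) (\<lambda>t. G (0, t))) {0..1}"
  proof (rule fundamental_theorem_of_calculus_interior_strong[OF S(1), of 0 1 "\<lambda>s. B (\<lambda>t. Z (s, t)) (\<lambda>t. G (s, t))"])
    fix s assume "s \<in> {0<..<1} - S"
    then have s: "s \<in> U" by (simp add: U_def)
    have v1: "torus_vel (\<lambda>s'. z (s', t)) s = D1 Z (s, t)" for t
    proof (rule torus_vel_lift)
      show "((\<lambda>s'. Z (s', t)) has_vector_derivative D1 Z (s, t)) (at s)"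
        by (rule D1_has_vector_derivative[OF sm]) (use s in simp)
      show "\<forall>\<^sub>F r in nhds s. torus_cover (Z (r, t)) = z (r, t)"
        using eventually_nhds_in_open[OF U(1) s] by eventually_elim (use Z(3) U in auto)
    qed
    have v2: "torus_vel (\<lambda>t'. z (s, t')) t = D2 Z (s, t)" for t
    proof (rule torus_vel_lift)
      show "((\<lambda>t. Z (s, t)) has_vector_derivative D2 Z (s, t)) (at t)"
        by (rule D2_has_vector_derivative[OF sm]) (use s in simp)
      show "\<forall>\<^sub>F r in nhds t. torus_cover (Z (s, r)) = z (s, r)" using Z(3) s U by auto
    qed
    have zZ: "z (s, t) = torus_cover (Z (s, t))" for t using Z(3) s U by auto
    have "((\<lambda>s. B (\<lambda>t. Z (s, t)) (\<lambda>t. D2 Z (s, t))) has_real_derivative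
         integral {0..\<tau>} (\<lambda>t. magnetic_form a (z (s, t)) (torus_vel (\<lambda>s'. z (s', t)) s) (torus_vel (\<lambda>t'. z (s, t')) t))) (at s)"
      unfolding v1 v2 unfolding zZ
    proof (rule loop_area_derivative[OF B U(1) s sm])
      show "Z (s, \<tau>) = Z (s, 0) + h" if "s \<in> U" for s using Z(4)[of s 0] that U by auto
    qed
    then have "((\<lambda>s. B (\<lambda>t. Z (s, t)) (\<lambda>t. D2 Z (s, t))) has_vector_derivative
         integral {0..\<tau>} (\<lambda>t. magnetic_form a (z (s, t)) (torus_vel (\<lambda>s'. z (s', t)) s) (torus_vel (\<lambda>t'. z (s, t')) t))) (at s within U)"
      by (simp add: has_real_derivative_iff_has_vector_derivative has_vector_derivative_at_within)
    then have "((\<lambda>s. B (\<lambda>t. Z (s, t)) (\<lambda>t. G (s, t))) has_vector_derivative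
         integral {0..\<tau>} (\<lambda>t. magnetic_form a (z (s, t)) (torus_vel (\<lambda>s'. z (s', t)) s) (torus_vel (\<lambda>t'. z (s, t')) t))) (at s within U)"
      by (rule has_vector_derivative_transform[OF s, rotated]) (simp add: GD)
    then show "((\<lambda>s. B (\<lambda>t. Z (s, t)) (\<lambda>t. G (s, t))) has_vector_derivative
         integral {0..\<tau>} (\<lambda>t. magnetic_form a (z (s, t)) (torus_vel (\<lambda>s'. z (s', t)) s) (torus_vel (\<lambda>t'. z (s, t')) t))) (at s)"
      using at_within_open[OF s U(1)] by simp
  qed (use loop_area_continuous[OF B Z(1,2)] in auto)
  then show ?thesis unfolding magnetic_area_def by (rule integral_unique)
qed

section \<open>The energy identity\<close>

text \<open>All members of a class share the loop and the area of the capping, so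
  \<open>pair_action\<close> is constant on it and \<open>the_elem\<close> returns this
  value.\<close>

lemma action_representative:
  assumes c: "c \<in> loop_space a \<tau> h" and wz: "(w, z) \<in> c"
  shows "(w, z) \<in> capped_loops \<tau> h" "action a V \<tau> c = pair_action a V \<tau> (w, z)"
proof -
  obtain w0 z0 where c0: "c = capped_rel a \<tau> h `` {(w0, z0)}"
    using c unfolding loop_space_def by (auto elim!: quotientE)
  then show "(w, z) \<in> capped_loops \<tau> h"
    using wz by (auto simp: capped_rel_def)
  have eq: "pair_action a V \<tau> (w', z') = pair_action a V \<tau> (w, z)" if "(w', z') \<in> c" for w' z'
    using that wz unfolding c0 by (auto simp: capped_rel_def pair_action_def)
  have "pair_action a V \<tau> ` c = {pair_action a V \<tau> (w, z)}"
  proof (intro equalityI subsetI)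
    fix r assume "r \<in> pair_action a V \<tau> ` c"
    then obtain w' z' where "(w', z') \<in> c" "r = pair_action a V \<tau> (w', z')" by auto
    then show "r \<in> {pair_action a V \<tau> (w, z)}" using eq by simp
  qed (use wz in auto)
  then show "action a V \<tau> c = pair_action a V \<tau> (w, z)" by (simp add: action_def)
qed

section \<open>Convergence and boundedness at the ends of the cylinder\<close>

lemma uniform_limit_param:
  fixes f :: "real \<times> real \<Rightarrow> 'a::metric_space" and \<rho> :: "'b \<Rightarrow> real"
  assumes f: "continuous_on ({0..1} \<times> {0..\<tau>}) f" and lim: "(\<rho> \<longlongrightarrow> r0) F"
    and r: "\<And>s. \<rho> s \<in> {0..1}" "r0 \<in> {0..1}"
  shows "uniform_limit {0..\<tau>} (\<lambda>s t. f (\<rho> s, t)) (\<lambda>t. f (r0, t)) F"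
proof (rule uniform_limitI)
  fix e :: real assume e: "0 < e"
  have "uniformly_continuous_on ({0..1} \<times> {0..\<tau>}) f"
    by (intro compact_uniformly_continuous f compact_Times) auto
  then obtain d where d: "d > 0" "\<And>w w'. w \<in> {0..1} \<times> {0..\<tau>} \<Longrightarrow> w' \<in> {0..1} \<times> {0..\<tau>} \<Longrightarrow> dist w' w < d \<Longrightarrow> dist (f w') (f w) < e"
    using e unfolding uniformly_continuous_on_def by blast
  show "\<forall>\<^sub>F s in F. \<forall>t\<in>{0..\<tau>}. dist (f (\<rho> s, t)) (f (r0, t)) < e"
    using tendstoD[OF lim d(1)]
  proof eventually_elim
    case (elim s)
    then show ?case using r by (auto intro!: d(2) simp: dist_Pair_Pair)
  qed
qed

lemma tendsto_integral_uniform: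
  fixes f :: "'b \<Rightarrow> real \<Rightarrow> real"
  assumes "uniform_limit {0..\<tau>} f g F" "\<And>s. continuous_on {0..\<tau>} (f s)" "F \<noteq> bot"
  shows "((\<lambda>s. integral {0..\<tau>} (f s)) \<longlongrightarrow> integral {0..\<tau>} g) F"
proof -
  obtain I J where IJ: "\<And>n. (f n has_integral I n) {0..\<tau>}" "(g has_integral J) {0..\<tau>}" "(I \<longlongrightarrow> J) F"
    using uniform_limit_integral[OF assms] by blast
  have "I = (\<lambda>s. integral {0..\<tau>} (f s))" using integral_unique[OF IJ(1)] by (intro ext) simp
  then show ?thesis using IJ by (simp add: integral_unique)
qed

lemma V_continuous:
  assumes "smooth_potential \<tau> V" "continuous_on S t" "continuous_on S x"
  shows "continuous_on S (\<lambda>y. V (t y) (torus_cover (x y)))"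
proof -
  have c: "continuous_on UNIV (\<lambda>(t, x). V t (torus_cover x))"
    using assms(1) by (intro smooth_on_continuous) (simp add: smooth_potential_def)
  show ?thesis
    using continuous_on_compose2[OF c continuous_on_Pair[OF assms(2,3)]] by simp
qed

lemma grad_V_continuous:
  assumes "smooth_potential \<tau> V" "continuous_on S t" "continuous_on S x"
  shows "continuous_on S (\<lambda>y. grad_V V (t y) (x y))"
  using continuous_on_compose2[OF continuous_on_grad_V[OF assms(1)] continuous_on_Pair[OF assms(2,3)]] by simp

text \<open>The momentum converges uniformly by the asymptotic condition. Convergence of the
  \<open>t\<close>-derivative of the base component is supplied by the velocity \<open>G\<close>,
  which is continuous up to the limiting circle \<open>r0\<close>.\<close>

lemma hamiltonian_terms_limit:
  fixes Z G :: "real \<times> real \<Rightarrow> 'n::finite vect"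
  assumes V: "smooth_potential \<tau> V"
    and Z: "continuous_on ({0..1} \<times> UNIV) Z" "continuous_on ({0..1} \<times> UNIV) G"
      "\<And>s t. s \<in> {0..1} \<Longrightarrow> ((\<lambda>t. Z (s, t)) has_vector_derivative G (s, t)) (at t)"
    and r: "\<And>s. \<rho> s \<in> {0..1}" "r0 \<in> {0..1}" "(\<rho> \<longlongrightarrow> r0) F" "F \<noteq> bot"
    and w: "smooth_phase_on UNIV w" "\<And>t. fst (w t) = torus_cover (Z (r0, t))"
    and p: "continuous_on UNIV p" "uniform_limit UNIV (\<lambda>s t. p (s, t)) (\<lambda>t. snd (w t)) F"
  shows "((\<lambda>s. integral {0..\<tau>} (\<lambda>t. p (s, t) \<bullet> G (\<rho> s, t))
       - integral {0..\<tau>} (\<lambda>t. (norm (p (s, t)))\<^sup>2 / 2 + V t (torus_cover (Z (\<rho> s, t))))) \<longlongrightarrow>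
     integral {0..\<tau>} (\<lambda>t. snd (w t) \<bullet> fst (phase_vel w t)) - integral {0..\<tau>} (\<lambda>t. hamiltonian V t (w t))) F"
proof -
  have sw: "smooth_on UNIV (snd \<circ> w)" using w(1) by (simp add: smooth_phase_on_def)
  have csw: "continuous_on S (\<lambda>t. snd (w t))" for S
    using smooth_on_continuous[OF sw] continuous_on_subset by (fastforce simp: o_def)
  have pv: "fst (phase_vel w t) = G (r0, t)" for t
  proof -
    have "((snd \<circ> w) has_derivative frechet_derivative (snd \<circ> w) (at t)) (at t)"
      by (rule smooth_on_has_derivative[OF sw]) simp
    then obtain v where v: "((snd \<circ> w) has_vector_derivative v) (at t)"
      using vector_derivative_works differentiableI_vector differentiable_def by blast
    have "has_torus_vel (fst \<circ> w) (G (r0, t)) t"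
      unfolding has_torus_vel_def
      by (intro exI[of _ "\<lambda>t. Z (r0, t)"]) (simp add: Z(3)[OF r(2)] w(2))
    then have "has_phase_vel w (G (r0, t), v) t" using v by (simp add: has_phase_vel_def)
    then show ?thesis by (simp add: phase_vel_eq)
  qed
  have cs: "continuous_on T (\<lambda>t. f (s, t))" if "continuous_on ({0..1} \<times> UNIV) f" "s \<in> {0..1}"
    for f :: "real \<times> real \<Rightarrow> 'n vect" and s T
    by (rule continuous_on_subset[OF continuous_on_curry[OF that(1) order_refl that(2)]]) simp
  have cp: "continuous_on T (\<lambda>t. p (s, t))" for s T
    by (rule continuous_on_UNIV_compose[OF p(1)]) (intro continuous_intros)
  have up: "uniform_limit {0..\<tau>} (\<lambda>s t. p (s, t)) (\<lambda>t. snd (w t)) F"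
    using p(2) by (rule uniform_limit_on_subset) simp
  have uG: "uniform_limit {0..\<tau>} (\<lambda>s t. G (\<rho> s, t)) (\<lambda>t. G (r0, t)) F"
    by (intro uniform_limit_param continuous_on_subset[OF Z(2)] r) auto
  have uV: "uniform_limit {0..\<tau>} (\<lambda>s t. V t (torus_cover (Z (\<rho> s, t)))) (\<lambda>t. V t (torus_cover (Z (r0, t)))) F"
  proof -
    have "continuous_on ({0..1} \<times> {0..\<tau>}) (\<lambda>y. V (snd y) (torus_cover (Z (fst y, snd y))))"
      unfolding prod.collapse
      by (intro V_continuous[OF V] continuous_intros continuous_on_subset[OF Z(1)]) auto
    from uniform_limit_param[OF this r(3,1,2)] show ?thesis by simp
  qed
  have bw: "bounded ((\<lambda>t. snd (w t)) ` {0..\<tau>})" "bounded ((\<lambda>t. G (r0, t)) ` {0..\<tau>})"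
    by (intro compact_imp_bounded compact_continuous_image csw cs[OF Z(2) r(2)] compact_Icc)+
  have u1: "uniform_limit {0..\<tau>} (\<lambda>s t. p (s, t) \<bullet> G (\<rho> s, t)) (\<lambda>t. snd (w t) \<bullet> G (r0, t)) F"
    by (rule bounded_bilinear.bounded_uniform_limit[OF bounded_bilinear_inner up uG bw(2,1)])
  have u2: "uniform_limit {0..\<tau>} (\<lambda>s t. (1/2) *\<^sub>R (p (s, t) \<bullet> p (s, t))) (\<lambda>t. (1/2) *\<^sub>R (snd (w t) \<bullet> snd (w t))) F"
    by (rule bounded_linear.uniform_limit[OF bounded_linear_scaleR_right
          bounded_bilinear.bounded_uniform_limit[OF bounded_bilinear_inner up up bw(1) bw(1)]])
  have l1: "((\<lambda>s. integral {0..\<tau>} (\<lambda>t. p (s, t) \<bullet> G (\<rho> s, t))) \<longlongrightarrow> integral {0..\<tau>} (\<lambda>t. snd (w t) \<bullet> G (r0, t))) F"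
    by (intro tendsto_integral_uniform[OF u1] r(4) continuous_intros cp cs[OF Z(2)] r(1))
  have "((\<lambda>s. integral {0..\<tau>} (\<lambda>t. (1/2) *\<^sub>R (p (s, t) \<bullet> p (s, t)) + V t (torus_cover (Z (\<rho> s, t))))) \<longlongrightarrow>
     integral {0..\<tau>} (\<lambda>t. (1/2) *\<^sub>R (snd (w t) \<bullet> snd (w t)) + V t (torus_cover (Z (r0, t))))) F"
    by (intro tendsto_integral_uniform uniform_limit_add u2 uV r(4) continuous_intros cp V_continuous[OF V] cs[OF Z(1)] r(1))
  from tendsto_diff[OF l1 this] show ?thesis
    by (simp add: pv hamiltonian_def w(2) power2_norm_eq_inner)
qed

text \<open>A qualitative bound that depends on the cylinder: close to the limit loops outside a
  compact range of \<open>s\<close>, and by compactness inside. It makes the supremum in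
  \<open>apriori_bound\<close> finite.\<close>

lemma momentum_bounded:
  fixes p :: "real \<times> real \<Rightarrow> 'a::real_normed_vector"
  assumes tau: "0 < \<tau>" and p: "continuous_on UNIV p" "\<And>s t. p (s, t + \<tau>) = p (s, t)"
    and q: "continuous_on UNIV w1" "continuous_on UNIV w2"
    and lim: "uniform_limit UNIV (\<lambda>s t. p (s, t)) w1 at_bot" "uniform_limit UNIV (\<lambda>s t. p (s, t)) w2 at_top"
  obtains P where "\<And>w. norm (p w) \<le> P"
proof -
  have "\<forall>\<^sub>F s in at_bot. \<forall>t\<in>UNIV. dist (p (s, t)) (w1 t) < 1" by (rule uniform_limitD[OF lim(1)]) simp
  then obtain S1 where S1: "\<And>s t. s \<le> S1 \<Longrightarrow> dist (p (s, t)) (w1 t) < 1" unfolding eventually_at_bot_linorder by blast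
  have "\<forall>\<^sub>F s in at_top. \<forall>t\<in>UNIV. dist (p (s, t)) (w2 t) < 1" by (rule uniform_limitD[OF lim(2)]) simp
  then obtain S2 where S2: "\<And>s t. s \<ge> S2 \<Longrightarrow> dist (p (s, t)) (w2 t) < 1" unfolding eventually_at_top_linorder by blast
  define K where "K = w1 ` {0..\<tau>} \<union> w2 ` {0..\<tau>} \<union> p ` ({S1..S2} \<times> {0..\<tau>})"
  have "compact K"
    unfolding K_def
    by (intro compact_Un compact_continuous_image compact_Times compact_Icc continuous_on_subset[OF p(1)]
        continuous_on_subset[OF q(1)] continuous_on_subset[OF q(2)] subset_UNIV)
  then have "bounded K" by (rule compact_imp_bounded)
  then obtain B where B: "\<And>y. y \<in> K \<Longrightarrow> norm y \<le> B"
    unfolding bounded_iff by blast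
  have near: "norm v \<le> B + 1" if "dist v y < 1" "norm y \<le> B" for v y :: 'a
    using that norm_triangle_sub[of v y] by (simp add: dist_norm)
  have 1: "norm (p (s, t)) \<le> B + 1" if t: "t \<in> {0..\<tau>}" for s t
  proof -
    consider "s \<le> S1" | "S2 \<le> s" | "s \<in> {S1..S2}" by force
    then show ?thesis
    proof cases
      case 1
      show ?thesis by (rule near[OF S1[OF 1] B]) (use t in \<open>simp add: K_def\<close>)
    next
      case 2
      show ?thesis by (rule near[OF S2[OF 2] B]) (use t in \<open>simp add: K_def\<close>)
    next
      case 3
      then have "norm (p (s, t)) \<le> B" using t by (intro B) (auto simp: K_def)
      then show ?thesis by simp
    qed
  qed
  have "norm (p (s, t)) \<le> B + 1" for s t
  proof -
    obtain k :: int where k: "t + of_int k * \<tau> \<in> {0..\<tau>}" using periodic_reduce[OF tau] by blast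
    then show ?thesis using 1[OF k, of s] periodic_int[of "\<lambda>t. p (s, t)" \<tau> t k] p(2) by simp
  qed
  then show thesis using that[of "B + 1"] by (metis surj_pair)
qed


text \<open>Integrand of the derivative of the action along the cylinder \<open>(x, p)\<close>.\<close>

definition cyl_rate :: "('n::finite \<Rightarrow> torus2 \<Rightarrow> real) \<Rightarrow> (real \<Rightarrow> 'n torus \<Rightarrow> real) \<Rightarrow>
    (real \<times> real \<Rightarrow> 'n vect) \<Rightarrow> (real \<times> real \<Rightarrow> 'n vect) \<Rightarrow> real \<Rightarrow> real \<Rightarrow> real" where
  "cyl_rate a V x p s t = omega a (torus_cover (x (s, t)), p (s, t)) (D1 x (s, t), D1 p (s, t)) (D2 x (s, t), D2 p (s, t))
     - (p (s, t) \<bullet> D1 p (s, t) + grad_V V t (x (s, t)) \<bullet> D1 x (s, t))"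

lemma D1_periodic:
  fixes f :: "real \<times> real \<Rightarrow> 'a::real_normed_vector"
  assumes f: "smooth_on UNIV f" and per: "\<And>s t. f (s, t + \<tau>) = f (s, t) + c"
  shows "D1 f (s, t + \<tau>) = D1 f (s, t)"
proof (rule vector_derivative_unique_at)
  show "((\<lambda>s. f (s, t + \<tau>)) has_vector_derivative D1 f (s, t + \<tau>)) (at s)"
    by (rule D1_has_vector_derivative[OF f]) simp
  show "((\<lambda>s. f (s, t + \<tau>)) has_vector_derivative D1 f (s, t)) (at s)"
    unfolding per using D1_has_vector_derivative[OF f, of s t] by (auto intro!: derivative_eq_intros)
qed

text \<open>In one lift of the concatenation of \<open>zm\<close> with the compactified cylinder,
  the magnetic areas of both cappings become differences of a single functional at the parameters 0,
  1/2 and 1. The action along \<open>u\<close> therefore has limits at both ends whose difference is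
  that of the critical values.\<close>

lemma moduli_lift:
  fixes a :: "'n::finite \<Rightarrow> torus2 \<Rightarrow> real"
  assumes tau: "0 < \<tau>" and a: "smooth_coeffs a" and V: "smooth_potential \<tau> V"
    and c: "c_minus \<in> Crit a V \<tau> h" "c_plus \<in> Crit a V \<tau> h"
    and u: "u \<in> moduli a V J \<tau> h c_minus c_plus"
  obtains x p \<A> lm lp P where "smooth_on UNIV x" "smooth_on UNIV p"
    "\<And>w. u w = (torus_cover (x w), p w)"
    "\<And>s t. p (s, t + \<tau>) = p (s, t)" "\<And>s t. x (s, t + \<tau>) = x (s, t) + of_int_vect h"
    "\<And>w. norm (p w) \<le> P"
    "(\<A> \<longlongrightarrow> lm) at_bot" "(\<A> \<longlongrightarrow> lp) at_top" "lm - lp = action a V \<tau> c_minus - action a V \<tau> c_plus"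
    "\<And>s. (\<A> has_real_derivative integral {0..\<tau>} (cyl_rate a V x p s)) (at s)"
    "\<And>s. cyl_rate a V x p s integrable_on {0..\<tau>}"
proof -
  have um: "smooth_phase_on UNIV u" "\<And>s t. u (s, t + \<tau>) = u (s, t)"
    using u unfolding moduli_def by blast+
  obtain wm zm wp zp where wz: "(wm, zm) \<in> c_minus" "(wp, zp) \<in> c_plus"
    and asy: "asymptotic at_bot wm u" "asymptotic at_top wp u"
    and cls: "capped_class a \<tau> h wp (concat_cyl zm (fst \<circ> compactify wm wp u)) = capped_class a \<tau> h wp zp"
    using u unfolding moduli_def by blast
  define zc where "zc = concat_cyl zm (fst \<circ> compactify wm wp u)"
  have cl: "c_minus \<in> loop_space a \<tau> h" "c_plus \<in> loop_space a \<tau> h" using c by (auto simp: Crit_def)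
  note rm = action_representative[OF cl(1) wz(1)] and rp = action_representative[OF cl(2) wz(2)]
  \<comment> \<open>The condition in \<open>moduli\<close> is an equality of sets. As
    \<open>(wp, zp)\<close> lies in the right-hand one, it is related to \<open>(wp, zc)\<close>;
    this places \<open>zc\<close> among the cappings and equates the areas.\<close>
  have "(wp, zp) \<in> capped_class a \<tau> h wp zc"
    unfolding zc_def cls using rp(1) by (simp add: capped_class_def capped_rel_def)
  then have zc: "(wp, zc) \<in> capped_loops \<tau> h" "magnetic_area a \<tau> zc = magnetic_area a \<tau> zp"
    by (auto simp: capped_class_def capped_rel_def)
  have capc: "capping \<tau> h wp zc" and capm: "capping \<tau> h wm zm"
    and sw: "smooth_phase_on UNIV wp" "smooth_phase_on UNIV wm"
    using zc(1) rm(1) by (auto simp: capped_loops_def)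
  obtain Z G where Z: "continuous_on ({0..1} \<times> UNIV) Z" "continuous_on ({0..1} \<times> UNIV) G"
    "\<And>s t. s \<in> {0..1} \<Longrightarrow> torus_cover (Z (s, t)) = zc (s, t)"
    "\<And>s t. s \<in> {0..1} \<Longrightarrow> Z (s, t + \<tau>) = Z (s, t) + of_int_vect h"
    "\<And>s t. s \<in> {0..1} \<Longrightarrow> ((\<lambda>t. Z (s, t)) has_vector_derivative G (s, t)) (at t)"
    using capping_lift[OF tau capc] by metis
  have hint: "of_int_vect h $ j $ i \<in> \<int>" for j i by (simp add: of_int_vect_def)
  obtain B where B: "loop_area a \<tau> (of_int_vect h) B"
    by (rule loop_area_functional[OF a tau, where h = "of_int_vect h"]) (use hint in auto)
  define b where "b r = B (\<lambda>t. Z (r, t)) (\<lambda>t. G (r, t))" for r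
  have area_c: "magnetic_area a \<tau> zc = b 1 - b 0"
  proof -
    obtain S where S: "finite S" "smooth_torus_on (({0<..<1} - S) \<times> UNIV) zc"
      using capc unfolding capping_def by blast
    show ?thesis
      unfolding b_def
      by (rule magnetic_area_lift[where B = B and a = a and \<tau> = \<tau> and z = zc and Z = Z and G = G, OF B S Z])
  qed
  have area_m: "magnetic_area a \<tau> zm = b (1/2) - b 0"
  proof -
    obtain S where S: "finite S" "smooth_torus_on (({0<..<1} - S) \<times> UNIV) zm"
      using capm unfolding capping_def by blast
    \<comment> \<open>The first half of the lift, reparametrised, lifts \<open>zm\<close>. The
      factor 1/2 in \<open>s\<close> leaves the derivative in \<open>t\<close> unchanged.\<close>
    define Zm Gm where "Zm y = Z (fst y / 2, snd y)" and "Gm y = G (fst y / 2, snd y)" for y :: "real \<times> real"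
    have c: "continuous_on ({0..1} \<times> UNIV) Zm" "continuous_on ({0..1} \<times> UNIV) Gm"
      unfolding Zm_def Gm_def
      by (rule continuous_on_compose2[OF Z(1)] continuous_on_compose2[OF Z(2)]; auto intro!: continuous_intros)+
    have zz: "zc (s / 2, t) = zm (s, t)" if "s \<in> {0..1}" for s t
      using that by (simp add: zc_def concat_cyl_def)
    have "magnetic_area a \<tau> zm = B (\<lambda>t. Zm (1, t)) (\<lambda>t. Gm (1, t)) - B (\<lambda>t. Zm (0, t)) (\<lambda>t. Gm (0, t))"
    proof (rule magnetic_area_lift[where B = B and a = a and \<tau> = \<tau> and z = zm and Z = Zm and G = Gm, OF B S c])
      fix s t :: real assume s: "s \<in> {0..1}"
      then have s2: "s / 2 \<in> {0..1}" by simp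
      show "torus_cover (Zm (s, t)) = zm (s, t)" using Z(3)[OF s2] zz[OF s] by (simp add: Zm_def)
      show "Zm (s, t + \<tau>) = Zm (s, t) + of_int_vect h" using Z(4)[OF s2] by (simp add: Zm_def)
      show "((\<lambda>t. Zm (s, t)) has_vector_derivative Gm (s, t)) (at t)" using Z(5)[OF s2] by (simp add: Zm_def Gm_def)
    qed
    then show ?thesis by (simp add: Zm_def Gm_def b_def)
  qed
  \<comment> \<open>Inverse of the change of parameter in \<open>compactify\<close>, moved to the
    second half of [0, 1]: \<open>r = 1 / (1 + exp (- s))\<close> solves
    \<open>ln (r / (1 - r)) = s\<close>.\<close>
  define \<rho> where "\<rho> s = (1 + 1 / (1 + exp (- s))) / 2" for s :: real
  have rho: "\<rho> s \<in> {1/2<..<1}" for s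
  proof -
    have "0 < 1 / (1 + exp (- s))" "1 / (1 + exp (- s)) < 1"
      using exp_gt_zero[of "- s"] by (simp_all add: add_pos_pos)
    then show ?thesis by (simp add: \<rho>_def)
  qed
  have rho01: "\<rho> s \<in> {0..1}" for s using rho[of s] by auto
  have zrho: "zc (\<rho> s, t) = fst (u (s, t))" for s t
  proof -
    define l where "l = 1 / (1 + exp (- s))"
    have e: "0 < 1 + exp (- s)" by (simp add: add_pos_pos)
    have "2 * \<rho> s - 1 = l" unfolding \<rho>_def l_def[symmetric] by argo
    moreover have "0 < l" "l < 1" using e by (simp_all add: l_def)
    ultimately have l: "0 < l" "l < 1" "2 * \<rho> s - 1 = l" by auto
    have "1 - l = exp (- s) * l" using e by (simp add: l_def field_simps)
    then have "l / (1 - l) = exp s" using l by (simp add: exp_minus field_simps)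
    then have "ln (l / (1 - l)) = s" by simp
    then show ?thesis using rho[of s] l
      by (simp add: zc_def concat_cyl_def compactify_def)
  qed
  have crho: "continuous_on UNIV \<rho>"
  proof -
    have "1 + exp (- s) \<noteq> 0" for s :: real using exp_gt_zero[of "- s"] by argo
    then show ?thesis unfolding \<rho>_def by (intro continuous_intros) auto
  qed
  have lim_rho: "(\<rho> \<longlongrightarrow> 1/2) at_bot" "(\<rho> \<longlongrightarrow> 1) at_top"
  proof -
    have "((\<lambda>s. (1 + 1 / (1 + exp (- s))) / 2) \<longlongrightarrow> (1 + 1 / (1 + 0)) / (2::real)) at_top"
      by (intro tendsto_intros filterlim_compose[OF exp_at_bot filterlim_uminus_at_bot_at_top]) auto
    then show "(\<rho> \<longlongrightarrow> 1) at_top" by (simp add: \<rho>_def[abs_def])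
    \<comment> \<open>Expanding the fraction by \<open>exp s\<close> replaces the divergent
      \<open>exp (- s)\<close> by a term that tends to 0.\<close>
    have "((\<lambda>s. (1 + exp s / (1 + exp s)) / 2) \<longlongrightarrow> (1 + 0 / (1 + 0)) / (2::real)) at_bot"
      by (intro tendsto_intros exp_at_bot) auto
    moreover have "(1 + exp s / (1 + exp s)) / 2 = \<rho> s" for s :: real
    proof -
      have "1 + exp s \<noteq> 0" by (metis add_pos_pos exp_gt_zero less_irrefl zero_less_one)
      then show ?thesis by (simp add: \<rho>_def exp_minus field_simps)
    qed
    ultimately show "(\<rho> \<longlongrightarrow> 1/2) at_bot" by simp
  qed
  \<comment> \<open>The second half of the concatenated cylinder is the compactification of \<open>u\<close>, so that its lift
    provides one of \<open>u\<close>.\<close>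
  define x where "x y = Z (\<rho> (fst y), snd y)" for y
  define p where "p y = snd (u y)" for y
  have cx: "continuous_on UNIV x"
    unfolding x_def by (rule continuous_on_compose2[OF Z(1)])
      (use rho01 in \<open>auto intro!: continuous_intros continuous_on_UNIV_compose[OF crho]\<close>)
  have ux: "u y = (torus_cover (x y), p y)" for y
    using Z(3)[OF rho01, of "fst y" "snd y"] zrho[of "fst y" "snd y"] by (simp add: x_def p_def)
  have x: "smooth_on UNIV x"
    by (rule smooth_lift[OF open_UNIV _ cx, of "fst \<circ> u"]) (use um(1) ux in \<open>auto simp: smooth_phase_on_def\<close>)
  have p: "smooth_on UNIV p"
    using um(1) by (simp add: smooth_phase_on_def p_def[abs_def] o_def)
  have pper: "p (s, t + \<tau>) = p (s, t)" for s t by (simp add: p_def um(2))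
  have xper: "x (s, t + \<tau>) = x (s, t) + of_int_vect h" for s t by (simp add: x_def Z(4)[OF rho01])
  have GD: "D2 x (s, t) = G (\<rho> s, t)" for s t
  proof (rule vector_derivative_unique_at)
    show "((\<lambda>t. x (s, t)) has_vector_derivative D2 x (s, t)) (at t)"
      by (rule D2_has_vector_derivative[OF x]) simp
    show "((\<lambda>t. x (s, t)) has_vector_derivative G (\<rho> s, t)) (at t)"
      using Z(5)[OF rho01] by (simp add: x_def)
  qed
  have cp: "continuous_on UNIV p" by (rule smooth_on_continuous[OF p])
  have plim: "uniform_limit UNIV (\<lambda>s t. p (s, t)) (\<lambda>t. snd (w t)) F" if "asymptotic F w u" for F w
  proof (rule uniform_limitI)
    fix e :: real assume "0 < e"
    then have "\<forall>\<^sub>F s in F. \<forall>t\<in>UNIV. dist (u (s, t)) (w t) < e"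
      using that unfolding asymptotic_def by (blast dest: uniform_limitD)
    then show "\<forall>\<^sub>F s in F. \<forall>t\<in>UNIV. dist (p (s, t)) (snd (w t)) < e"
      by eventually_elim (auto simp: p_def intro: le_less_trans[OF dist_snd_le])
  qed
  have csnd: "continuous_on UNIV (\<lambda>t. snd (w t))" if "smooth_phase_on UNIV w" for w :: "real \<Rightarrow> 'n phase"
    using that smooth_on_continuous[of UNIV "snd \<circ> w"] by (simp add: smooth_phase_on_def o_def)
  obtain P where P: "\<And>w. norm (p w) \<le> P"
    using momentum_bounded[OF tau cp pper csnd[OF sw(2)] csnd[OF sw(1)] plim[OF asy(1)] plim[OF asy(2)]] by blast
  \<comment> \<open>The action of the circle at \<open>s\<close>, with \<open>B\<close> in place of
    the area of a capping. It is off by the constant \<open>b 0\<close>, which cancels in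
    differences.\<close>
  define \<A> where "\<A> s = integral {0..\<tau>} (\<lambda>t. p (s, t) \<bullet> D2 x (s, t))
       - integral {0..\<tau>} (\<lambda>t. (norm (p (s, t)))\<^sup>2 / 2 + V t (torus_cover (x (s, t))))
       + B (\<lambda>t. x (s, t)) (\<lambda>t. D2 x (s, t))" for s
  define I where "I w = integral {0..\<tau>} (\<lambda>t. snd (w t) \<bullet> fst (phase_vel w t)) - integral {0..\<tau>} (\<lambda>t. hamiltonian V t (w t))" for w
  have cb: "continuous_on {0..1} b" unfolding b_def by (rule loop_area_continuous[OF B Z(1,2)])
  have lim: "(\<A> \<longlongrightarrow> I w + b r0) F"
    if "asymptotic F w u" "(\<rho> \<longlongrightarrow> r0) F" "r0 \<in> {0..1}" "F \<noteq> bot" "smooth_phase_on UNIV w" "\<And>t. fst (w t) = zc (r0, t)" for F w r0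
  proof -
    have w: "fst (w t) = torus_cover (Z (r0, t))" for t using that(6) Z(3)[OF that(3)] by simp
    have "((\<lambda>s. b (\<rho> s)) \<longlongrightarrow> b r0) F"
      by (intro continuous_on_tendsto_compose[OF cb that(2,3)]) (simp add: rho01[simplified])
    from tendsto_add[OF hamiltonian_terms_limit[OF V Z(1,2,5) rho01 that(3,2,4,5) w cp plim[OF that(1)]] this]
    show ?thesis unfolding \<A>_def[abs_def] I_def b_def GD by (simp add: x_def)
  qed
  have lm: "(\<A> \<longlongrightarrow> I wm + b (1/2)) at_bot"
  proof (rule lim[OF asy(1) lim_rho(1) _ _ sw(2)])
    show "fst (wm t) = zc (1/2, t)" for t
      using capm by (simp add: capping_def zc_def concat_cyl_def)
  qed auto
  have lp: "(\<A> \<longlongrightarrow> I wp + b 1) at_top"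
  proof (rule lim[OF asy(2) lim_rho(2) _ _ sw(1)])
    show "fst (wp t) = zc (1, t)" for t using capc by (simp add: capping_def)
  qed auto
  have diff: "(I wm + b (1/2)) - (I wp + b 1) = action a V \<tau> c_minus - action a V \<tau> c_plus"
    unfolding rm(2) rp(2) pair_action_def I_def using area_c area_m zc(2) by simp
  have "(\<A> has_real_derivative integral {0..\<tau>} (cyl_rate a V x p s)) (at s) \<and>
     cyl_rate a V x p s integrable_on {0..\<tau>}" for s
  proof -
    have cont: "continuous_on UNIV (D1 x)" "continuous_on UNIV (D2 x)" "continuous_on UNIV (D1 (D2 x))"
      "continuous_on UNIV (D1 p)" "continuous_on UNIV (D2 p)"
      by (intro smooth_on_continuous smooth_on_D1 smooth_on_D2 x p)+
    note cc = cx[THEN continuous_on_UNIV_compose] cp[THEN continuous_on_UNIV_compose] cont[THEN continuous_on_UNIV_compose]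
    have D1per: "D1 x (s, \<tau>) = D1 x (s, 0)"
      using D1_periodic[OF x xper, of s 0] by simp
    have 1: "((\<lambda>s. integral {0..\<tau>} (\<lambda>t. p (s, t) \<bullet> D2 x (s, t))) has_real_derivative
      integral {0..\<tau>} (\<lambda>t. D1 p (s, t) \<bullet> D2 x (s, t) - D2 p (s, t) \<bullet> D1 x (s, t))
      + (p (s, \<tau>) \<bullet> D1 x (s, \<tau>) - p (s, 0) \<bullet> D1 x (s, 0))) (at s)"
    proof (rule cylinder_stokes[where U = UNIV and ?X12.0 = "\<lambda>s t. D1 (D2 x) (s, t)"])
      fix s t :: real
      show "((\<lambda>t. D1 x (s, t)) has_vector_derivative D1 (D2 x) (s, t)) (at t)"
        unfolding D1_D2_commute[OF open_UNIV x UNIV_I] by (rule D2_has_vector_derivative[OF smooth_on_D1[OF x] UNIV_I])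
      show "((\<lambda>s. D2 x (s, t)) has_vector_derivative D1 (D2 x) (s, t)) (at s)"
        by (rule D1_has_vector_derivative[OF smooth_on_D2[OF x] UNIV_I])
    qed (use tau in \<open>auto intro!: continuous_intros cc D1_has_vector_derivative[OF p UNIV_I] D2_has_vector_derivative[OF p UNIV_I] simp: case_prod_beta'\<close>)
    have pp: "p (s, \<tau>) = p (s, 0)" using pper[of s 0] by simp
    have 2: "((\<lambda>s. integral (cbox 0 \<tau>) (\<lambda>t. (norm (p (s, t)))\<^sup>2 / 2 + V t (torus_cover (x (s, t))))) has_vector_derivative
        integral (cbox 0 \<tau>) (\<lambda>t. p (s, t) \<bullet> D1 p (s, t) + grad_V V t (x (s, t)) \<bullet> D1 x (s, t))) (at s within UNIV)"
    proof (rule leibniz_rule_vector_derivative)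
      fix s t :: real
      have "((\<lambda>s. p (s, t)) has_derivative (\<lambda>r. r *\<^sub>R D1 p (s, t))) (at s)"
        using D1_has_vector_derivative[OF p UNIV_I] by (simp add: has_vector_derivative_def)
      then have A: "((\<lambda>s. (norm (p (s, t)))\<^sup>2 / 2) has_derivative (\<lambda>r. r * (p (s, t) \<bullet> D1 p (s, t)))) (at s)"
        unfolding power2_norm_eq_inner
        by (auto intro!: derivative_eq_intros simp: inner_commute)
      have "((\<lambda>s. x (s, t)) has_derivative (\<lambda>r. r *\<^sub>R D1 x (s, t))) (at s)"
        using D1_has_vector_derivative[OF x UNIV_I] by (simp add: has_vector_derivative_def)
      from has_derivative_add[OF A has_derivative_compose[OF this V_has_derivative[OF V]]]
      show "((\<lambda>s. (norm (p (s, t)))\<^sup>2 / 2 + V t (torus_cover (x (s, t)))) has_vector_derivative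
          p (s, t) \<bullet> D1 p (s, t) + grad_V V t (x (s, t)) \<bullet> D1 x (s, t)) (at s within UNIV)"
        unfolding has_vector_derivative_def by (rule has_derivative_eq_rhs) (auto simp: algebra_simps)
    next
      fix s
      show "(\<lambda>t. (norm (p (s, t)))\<^sup>2 / 2 + V t (torus_cover (x (s, t)))) integrable_on cbox 0 \<tau>"
        unfolding cbox_interval
        by (intro integrable_continuous_real continuous_intros cc V_continuous[OF V]) auto
    next
      show "continuous_on (UNIV \<times> cbox 0 \<tau>) (\<lambda>(s, t). p (s, t) \<bullet> D1 p (s, t) + grad_V V t (x (s, t)) \<bullet> D1 x (s, t))"
        unfolding case_prod_beta' by (intro continuous_intros cc grad_V_continuous[OF V])
    qed auto
    have 3: "((\<lambda>s. B (\<lambda>t. x (s, t)) (\<lambda>t. D2 x (s, t))) has_real_derivative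
         integral {0..\<tau>} (\<lambda>t. magnetic_form a (torus_cover (x (s, t))) (D1 x (s, t)) (D2 x (s, t)))) (at s)"
      by (rule loop_area_derivative[OF B, of UNIV]) (use x xper[of _ 0] in auto)
    have ca: "continuous_on UNIV (a j \<circ> q2)" for j
      using a by (intro smooth_on_continuous) (simp add: smooth_coeffs_def)
    have cm: "continuous_on {0..\<tau>} (\<lambda>t. magnetic_form a (torus_cover (x (s, t))) (D1 x (s, t)) (D2 x (s, t)))"
    proof -
      have "continuous_on {0..\<tau>} (\<lambda>t. (a j \<circ> q2) (x (s, t) $ j))" for j
        by (rule continuous_on_UNIV_compose[OF ca]) (intro continuous_intros cc)
      then have "continuous_on {0..\<tau>} (\<lambda>t. a j (torus_cover (x (s, t)) $ j))" for j by (simp add: torus_cover_def)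
      then show ?thesis unfolding magnetic_form_def area_form_def by (intro continuous_intros cc)
    qed
    have i1: "(\<lambda>t. D1 p (s, t) \<bullet> D2 x (s, t) - D2 p (s, t) \<bullet> D1 x (s, t)) integrable_on {0..\<tau>}"
      and i2: "(\<lambda>t. p (s, t) \<bullet> D1 p (s, t) + grad_V V t (x (s, t)) \<bullet> D1 x (s, t)) integrable_on {0..\<tau>}"
      and i3: "(\<lambda>t. magnetic_form a (torus_cover (x (s, t))) (D1 x (s, t)) (D2 x (s, t))) integrable_on {0..\<tau>}"
      by (intro integrable_continuous_real continuous_intros cc grad_V_continuous[OF V] cm)+
    define I1 where "I1 t = D1 p (s, t) \<bullet> D2 x (s, t) - D2 p (s, t) \<bullet> D1 x (s, t)" for t
    define I2 where "I2 t = p (s, t) \<bullet> D1 p (s, t) + grad_V V t (x (s, t)) \<bullet> D1 x (s, t)" for t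
    define I3 where "I3 t = magnetic_form a (torus_cover (x (s, t))) (D1 x (s, t)) (D2 x (s, t))" for t
    have "cyl_rate a V x p s = (\<lambda>t. I1 t - I2 t + I3 t)"
      by (rule ext) (simp add: cyl_rate_def omega_def dlambda_def inner_commute I1_def I2_def I3_def)
    moreover have "((\<lambda>t. I1 t - I2 t + I3 t) has_integral
        integral {0..\<tau>} I1 - integral {0..\<tau>} I2 + integral {0..\<tau>} I3) {0..\<tau>}"
      by (intro has_integral_add has_integral_diff integrable_integral)
        (use i1 i2 i3 in \<open>simp_all add: I1_def[abs_def] I2_def[abs_def] I3_def[abs_def]\<close>)
    ultimately have rate: "(cyl_rate a V x p s has_integral
        integral {0..\<tau>} I1 - integral {0..\<tau>} I2 + integral {0..\<tau>} I3) {0..\<tau>}" by simp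
    have "(\<A> has_real_derivative integral {0..\<tau>} (cyl_rate a V x p s)) (at s)"
      using DERIV_add[OF DERIV_diff[OF 1 2[unfolded cbox_interval has_real_derivative_iff_has_vector_derivative[symmetric]]] 3]
      unfolding D1per pp \<A>_def[abs_def] integral_unique[OF rate] I1_def[abs_def] I2_def[abs_def] I3_def[abs_def] by simp
    then show ?thesis using rate by (blast intro: has_integral_integrable)
  qed
  then show thesis using that[OF x p ux pper xper P lm lp diff] by blast
qed

section \<open>Dissipation of the action\<close>

lemma omega_skew: "omega a y \<xi> \<eta> = - omega a y \<eta> \<xi>"
proof -
  have "magnetic_form a z v w = - magnetic_form a z w v" for z v w
    unfolding magnetic_form_def sum_negf[symmetric]
    by (intro sum.cong) (auto simp: area_form_def algebra_simps)
  then have "magnetic_form a (fst y) (fst \<xi>) (fst \<eta>) = - magnetic_form a (fst y) (fst \<eta>) (fst \<xi>)" .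
  then show ?thesis by (simp add: omega_def dlambda_def inner_commute)
qed

lemma omega_add_left: "omega a y (\<xi> + \<xi>') \<eta> = omega a y \<xi> \<eta> + omega a y \<xi>' \<eta>"
proof -
  have "magnetic_form a z (v + v') w = magnetic_form a z v w + magnetic_form a z v' w" for z v v' w
    unfolding magnetic_form_def sum.distrib[symmetric]
    by (intro sum.cong) (auto simp: area_form_def algebra_simps)
  then show ?thesis by (simp add: omega_def dlambda_def inner_add_left)
qed

text \<open>After the Floer equation is inserted into \<open>cyl_rate\<close>, the Hamiltonian
  vector field cancels the differential of the Hamiltonian, and minus \<open>omega\<close> of (J us,
  us) remains. So the action decreases at least at the rate \<open>e\<close> times the energy, and
  its total drop is at most \<open>lm - lp\<close>.\<close>

lemma floer_energy:
  fixes a :: "'n::finite \<Rightarrow> torus2 \<Rightarrow> real" and x p :: "real \<times> real \<Rightarrow> 'n vect"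
  assumes x: "smooth_on UNIV x" and p: "smooth_on UNIV p" and e: "0 \<le> e"
    and lim: "(\<A> \<longlongrightarrow> lm) at_bot" "(\<A> \<longlongrightarrow> lp) at_top"
    and dA: "\<And>s. (\<A> has_real_derivative integral {0..\<tau>} (cyl_rate a V x p s)) (at s)"
    and ut: "\<And>s t. (D2 x (s, t), D2 p (s, t)) =
     (p (s, t), - grad_V V t (x (s, t)) - magnetic_map a (torus_cover (x (s, t))) (p (s, t)))
     + blinfun_apply (J s t) (D1 x (s, t), D1 p (s, t))"
    and J: "\<And>s t \<xi>. e * (norm \<xi>)\<^sup>2 \<le> omega a (torus_cover (x (s, t)), p (s, t)) (blinfun_apply (J s t) \<xi>) \<xi>"
    and rate_int: "\<And>s. (cyl_rate a V x p s) integrable_on {0..\<tau>}"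
    and s12: "s1 \<le> s2"
  shows "e * integral {s1..s2} (\<lambda>s. integral {0..\<tau>} (\<lambda>t. (norm (D1 x (s, t)))\<^sup>2 + (norm (D1 p (s, t)))\<^sup>2)) \<le> lm - lp"
proof -
  define \<epsilon> where "\<epsilon> s = integral {0..\<tau>} (\<lambda>t. (norm (D1 x (s, t)))\<^sup>2 + (norm (D1 p (s, t)))\<^sup>2)" for s
  have c: "continuous_on UNIV (D1 x)" "continuous_on UNIV (D1 p)"
    by (intro smooth_on_continuous smooth_on_D1 x p)+
  note cc = c[THEN continuous_on_UNIV_compose]
  have ceps: "continuous_on UNIV \<epsilon>"
    unfolding \<epsilon>_def[abs_def] cbox_interval[symmetric]
    by (rule integral_continuous_on_param) (auto simp: case_prod_beta' intro!: continuous_intros cc)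
  have rate: "cyl_rate a V x p s t \<le> - (e * ((norm (D1 x (s, t)))\<^sup>2 + (norm (D1 p (s, t)))\<^sup>2))" for s t
  proof -
    let ?us = "(D1 x (s, t), D1 p (s, t))"
    let ?y = "(torus_cover (x (s, t)), p (s, t))"
    let ?X = "(p (s, t), - grad_V V t (x (s, t)) - magnetic_map a (torus_cover (x (s, t))) (p (s, t)))"
    let ?W = "blinfun_apply (J s t) ?us"
    have "omega a ?y ?us (?X + ?W) = - omega a ?y ?X ?us - omega a ?y ?W ?us"
      using omega_skew[of a ?y ?us "?X + ?W"]
      by (simp only: omega_add_left)
    moreover have "omega a ?y ?X ?us = - (p (s, t) \<bullet> D1 p (s, t) + grad_V V t (x (s, t)) \<bullet> D1 x (s, t))"
      by (simp add: omega_def dlambda_def magnetic_form_map inner_diff_left)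
    ultimately have "cyl_rate a V x p s t = - omega a ?y ?W ?us"
      unfolding cyl_rate_def ut by simp
    then show ?thesis using J[of ?us s t] by (simp add: norm_prod_def)
  qed
  have dAle: "integral {0..\<tau>} (cyl_rate a V x p s) \<le> - (e * \<epsilon> s)" for s
  proof -
    have "integral {0..\<tau>} (cyl_rate a V x p s) \<le> integral {0..\<tau>} (\<lambda>t. - (e * ((norm (D1 x (s, t)))\<^sup>2 + (norm (D1 p (s, t)))\<^sup>2)))"
      by (intro integral_le rate_int rate integrable_continuous_real continuous_intros cc)
    then show ?thesis by (simp add: \<epsilon>_def)
  qed
  obtain K where K: "\<And>s. (K has_vector_derivative \<epsilon> s) (at s)"
    using has_antiderivative[OF ceps] by blast
  have anti: "\<A> s' + e * K s' \<le> \<A> s + e * K s" if "s \<le> s'" for s s'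
  proof (rule DERIV_nonpos_imp_nonincreasing[OF that])
    fix r
    have "((\<lambda>s. \<A> s + e * K s) has_real_derivative integral {0..\<tau>} (cyl_rate a V x p r) + e * \<epsilon> r) (at r)"
      using K[of r] by (intro DERIV_add dA DERIV_cmult) (simp add: has_real_derivative_iff_has_vector_derivative)
    then show "\<exists>y. ((\<lambda>s. \<A> s + e * K s) has_real_derivative y) (at r) \<and> y \<le> 0"
      using dAle[of r] by (intro exI conjI) auto
  qed
  have eps0: "0 \<le> \<epsilon> s" for s
    unfolding \<epsilon>_def by (intro integral_nonneg integrable_continuous_real continuous_intros cc) auto
  have decr: "\<A> s' \<le> \<A> s" if "s \<le> s'" for s s'
  proof (rule DERIV_nonpos_imp_nonincreasing[OF that])
    fix r
    have "integral {0..\<tau>} (cyl_rate a V x p r) \<le> 0"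
      using dAle[of r] eps0[of r] e by (meson mult_nonneg_nonneg neg_le_0_iff_le order_trans)
    then show "\<exists>y. (\<A> has_real_derivative y) (at r) \<and> y \<le> 0" using dA by blast
  qed
  have "\<A> s1 \<le> lm"
    by (rule tendsto_lowerbound[OF lim(1)]) (auto simp: eventually_at_bot_linorder intro!: exI[of _ s1] decr)
  moreover have "lp \<le> \<A> s2"
    by (rule tendsto_upperbound[OF lim(2)]) (auto simp: eventually_at_top_linorder intro!: exI[of _ s2] decr)
  moreover have i: "integral {s1..s2} \<epsilon> = K s2 - K s1"
    by (intro integral_unique fundamental_theorem_of_calculus s12 K[THEN has_vector_derivative_at_within])
  ultimately have "e * integral {s1..s2} \<epsilon> \<le> lm - lp"
    using anti[OF s12] unfolding i right_diff_distrib by linarith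
  then show ?thesis by (simp add: \<epsilon>_def[abs_def])
qed

section \<open>The a priori bound\<close>

lemma C1_norm_square:
  fixes f :: "real \<times> real \<Rightarrow> 'a::euclidean_space"
  assumes "smooth_on UNIV f"
  shows "C1 (\<lambda>w. (norm (f w))\<^sup>2) (\<lambda>w. 2 * (f w \<bullet> D1 f w)) (\<lambda>w. 2 * (f w \<bullet> D2 f w))"
  unfolding C1_def
proof (intro conjI allI)
  fix z
  show "((\<lambda>w. (norm (f w))\<^sup>2) has_derivative
      (\<lambda>h. fst h *\<^sub>R (2 * (f z \<bullet> D1 f z)) + snd h *\<^sub>R (2 * (f z \<bullet> D2 f z)))) (at z)"
    unfolding power2_norm_eq_inner
    by (rule has_derivative_eq_rhs[OF has_derivative_inner[OF has_derivative_D12[OF assms UNIV_I] has_derivative_D12[OF assms UNIV_I]]])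
      (auto simp: inner_add_right inner_add_left inner_commute algebra_simps)
qed (intro continuous_intros smooth_on_continuous smooth_on_D1 smooth_on_D2 assms)+

lemma C1_add:
  assumes "C1 f f1 f2" "C1 g g1 g2"
  shows "C1 (\<lambda>w. f w + g w) (\<lambda>w. f1 w + g1 w) (\<lambda>w. f2 w + g2 w)"
  unfolding C1_def
proof (intro conjI allI continuous_on_add C1_continuous[OF assms(1)] C1_continuous[OF assms(2)])
  fix z
  show "((\<lambda>w. f w + g w) has_derivative (\<lambda>h. fst h *\<^sub>R (f1 z + g1 z) + snd h *\<^sub>R (f2 z + g2 z))) (at z)"
    by (rule has_derivative_eq_rhs[OF has_derivative_add[OF C1_has_derivative[OF assms(1)] C1_has_derivative[OF assms(2)]]])
      (auto simp: algebra_simps)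
qed

lemma integral_three_periods:
  fixes f :: "real \<Rightarrow> real"
  assumes "0 < \<tau>" "continuous_on UNIV f" "\<And>t. f (t + \<tau>) = f t"
  shows "integral {-\<tau>..2*\<tau>} f = 3 * integral {0..\<tau>} f"
proof -
  have i: "f integrable_on {a..b}" for a b
    by (intro integrable_continuous_real continuous_on_subset[OF assms(2)]) simp
  have "integral {0 - \<tau>..\<tau> - \<tau>} (\<lambda>t. f (t + \<tau>)) = integral {0..\<tau>} f" by (rule integral_shift_real_ivl)
  then have 1: "integral {-\<tau>..0} f = integral {0..\<tau>} f" by (simp add: assms(3))
  have "f (t - \<tau>) = f t" for t using assms(3)[of "t - \<tau>"] by simp
  then have 2: "integral {\<tau>..2*\<tau>} f = integral {0..\<tau>} f"
    using integral_shift_real_ivl[of 0 "-\<tau>" \<tau> f] by simp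
  have "integral {-\<tau>..2*\<tau>} f = integral {-\<tau>..0} f + integral {0..2*\<tau>} f"
    by (rule Henstock_Kurzweil_Integration.integral_combine[symmetric, OF _ _ i]) (use assms in auto)
  also have "integral {0..2*\<tau>} f = integral {0..\<tau>} f + integral {\<tau>..2*\<tau>} f"
    by (rule Henstock_Kurzweil_Integration.integral_combine[symmetric, OF _ _ i]) (use assms in auto)
  finally show ?thesis using 1 2 by simp
qed

text \<open>Averaging over the outer half of the interval, of length R / 2. The summand 1 in
  \<open>K + 1\<close> makes the contradiction strict, and the lower bound for \<open>r\<close>
  allows a later division by it.\<close>

lemma exists_small_radius:
  fixes f :: "real \<Rightarrow> real"
  assumes "0 < R" "continuous_on {0..R} f" "\<And>r. 0 \<le> r \<Longrightarrow> 0 \<le> f r" "integral {0..R} f \<le> K"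
  obtains r where "R / 2 \<le> r" "r \<le> R" "f r \<le> 2 * (K + 1) / R"
proof (rule ccontr)
  assume no: "\<not> thesis"
  note obt = that
  have big: "2 * (K + 1) / R \<le> f r" if "r \<in> {R/2..R}" for r
  proof (rule ccontr)
    assume "\<not> 2 * (K + 1) / R \<le> f r"
    then show False using no obt[of r] that by simp
  qed
  have "K + 1 = integral {R/2..R} (\<lambda>r. 2 * (K + 1) / R)" using assms(1) by simp
  also have "\<dots> \<le> integral {R/2..R} f"
    by (intro integral_le integrable_continuous_real continuous_on_subset[OF assms(2)] big) (use assms(1) in auto)
  also have "\<dots> \<le> integral {0..R} f"
    by (intro integral_subset_le integrable_continuous_real continuous_on_subset[OF assms(2)]) (use assms in auto)
  finally show False using assms(4) by simp
qed

text \<open>The bound is named in order to show that it depends on these numbers only. It results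
  from solving P - 1 < 1 + 2c/R + Mc + (1 + P)/2 for \<open>P\<close>, where \<open>c\<close> bounds
  \<open>r\<close> times the integral of g + |p|^2 over a suitable circle of radius
  \<open>r\<close>.\<close>

definition apriori_const :: "real \<Rightarrow> real \<Rightarrow> real \<Rightarrow> real \<Rightarrow> real \<Rightarrow> real \<Rightarrow> real" where
  "apriori_const \<tau> M F0 K1 Cp E = (let R = min \<tau> (1 / (2 * (F0 + 2*pi*M)));
      c = 2 * ((K1 + 1) * (3 + 2 * \<tau> * (1 + Cp)) * (2 * R + E) + 1) / R
    in 3 + 2 * (1 + 2 * c / R + M * c))"

text \<open>The supremum \<open>P\<close> of the norm of \<open>p\<close> is finite by assumption. It is nearly attained at some
  point, and the interior estimate at that point yields \<open>P \<le> c + P / 2\<close> with a constant \<open>c\<close>, as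
  soon as the circle is small and carries little of the integral of \<open>g + |p|\<^sup>2\<close>.\<close>

lemma apriori_bound:
  fixes x p :: "real \<times> real \<Rightarrow> 'a::euclidean_space"
  assumes tau: "0 < \<tau>" and M: "1 \<le> M" and F0: "0 \<le> F0" and K1: "0 \<le> K1" and Cp: "0 \<le> Cp" and E: "0 \<le> E"
    and x: "smooth_on UNIV x" and p: "smooth_on UNIV p"
    and g: "\<And>w. g w = (norm (D1 x w))\<^sup>2 + (norm (D2 x w))\<^sup>2 + (norm (D1 p w))\<^sup>2 + (norm (D2 p w))\<^sup>2"
    and n: "\<And>w. n w = (norm (D1 x w))\<^sup>2 + (norm (D1 p w))\<^sup>2"
    and per: "\<And>s t. p (s, t + \<tau>) = p (s, t)" "\<And>s t. n (s, t + \<tau>) = n (s, t)"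
    and bdd: "bdd_above (range (\<lambda>w. norm (p w)))"
    and gM: "\<And>w. g w \<le> M * (D2 p w \<bullet> D1 x w - D1 p w \<bullet> D2 x w) + F0 * (1 + (norm (p w))\<^sup>2)"
    and gK: "\<And>w. g w \<le> K1 * (n w + 1 + (norm (p w))\<^sup>2)"
    and slice: "\<And>s t. (norm (p (s, t)))\<^sup>2 \<le> Cp * (1 + integral {0..\<tau>} (\<lambda>t. n (s, t)))"
    and energy: "\<And>s1 s2. s1 \<le> s2 \<Longrightarrow> integral {s1..s2} (\<lambda>s. integral {0..\<tau>} (\<lambda>t. n (s, t))) \<le> E"
  shows "norm (p w0) \<le> apriori_const \<tau> M F0 K1 Cp E"
proof -
  \<comment> \<open>The first bound keeps the square around the centre within three periods; the
    second limits the coefficient of \<open>1 + P\<close> in the interior estimate to 1/2.\<close>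
  define R0 where "R0 = min \<tau> (1 / (2 * (F0 + 2*pi*M)))"
  have FM: "0 < F0 + 2*pi*M" using F0 M by (intro add_nonneg_pos mult_pos_pos) auto
  have half: "1 / (2 * y) * y = 1/2" if "0 < y" for y :: real using that by simp
  have R0: "0 < R0" "R0 \<le> \<tau>" "R0 * (F0 + 2*pi*M) \<le> 1/2"
  proof -
    show "0 < R0" "R0 \<le> \<tau>" using tau FM by (auto simp: R0_def)
    have "R0 * (F0 + 2*pi*M) \<le> 1 / (2 * (F0 + 2*pi*M)) * (F0 + 2*pi*M)"
      using FM by (intro mult_right_mono) (auto simp: R0_def)
    also have "\<dots> = 1/2" using half[OF FM] .
    finally show "R0 * (F0 + 2*pi*M) \<le> 1/2" .
  qed
  define K2 where "K2 = (K1 + 1) * (3 + 2 * \<tau> * (1 + Cp))"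
  have K2: "0 \<le> K2" using K1 Cp tau by (simp add: K2_def)
  define K3 where "K3 = K2 * (2 * R0 + E) + 1"
  define c where "c = 2 * K3 / R0"
  define B where "B = 3 + 2 * (1 + 2 * c / R0 + M * c)"
  define P where "P = (SUP w. norm (p w))"
  have P: "norm (p w) \<le> P" for w unfolding P_def by (rule cSUP_upper[OF UNIV_I bdd])
  have P0: "0 \<le> P" using P[of w0] norm_ge_zero order_trans by blast
  \<comment> \<open>The supremum need not be attained, hence the loss of 1.\<close>
  have "P - 1 < (SUP w. norm (p w))" by (simp add: P_def)
  then obtain w1 where w1: "P - 1 < norm (p w1)"
    using less_cSUP_iff[OF _ bdd] by auto
  obtain s0 t1 where st: "w1 = (s0, t1)" by (cases w1)
  obtain k :: int where k: "t1 + of_int k * \<tau> \<in> {0..\<tau>}" using periodic_reduce[OF tau] by blast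
  define t0 where "t0 = t1 + of_int k * \<tau>"
  have pz: "P - 1 < norm (p (s0, t0))"
    using w1 periodic_int[of "\<lambda>t. p (s0, t)" \<tau> t1 k] per(1) by (simp add: t0_def st)
  have t0: "0 \<le> t0" "t0 \<le> \<tau>" using k by (auto simp: t0_def)
  define \<epsilon> where "\<epsilon> s = integral {0..\<tau>} (\<lambda>t. n (s, t))" for s
  define G where "G w = g w + (norm (p w))\<^sup>2" for w
  have cont: "continuous_on UNIV (D1 x)" "continuous_on UNIV (D2 x)" "continuous_on UNIV (D1 p)" "continuous_on UNIV (D2 p)" "continuous_on UNIV p"
    by (intro smooth_on_continuous smooth_on_D1 smooth_on_D2 x p)+
  note cc = cont[THEN continuous_on_UNIV_compose]
  have cn: "continuous_on S (\<lambda>t. n (f t))" if "continuous_on S f" for S and f :: "'b::topological_space \<Rightarrow> real \<times> real"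
    unfolding n by (intro continuous_intros cc that)
  have cG: "continuous_on S (\<lambda>t. G (f t))" if "continuous_on S f" for S and f :: "'b::topological_space \<Rightarrow> real \<times> real"
    unfolding G_def g by (intro continuous_intros cc that)
  have n0: "0 \<le> n w" and G0: "0 \<le> G w" for w by (auto simp: n G_def g)
  have eps0: "0 \<le> \<epsilon> s" for s
    unfolding \<epsilon>_def by (intro integral_nonneg integrable_continuous_real cn continuous_intros n0)
  have ceps: "continuous_on S \<epsilon>" for S
    unfolding \<epsilon>_def[abs_def] cbox_interval[symmetric]
    by (rule integral_continuous_on_param) (auto simp: case_prod_beta' intro!: continuous_intros cn)
  have C1G: "\<exists>G1 G2. C1 G G1 G2"
    unfolding G_def[abs_def] g
    by (intro exI, rule C1_add, (rule C1_add)+; rule C1_norm_square; intro smooth_on_D1 smooth_on_D2 x p)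
  \<comment> \<open>The slice bound replaces |p|^2 by the energy of the circle, so that the integral
    of \<open>G\<close> over a square is controlled by \<open>E\<close>.\<close>
  have GK: "G (s, t) \<le> (K1 + 1) * n (s, t) + (K1 + 1) * (1 + Cp) * (1 + \<epsilon> s)" for s t
  proof -
    have "G (s, t) \<le> (K1 + 1) * (n (s, t) + 1 + (norm (p (s, t)))\<^sup>2)"
      using gK[of "(s, t)"] n0[of "(s, t)"] unfolding G_def distrib_right by simp
    also have "\<dots> \<le> (K1 + 1) * (n (s, t) + (1 + \<epsilon> s) + Cp * (1 + \<epsilon> s))"
      using K1 slice[of s t] eps0[of s] by (intro mult_left_mono add_mono) (auto simp: \<epsilon>_def)
    finally show ?thesis by (simp add: algebra_simps)
  qed
  have inner: "integral {t0 - R0..t0 + R0} (\<lambda>t. G (s, t)) \<le> K2 * (1 + \<epsilon> s)" for s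
  proof -
    have "integral {t0 - R0..t0 + R0} (\<lambda>t. G (s, t)) \<le>
        integral {t0 - R0..t0 + R0} (\<lambda>t. (K1 + 1) * n (s, t) + (K1 + 1) * (1 + Cp) * (1 + \<epsilon> s))"
      by (intro integral_le integrable_continuous_real cG cn continuous_intros GK)
    also have "\<dots> = (K1 + 1) * integral {t0 - R0..t0 + R0} (\<lambda>t. n (s, t)) + 2 * R0 * ((K1 + 1) * (1 + Cp) * (1 + \<epsilon> s))"
      by (subst integral_add) (use R0 in \<open>auto intro!: integrable_continuous_real cn continuous_intros\<close>)
    also have "\<dots> \<le> (K1 + 1) * (3 * (1 + \<epsilon> s)) + 2 * \<tau> * ((K1 + 1) * (1 + Cp) * (1 + \<epsilon> s))"
    proof (intro add_mono mult_left_mono mult_right_mono)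
      have "integral {t0 - R0..t0 + R0} (\<lambda>t. n (s, t)) \<le> integral {-\<tau>..2*\<tau>} (\<lambda>t. n (s, t))"
        by (intro integral_subset_le integrable_continuous_real cn continuous_intros) (use R0 t0 n0 in auto)
      also have "\<dots> = 3 * \<epsilon> s"
        unfolding \<epsilon>_def by (rule integral_three_periods[OF tau]) (auto intro!: cn continuous_intros simp: per)
      finally show "integral {t0 - R0..t0 + R0} (\<lambda>t. n (s, t)) \<le> 3 * (1 + \<epsilon> s)" by simp
    qed (use K1 Cp eps0[of s] R0 in auto)
    also have "\<dots> = K2 * (1 + \<epsilon> s)" by (simp add: K2_def algebra_simps)
    finally show ?thesis .
  qed
  define F where "F r = r * integral {0..2*pi} (\<lambda>\<theta>. G (polar (s0, t0) r \<theta>))" for r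
  have cF: "continuous_on {0..R0} F"
    unfolding F_def[abs_def] cbox_interval[symmetric]
    by (intro continuous_intros integral_continuous_on_param)
      (auto simp: case_prod_beta' intro!: continuous_intros cG)
  have Fpos: "0 \<le> F r" if "0 \<le> r" for r
    unfolding F_def using that
    by (intro mult_nonneg_nonneg integral_nonneg integrable_continuous_real cG continuous_intros G0)
  have "integral {0..R0} F \<le> integral {s0 - R0..s0 + R0} (\<lambda>s. integral {t0 - R0..t0 + R0} (\<lambda>t. G (s, t)))"
  proof -
    obtain G1 G2 where "C1 G G1 G2" using C1G by blast
    from disc_integral_le_square[OF this G0 R0(1), where z = "(s0, t0)"]
    show ?thesis by (simp add: F_def[abs_def])
  qed
  also have "\<dots> \<le> integral {s0 - R0..s0 + R0} (\<lambda>s. K2 * (1 + \<epsilon> s))"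
  proof (intro integral_le integrable_continuous_real continuous_intros ceps inner)
    show "continuous_on {s0 - R0..s0 + R0} (\<lambda>s. integral {t0 - R0..t0 + R0} (\<lambda>t. G (s, t)))"
      unfolding cbox_interval[symmetric]
      by (rule integral_continuous_on_param) (auto simp: case_prod_beta' intro!: continuous_intros cG)
  qed
  also have "\<dots> = K2 * (2 * R0 + integral {s0 - R0..s0 + R0} \<epsilon>)"
    using R0 by (simp add: integral_add integrable_continuous_real ceps)
  also have "\<dots> \<le> K2 * (2 * R0 + E)"
    using energy[of "s0 - R0" "s0 + R0"] R0 K2 by (intro mult_left_mono) (auto simp: \<epsilon>_def[abs_def])
  finally obtain r where r: "R0 / 2 \<le> r" "r \<le> R0" "F r \<le> c"
    using exists_small_radius[OF R0(1) cF Fpos] unfolding c_def K3_def by blast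
  have r0: "0 < r" using r R0 by simp
  define d where "d = integral {0..2*pi} (\<lambda>\<theta>. g (polar (s0, t0) r \<theta>))"
  define N where "N = integral {0..2*pi} (\<lambda>\<theta>. (norm (p (polar (s0, t0) r \<theta>)))\<^sup>2)"
  have ig: "(\<lambda>\<theta>. g (polar (s0, t0) r \<theta>)) integrable_on {0..2*pi}"
    and ip: "(\<lambda>\<theta>. (norm (p (polar (s0, t0) r \<theta>)))\<^sup>2) integrable_on {0..2*pi}"
    unfolding g by (intro integrable_continuous_real continuous_intros cc)+
  have FdN: "F r = r * d + r * N"
    unfolding F_def G_def d_def N_def using integral_add[OF ig ip] by (simp add: distrib_left)
  have d0: "0 \<le> d" and N0: "0 \<le> N"
    unfolding d_def N_def by (intro integral_nonneg ig ip; simp add: g)+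
  have rd: "r * d \<le> c" and rN: "r * N \<le> c"
    using r(3) r0 d0 N0 mult_nonneg_nonneg[of r d] mult_nonneg_nonneg[of r N] unfolding FdN by linarith+
  have "R0 / 2 * N \<le> r * N" using r N0 by (intro mult_right_mono) auto
  then have N: "N \<le> 2 * c / R0" using rN R0 by (simp add: field_simps)
  have mean: "norm (integral {0..2*pi} (\<lambda>\<theta>. p (polar (s0, t0) r \<theta>))) / (2*pi) \<le> 1 + 2 * c / R0"
  proof -
    have "norm (integral {0..2*pi} (\<lambda>\<theta>. p (polar (s0, t0) r \<theta>))) \<le>
        integral {0..2*pi} (\<lambda>\<theta>. 1 + (norm (p (polar (s0, t0) r \<theta>)))\<^sup>2)"
    proof (intro integral_norm_bound_integral integrable_continuous_real continuous_intros cc)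
      fix \<theta>
      have "0 \<le> (norm (p (polar (s0, t0) r \<theta>)) - 1)\<^sup>2" by simp
      then have "2 * norm (p (polar (s0, t0) r \<theta>)) \<le> 1 + (norm (p (polar (s0, t0) r \<theta>)))\<^sup>2"
        unfolding power2_diff by simp
      then show "norm (p (polar (s0, t0) r \<theta>)) \<le> 1 + (norm (p (polar (s0, t0) r \<theta>)))\<^sup>2"
        using norm_ge_zero[of "p (polar (s0, t0) r \<theta>)"] by linarith
    qed
    also have "\<dots> = 2*pi + N"
      unfolding N_def by (subst integral_add[OF _ ip]) auto
    finally have "norm (integral {0..2*pi} (\<lambda>\<theta>. p (polar (s0, t0) r \<theta>))) / (2*pi) \<le> (2*pi + N) / (2*pi)"
      by (intro divide_right_mono) auto
    also have "\<dots> = 1 + N / (2*pi)" by (simp add: field_simps)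
    also have "N / (2*pi) \<le> N / 1" using N0 pi_gt3 by (intro divide_left_mono) auto
    finally show ?thesis using N by simp
  qed
  \<comment> \<open>\<open>interior_estimate\<close> with Q = 1 + P and F = F0 (1 + P^2), so that
    both F / Q and Q are at most a multiple of 1 + P.\<close>
  have "norm (p (s0, t0)) \<le> norm (integral {0..2*pi} (\<lambda>\<theta>. p (polar (s0, t0) r \<theta>))) / (2*pi)
    + r * (M * d / (1 + P) + F0 * (1 + P\<^sup>2) / (1 + P) + 2 * pi * M * (1 + P))"
    unfolding d_def
  proof (rule interior_estimate[OF x p M _ r0 _ g])
    fix w
    have "F0 * (1 + (norm (p w))\<^sup>2) \<le> F0 * (1 + P\<^sup>2)"
      using F0 P by (intro mult_left_mono add_left_mono power_mono) auto
    then show "g w \<le> M * (D2 p w \<bullet> D1 x w - D1 p w \<bullet> D2 x w) + F0 * (1 + P\<^sup>2)"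
      using gM[of w] by linarith
  qed (use F0 P0 in auto)
  also have "\<dots> \<le> (1 + 2 * c / R0) + (M * c + (1 + P) / 2)"
  proof (rule add_mono[OF mean])
    have "M * d / (1 + P) \<le> M * d / 1" using M d0 P0 by (intro divide_left_mono) auto
    moreover have "F0 * (1 + P\<^sup>2) / (1 + P) \<le> F0 * (1 + P)"
    proof -
      have "F0 * (1 + P\<^sup>2) \<le> F0 * ((1 + P) * (1 + P))"
        using F0 P0 by (intro mult_left_mono) (auto simp: power2_eq_square algebra_simps)
      then show ?thesis using P0 by (simp add: pos_divide_le_eq mult.assoc)
    qed
    ultimately have "r * (M * d / (1 + P) + F0 * (1 + P\<^sup>2) / (1 + P) + 2 * pi * M * (1 + P))
        \<le> r * (M * d + F0 * (1 + P) + 2 * pi * M * (1 + P))"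
      using r0 by (intro mult_left_mono) auto
    also have "\<dots> = M * (r * d) + (r * (F0 + 2*pi*M)) * (1 + P)" by (simp add: algebra_simps)
    also have "\<dots> \<le> M * c + (1/2) * (1 + P)"
    proof (intro add_mono mult_left_mono mult_right_mono rd)
      show "r * (F0 + 2*pi*M) \<le> 1/2"
        using mult_right_mono[OF r(2), of "F0 + 2*pi*M"] FM R0(3) by linarith
    qed (use M P0 in auto)
    finally show "r * (M * d / (1 + P) + F0 * (1 + P\<^sup>2) / (1 + P) + 2 * pi * M * (1 + P)) \<le> M * c + (1 + P) / 2"
      by simp
  qed
  finally have "P \<le> B" using pz unfolding B_def by argo
  moreover have "B = apriori_const \<tau> M F0 K1 Cp E"
    by (simp add: B_def c_def K3_def K2_def R0_def apriori_const_def Let_def)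
  ultimately show ?thesis using P order_trans by blast
qed

lemma continuous_on_magnetic_map:
  assumes a: "smooth_coeffs a" and "continuous_on S x" "continuous_on S v"
  shows "continuous_on S (\<lambda>y. magnetic_map a (torus_cover (x y)) (v y))"
proof -
  have ca: "continuous_on UNIV (a j \<circ> q2)" for j
    using a by (intro smooth_on_continuous) (simp add: smooth_coeffs_def)
  have "continuous_on S (\<lambda>y. (a j \<circ> q2) (x y $ j))" for j
    by (rule continuous_on_UNIV_compose[OF ca]) (intro continuous_intros assms)
  then have 1: "continuous_on S (\<lambda>y. a j (torus_cover (x y) $ j))" for j by (simp add: torus_cover_def)
  have rot: "rot w = - (w $ 2) *\<^sub>R axis 1 1 + (w $ 1) *\<^sub>R axis 2 1" for w
    by (auto simp: rot_def vec_eq_iff forall_2 axis_def)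
  show ?thesis
    unfolding magnetic_map_def rot by (intro continuous_on_vec_lambda continuous_intros 1 assms)
qed

text \<open>All constants are fixed before \<open>J\<close>, the class \<open>h\<close> and the
  cylinder. \<open>J\<close> enters through \<open>e\<close> and the norm bound \<open>L\<close>,
  and \<open>x\<close> through its derivatives and periodic quantities, whence the
  uniformity.\<close>

lemma floer_momentum_bound:
  fixes a :: "'n::finite \<Rightarrow> torus2 \<Rightarrow> real"
  assumes tau: "0 < \<tau>" and a: "smooth_coeffs a" and nr: "non_resonant a \<tau>" and V: "smooth_potential \<tau> V"
    and A: "0 < A" and e: "e = min A (1 / A) / 2" and E: "0 \<le> E"
  obtains B where "\<And>J h c_minus c_plus u w. (\<And>t. J t \<in> acs_nbhd a A e) \<Longrightarrow>
    c_minus \<in> Crit a V \<tau> h \<Longrightarrow> c_plus \<in> Crit a V \<tau> h \<Longrightarrow>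
    action a V \<tau> c_minus - action a V \<tau> c_plus \<le> E \<Longrightarrow>
    u \<in> moduli a V J \<tau> h c_minus c_plus \<Longrightarrow> norm (snd (u w)) \<le> B"
proof -
  have e0: "0 < e" using A by (simp add: e)
  obtain Cg where Cg: "0 < Cg" "\<And>t x. norm (grad_V V t x) \<le> Cg" using grad_V_bounded[OF tau V] by blast
  obtain Ca where Ca: "0 < Ca" "\<And>j y. \<bar>a j y\<bar> \<le> Ca" using coeffs_bounded[OF a] by blast
  obtain Cm where Cm: "0 < Cm"
    "\<And>x p f t. continuous_on UNIV x \<Longrightarrow> continuous_on UNIV f \<Longrightarrow>
      (\<And>t. (p has_vector_derivative f t - magnetic_map a (torus_cover (x t)) (p t)) (at t)) \<Longrightarrow>
      p \<tau> = p 0 \<Longrightarrow> t \<in> {0..\<tau>} \<Longrightarrow> norm (p t) \<le> Cm * integral {0..\<tau>} (\<lambda>t. norm (f t))"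
    by (rule momentum_slice_bound[OF tau a nr]) blast
  define L where "L = norm (J_ref A :: 'n tangent \<Rightarrow>\<^sub>L 'n tangent) + e"
  have L: "0 \<le> L" using e0 by (simp add: L_def)
  define CX where "CX = 1 + 2 * Cg\<^sup>2 + 2 * Ca\<^sup>2"
  define M where "M = (1 + 2 * L\<^sup>2 + e) * (2 / e)"
  define F' where "F' = (1 + 2 * L\<^sup>2 + e) / e\<^sup>2 + 2"
  define K1 where "K1 = 1 + 2 * L\<^sup>2 + 2 * CX"
  \<comment> \<open>The factors come from the slice bound \<open>Cm\<close>, from Cauchy-Schwarz on
    an interval of length \<tau>, and from the pointwise bound \<open>f2\<close> below.\<close>
  define Cp where "Cp = Cm\<^sup>2 * \<tau> * (2 * Cg\<^sup>2 * \<tau> + 2 * L\<^sup>2)"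
  have M1: "1 \<le> M"
  proof -
    have "1 \<le> e * (2 / e)" using e0 by simp
    also have "\<dots> \<le> M" unfolding M_def using e0 by (intro mult_right_mono) auto
    finally show ?thesis .
  qed
  have CX0: "0 \<le> CX" by (simp add: CX_def)
  have F'0: "0 \<le> F'" using e0 by (simp add: F'_def)
  have K10: "0 \<le> K1" using CX0 by (simp add: K1_def)
  have Cp0: "0 \<le> Cp" unfolding Cp_def using tau by (intro mult_nonneg_nonneg add_nonneg_nonneg) auto
  define B where "B = apriori_const \<tau> M (F' * CX) K1 Cp (4 / e * E)"
  show thesis
  proof (rule that[of B])
    fix J h c_minus c_plus u w
    assume J: "\<And>t. J t \<in> acs_nbhd a A e"
      and c: "c_minus \<in> Crit a V \<tau> h" "c_plus \<in> Crit a V \<tau> h"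
      and act: "action a V \<tau> c_minus - action a V \<tau> c_plus \<le> E"
      and u: "u \<in> moduli a V J \<tau> h c_minus c_plus"
    note Jp = acs_nbhd_properties[OF A e J, folded L_def]
    obtain x p \<A> lm lp P where x: "smooth_on UNIV x" and p: "smooth_on UNIV p"
      and ux: "\<And>w. u w = (torus_cover (x w), p w)"
      and per: "\<And>s t. p (s, t + \<tau>) = p (s, t)" "\<And>s t. x (s, t + \<tau>) = x (s, t) + of_int_vect h"
      and P: "\<And>w. norm (p w) \<le> P"
      and lim: "(\<A> \<longlongrightarrow> lm) at_bot" "(\<A> \<longlongrightarrow> lp) at_top" "lm - lp = action a V \<tau> c_minus - action a V \<tau> c_plus"
      and dA: "\<And>s. (\<A> has_real_derivative integral {0..\<tau>} (cyl_rate a V x p s)) (at s)"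
        "\<And>s. cyl_rate a V x p s integrable_on {0..\<tau>}"
      by (rule moduli_lift[OF tau a V c u]) blast
    have fl: "floer_eq a V J u" using u unfolding moduli_def by blast
    define us where "us s t = (D1 x (s, t), D1 p (s, t))" for s t
    define ut where "ut s t = (D2 x (s, t), D2 p (s, t))" for s t
    define X where "X s t = (p (s, t), - grad_V V t (x (s, t)) - magnetic_map a (torus_cover (x (s, t))) (p (s, t)))" for s t
    have ut: "ut s t = X s t + blinfun_apply (J t (u (s, t))) (us s t)" for s t
      unfolding ut_def X_def us_def by (rule floer_eq_lift[OF V Jp(1) ux x p fl])
    define g where "g w = (norm (D1 x w))\<^sup>2 + (norm (D2 x w))\<^sup>2 + (norm (D1 p w))\<^sup>2 + (norm (D2 p w))\<^sup>2" for w
    define n where "n w = (norm (D1 x w))\<^sup>2 + (norm (D1 p w))\<^sup>2" for w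
    have n_us: "n (s, t) = (norm (us s t))\<^sup>2" for s t by (simp add: n_def us_def norm_Pair)
    have g_us: "g (s, t) = (norm (us s t))\<^sup>2 + (norm (ut s t))\<^sup>2" for s t
      by (simp add: g_def us_def ut_def norm_Pair)
    have XB: "(norm (X s t))\<^sup>2 \<le> CX * (1 + (norm (p (s, t)))\<^sup>2)" for s t
    proof -
      have "norm (- grad_V V t (x (s, t)) - magnetic_map a (torus_cover (x (s, t))) (p (s, t))) \<le> Cg + Ca * norm (p (s, t))"
        using norm_triangle_ineq4[of "- grad_V V t (x (s, t))" "magnetic_map a (torus_cover (x (s, t))) (p (s, t))"]
          Cg(2)[of t "x (s, t)"] norm_magnetic_map_le[where a = a and y = "torus_cover (x (s, t))" and v = "p (s, t)", OF Ca(2)] by simp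
      then have "(norm (X s t))\<^sup>2 \<le> (norm (p (s, t)))\<^sup>2 + (Cg + Ca * norm (p (s, t)))\<^sup>2"
        by (simp add: X_def norm_Pair power_mono)
      also have "\<dots> \<le> (norm (p (s, t)))\<^sup>2 + ((Cg + Ca * norm (p (s, t)))\<^sup>2 + (Cg - Ca * norm (p (s, t)))\<^sup>2)" by simp
      also have "(Cg + Ca * norm (p (s, t)))\<^sup>2 + (Cg - Ca * norm (p (s, t)))\<^sup>2 = 2 * Cg\<^sup>2 + 2 * Ca\<^sup>2 * (norm (p (s, t)))\<^sup>2"
        by (simp add: power2_eq_square algebra_simps)
      also have "(norm (p (s, t)))\<^sup>2 + (2 * Cg\<^sup>2 + 2 * Ca\<^sup>2 * (norm (p (s, t)))\<^sup>2) \<le> CX * (1 + (norm (p (s, t)))\<^sup>2)"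
        by (simp add: CX_def algebra_simps)
      finally show ?thesis .
    qed
    note bounds = J_gradient_bounds[OF e0 Jp(2) Jp(3) ut]
    show "norm (snd (u w)) \<le> B"
      unfolding ux snd_conv B_def
    proof (rule apriori_bound[OF tau M1 mult_nonneg_nonneg[OF F'0 CX0] K10 Cp0 _ x p g_def n_def per(1)])
      show "0 \<le> 4 / e * E" using e0 E by simp
    next
      fix s t
      show "n (s, t + \<tau>) = n (s, t)"
        using D1_periodic[OF x per(2)] D1_periodic[OF p, of \<tau> 0] per(1) by (simp add: n_def)
    next
      show "bdd_above (range (\<lambda>w. norm (p w)))" using P by (intro bdd_aboveI2)
    next
      fix w :: "real \<times> real"
      obtain s t where w: "w = (s, t)" by (cases w)
      have "g w \<le> M * (D2 p w \<bullet> D1 x w - D1 p w \<bullet> D2 x w) + F' * (norm (X s t))\<^sup>2"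
        using bounds(2)[where s1 = s and t1 = t] unfolding w g_us M_def F'_def by (simp add: us_def ut_def inner_commute)
      also have "\<dots> \<le> M * (D2 p w \<bullet> D1 x w - D1 p w \<bullet> D2 x w) + F' * (CX * (1 + (norm (p w))\<^sup>2))"
        unfolding w by (intro add_left_mono mult_left_mono XB F'0)
      finally show "g w \<le> M * (D2 p w \<bullet> D1 x w - D1 p w \<bullet> D2 x w) + F' * CX * (1 + (norm (p w))\<^sup>2)"
        by (simp add: mult.assoc)
      have n0: "0 \<le> n w" by (simp add: n_def)
      have "g w \<le> (1 + 2 * L\<^sup>2) * n w + 2 * (norm (X s t))\<^sup>2"
        unfolding w g_us n_us by (rule bounds(1))
      also have "\<dots> \<le> (1 + 2 * L\<^sup>2) * n w + 2 * (CX * (1 + (norm (p w))\<^sup>2))"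
        unfolding w by (intro add_left_mono mult_left_mono XB) simp
      also have "\<dots> \<le> (1 + 2 * L\<^sup>2) * (n w + 1 + (norm (p w))\<^sup>2) + 2 * CX * (n w + 1 + (norm (p w))\<^sup>2)"
        unfolding mult.assoc[symmetric] using n0 CX0 by (intro add_mono mult_left_mono) auto
      finally show "g w \<le> K1 * (n w + 1 + (norm (p w))\<^sup>2)" by (simp add: K1_def distrib_right)
    next
      fix s t
      obtain k :: int where k: "t + of_int k * \<tau> \<in> {0..\<tau>}" using periodic_reduce[OF tau] by blast
      \<comment> \<open>The vertical part of the Floer equation without its magnetic term: the
        right-hand side in \<open>momentum_slice_bound\<close>, in the form that is bounded by
        \<open>us\<close>.\<close>
      define f where "f t = - grad_V V t (x (s, t)) + snd (blinfun_apply (J t (u (s, t))) (us s t))" for t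
      \<comment> \<open>This form of \<open>f\<close> shows its continuity.\<close>
      have f_eq: "f t = D2 p (s, t) + magnetic_map a (torus_cover (x (s, t))) (p (s, t))" for t
        using arg_cong[OF ut[of s t], of snd] by (simp add: ut_def X_def f_def)
      have "continuous_on UNIV x" "continuous_on UNIV p" "continuous_on UNIV (D1 x)" "continuous_on UNIV (D1 p)" "continuous_on UNIV (D2 p)"
        by (intro smooth_on_continuous smooth_on_D1 smooth_on_D2 x p)+
      note cc = this[THEN continuous_on_UNIV_compose]
      have cx: "continuous_on UNIV (\<lambda>t. x (s, t))" and cp: "continuous_on UNIV (\<lambda>t. p (s, t))"
        and cDp: "continuous_on UNIV (\<lambda>t. D2 p (s, t))"
        by (intro cc continuous_intros)+
      have cn: "continuous_on {0..\<tau>} (\<lambda>t. n (s, t))"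
        unfolding n_def by (intro continuous_intros cc)
      have cf: "continuous_on UNIV f"
        unfolding f_eq by (intro continuous_intros cDp continuous_on_magnetic_map[OF a] cx cp)
      have cf': "continuous_on {0..\<tau>} (\<lambda>t. norm (f t))"
        by (intro continuous_intros continuous_on_subset[OF cf]) simp
      have f2: "(norm (f t))\<^sup>2 \<le> 2 * Cg\<^sup>2 + 2 * L\<^sup>2 * n (s, t)" for t
      proof -
        have snd_le: "norm (snd v) \<le> norm v" for v :: "'n tangent"
          using norm_snd_le[of "snd v" "fst v"] by simp
        have "norm (f t) \<le> norm (grad_V V t (x (s, t))) + norm (snd (blinfun_apply (J t (u (s, t))) (us s t)))"
          unfolding f_def by (rule norm_triangle_le) simp
        also have "\<dots> \<le> Cg + L * norm (us s t)"
          by (intro add_mono Cg(2) order_trans[OF snd_le Jp(3)])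
        finally have "(norm (f t))\<^sup>2 \<le> (Cg + L * norm (us s t))\<^sup>2" by (intro power_mono) auto
        also have "\<dots> \<le> (Cg + L * norm (us s t))\<^sup>2 + (Cg - L * norm (us s t))\<^sup>2" by simp
        also have "\<dots> = 2 * Cg\<^sup>2 + 2 * L\<^sup>2 * n (s, t)"
          unfolding n_us by (simp add: power2_eq_square algebra_simps)
        finally show ?thesis .
      qed
      define \<epsilon> where "\<epsilon> = integral {0..\<tau>} (\<lambda>t. n (s, t))"
      have eps0: "0 \<le> \<epsilon>"
        unfolding \<epsilon>_def by (intro integral_nonneg integrable_continuous_real cn) (simp add: n_def)
      have "(integral {0..\<tau>} (\<lambda>t. norm (f t)))\<^sup>2 \<le> \<tau> * integral {0..\<tau>} (\<lambda>t. (norm (f t))\<^sup>2)"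
        using integral_square_le[OF _ cf'] tau by simp
      also have "\<dots> \<le> \<tau> * integral {0..\<tau>} (\<lambda>t. 2 * Cg\<^sup>2 + 2 * L\<^sup>2 * n (s, t))"
        using tau by (intro mult_left_mono integral_le integrable_continuous_real continuous_intros cf' cn f2) auto
      also have "\<dots> = \<tau> * (2 * Cg\<^sup>2 * \<tau> + 2 * L\<^sup>2 * \<epsilon>)"
        unfolding \<epsilon>_def using tau by (subst integral_add) (auto intro!: integrable_continuous_real continuous_intros cn)
      also have "\<dots> \<le> \<tau> * ((2 * Cg\<^sup>2 * \<tau> + 2 * L\<^sup>2) * (1 + \<epsilon>))"
        using tau eps0 by (intro mult_left_mono) (auto simp: algebra_simps)
      finally have f3: "(integral {0..\<tau>} (\<lambda>t. norm (f t)))\<^sup>2 \<le> \<tau> * ((2 * Cg\<^sup>2 * \<tau> + 2 * L\<^sup>2) * (1 + \<epsilon>))" .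
      have "norm (p (s, t + of_int k * \<tau>)) \<le> Cm * integral {0..\<tau>} (\<lambda>t. norm (f t))"
      proof (rule Cm(2)[OF cx cf _ _ k])
        show "((\<lambda>t. p (s, t)) has_vector_derivative f t - magnetic_map a (torus_cover (x (s, t))) (p (s, t))) (at t)" for t
          unfolding f_eq using D2_has_vector_derivative[OF p UNIV_I] by simp
        show "p (s, \<tau>) = p (s, 0)" using per(1)[of s 0] by simp
      qed
      then have "norm (p (s, t)) \<le> Cm * integral {0..\<tau>} (\<lambda>t. norm (f t))"
        using periodic_int[of "\<lambda>t. p (s, t)" \<tau> t k] per(1) by simp
      then have "(norm (p (s, t)))\<^sup>2 \<le> (Cm * integral {0..\<tau>} (\<lambda>t. norm (f t)))\<^sup>2" by (intro power_mono) auto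
      also have "\<dots> \<le> Cm\<^sup>2 * (\<tau> * ((2 * Cg\<^sup>2 * \<tau> + 2 * L\<^sup>2) * (1 + \<epsilon>)))"
        unfolding power_mult_distrib by (intro mult_left_mono f3) simp
      finally show "(norm (p (s, t)))\<^sup>2 \<le> Cp * (1 + integral {0..\<tau>} (\<lambda>t. n (s, t)))"
        unfolding Cp_def \<epsilon>_def by (simp add: mult.assoc)
    next
      fix s1 s2 :: real assume "s1 \<le> s2"
      \<comment> \<open>\<open>e / 4\<close> combines the factor 1/4 in \<open>acs_nbhd\<close> with
        the uniform lower bound \<open>e\<close> for \<open>dlambda\<close>.\<close>
      have "e / 4 * integral {s1..s2} (\<lambda>s. integral {0..\<tau>} (\<lambda>t. n (s, t))) \<le> lm - lp"
        unfolding n_def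
      proof (rule floer_energy[OF x p _ lim(1,2) dA(1) _ _ dA(2) \<open>s1 \<le> s2\<close>])
        show "(D2 x (s, t), D2 p (s, t)) =
          (p (s, t), - grad_V V t (x (s, t)) - magnetic_map a (torus_cover (x (s, t))) (p (s, t)))
          + blinfun_apply (J t (u (s, t))) (D1 x (s, t), D1 p (s, t))" for s t
          using ut[of s t] by (simp add: ut_def X_def us_def)
        show "e / 4 * (norm \<xi>)\<^sup>2 \<le> omega a (torus_cover (x (s, t)), p (s, t)) (blinfun_apply (J t (u (s, t))) \<xi>) \<xi>" for s t \<xi>
          using Jp(4)[of \<xi> "u (s, t)" t] by (simp add: ux)
      qed (use e0 in simp)
      then show "integral {s1..s2} (\<lambda>s. integral {0..\<tau>} (\<lambda>t. n (s, t))) \<le> 4 / e * E"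
        using lim(3) act e0 by (simp add: field_simps)
    qed
  qed
qed

theorem theorem3p11:
  fixes a :: "'n::finite \<Rightarrow> torus2 \<Rightarrow> real"
    and V :: "real \<Rightarrow> 'n torus \<Rightarrow> real"
    and \<tau> A :: real
  assumes "\<tau> > 0"
    and "smooth_coeffs a"
    and "non_resonant a \<tau>"
    and "smooth_potential \<tau> V"
    and "non_degenerate a V \<tau>"
    and "A > 0"
    and "A \<ge> (MAX j. SUP x. \<bar>a j x\<bar>)"
  shows "\<exists>\<epsilon>\<^sub>0>0. \<forall>J. smooth_family \<tau> J \<and> (\<forall>t. J t \<in> acs_nbhd a A \<epsilon>\<^sub>0) \<longrightarrow>
    (\<forall>C E. E \<ge> 0 \<longrightarrow> (\<exists>K :: 'n phase set. compact K \<and>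
      (\<forall>h. \<forall>c_minus \<in> Crit a V \<tau> h. \<forall>c_plus \<in> Crit a V \<tau> h.
        action a V \<tau> c_minus \<le> C \<and> action a V \<tau> c_minus - action a V \<tau> c_plus \<le> E \<longrightarrow>
        (\<forall>u \<in> moduli a V J \<tau> h c_minus c_plus. range u \<subseteq> K))))"
  proof -
  define e where "e = min A (1 / A) / 2"
  have e0: "0 < e" using \<open>A > 0\<close> by (simp add: e_def)
  have "\<exists>K :: 'n phase set. compact K \<and>
      (\<forall>h. \<forall>c_minus \<in> Crit a V \<tau> h. \<forall>c_plus \<in> Crit a V \<tau> h.
        action a V \<tau> c_minus \<le> C \<and> action a V \<tau> c_minus - action a V \<tau> c_plus \<le> E \<longrightarrow>
        (\<forall>u \<in> moduli a V J \<tau> h c_minus c_plus. range u \<subseteq> K))"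
    if J: "\<forall>t. J t \<in> acs_nbhd a A e" and E: "0 \<le> E" for J C E
  proof -
    obtain B where B: "\<And>J h c_minus c_plus u w. (\<And>t. J t \<in> acs_nbhd a A e) \<Longrightarrow>
      c_minus \<in> Crit a V \<tau> h \<Longrightarrow> c_plus \<in> Crit a V \<tau> h \<Longrightarrow>
      action a V \<tau> c_minus - action a V \<tau> c_plus \<le> E \<Longrightarrow>
      u \<in> moduli a V J \<tau> h c_minus c_plus \<Longrightarrow> norm (snd (u w)) \<le> B"
      using floer_momentum_bound[OF assms(1,2,3,4,6) e_def E] by metis
    \<comment> \<open>The torus is compact, so a ball in the fibre gives the compact set, the same
      one for all classes \<open>h\<close>.\<close>
    have "range u \<subseteq> UNIV \<times> cball 0 B"
      if "c_minus \<in> Crit a V \<tau> h" "c_plus \<in> Crit a V \<tau> h" "action a V \<tau> c_minus - action a V \<tau> c_plus \<le> E"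
        "u \<in> moduli a V J \<tau> h c_minus c_plus" for h c_minus c_plus u
      using B[OF J[rule_format] that] by (simp add: image_subset_iff mem_Times_iff)
    then show ?thesis
      by (intro exI[of _ "UNIV \<times> cball 0 B"] conjI compact_Times compact_torus compact_cball) blast
  qed
  then show ?thesis using e0 by blast
qed

end
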